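(* Let $\Omega\subset\mathbb{R}^n$ be open, bounded and $G$-invariant (i.e. $gx\in\Omega$ for all $g\in G$, $x\in\Omega$), and let $E\subset\mathbb{R}^n$ be measurable with ${\rm Per}^\kappa_{s_0}(E,\Omega)<\infty$ for some $s_0\in(0,1/2)$. Suppose there exist $c_*>0$ and $\eta>2s_0$ such that $$\mu_\kappa\big({\rm D}^\Omega_r(\Omega^c)\big)\le c_*\min\{r^\eta,1\},\quad r\in[0,1].$$ (a) If $\mu_\kappa(E\cap\Omega)=\mu_\kappa(E^c\cap\Omega)$, then $\lim_{s\to0^+}s\,{\rm Per}^\kappa_s(E,\Omega)$ exists and equals $2\mu_\kappa(E\cap\Omega)=2\mu_\kappa(E^c\cap\Omega)$. (b) If $\mu_\kappa(E\cap\Omega)\neq\mu_\kappa(E^c\cap\Omega)$, then $\lim_{s\to0^+}s\,{\rm Per}^\kappa_s(E,\Omega)$ exists if and only if $\Xi^\kappa_E$ exists, and in this case $$\Xi^\kappa_E=\frac{\lim_{s\to0^+}s\,{\rm Per}^\kappa_s(E,\Omega)-2\mu_\kappa(E\cap\Omega)}{2[\mu_\kappa(E^c\cap\Omega)-\mu_\kappa(E\cap\Omega)]}.$$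
   Context: Dunkl setting on $\mathbb{R}^n$: root system $\mathcal{R}$ (finite nonempty subset of $\mathbb{R}^n\setminus\{0\}$ with $\mathcal{R}\cap\alpha\mathbb{R}=\{\pm\alpha\}$, $r_\alpha(\mathcal{R})=\mathcal{R}$, $|\alpha|=\sqrt2$, where $r_\alpha x=x-2\frac{\langle\alpha,x\rangle}{|\alpha|^2}\alpha$), finite reflection group $G$ generated by the $r_\alpha$, positive subsystem $\mathcal{R}_+$, $G$-invariant multiplicity $\kappa:\mathcal{R}\to[0,\infty)$. Dunkl Laplacian $\Delta_\kappa f(x)=\Delta f(x)+2\sum_{\alpha\in\mathcal{R}_+}\kappa(\alpha)\big(\frac{\langle\alpha,\nabla f(x)\rangle}{\langle\alpha,x\rangle}-\frac{f(x)-f(r_\alpha x)}{\langle\alpha,x\rangle^2}\big)$; $\mu_\kappa=w_\kappa\,dx$ with $w_\kappa(x)=\prod_{\alpha\in\mathcal{R}_+}|\langle\alpha,x\rangle|^{2\kappa(\alpha)}$; $(P_t^\kappa)$ the Dunkl heat semigroup generated by $\Delta_\kappa$ with heat kernel $p_t^\kappa$ w.r.t. $\mu_\kappa$. Pseudo-metric $d(x,y)=\min_{g\in G}|x-gy|$, $d(x,A)=\inf_{y\in A}d(x,y)$, $B_d(x,r)=\{y:d(x,y)<r\}$. For disjoint sets $E,F$, ${\rm D}^E_r(F)=\{x\in E: d(x,F)\le r\}$. For $s>0$ and disjoint measurable $A,B$: $L^\kappa_s(A,B)=\int_0^\infty t^{-(1+s)}\int_A P_t^\kappa\mathbf{1}_B(x)\,\mu_\kappa(dx)\,dt$.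 For open $\Omega$, $s\in(0,1/2)$, measurable $E$: ${\rm Per}^\kappa_s(E,\Omega)=2[L^\kappa_s(E\cap\Omega,E^c\cap\Omega)+L^\kappa_s(E\cap\Omega,E^c\cap\Omega^c)+L^\kappa_s(E\cap\Omega^c,E^c\cap\Omega)]$. $\Lambda^\kappa_E(x,r,s)=\int_1^\infty P_t^\kappa(\mathbf{1}_{E\cap B_d(x,r)^c})(x)\,t^{-(1+s)}dt$. "$\Xi^\kappa_E$ exists" means $\lim_{s\to0^+}s\Lambda^\kappa_E(x,r,s)$ exists for some $(x,r)\in\mathbb{R}^n\times(0,\infty)$; the paper shows it then exists for all $(x,r)$ with a common value, denoted $\Xi^\kappa_E$. *)

theory Defs
  imports "HOL-Analysis.Analysis"
begin

definition refl :: "'a::euclidean_space \<Rightarrow> 'a \<Rightarrow> 'a" where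
  "refl \<alpha> x = x - (2 * (\<alpha> \<bullet> x) / (\<alpha> \<bullet> \<alpha>)) *\<^sub>R \<alpha>"

text \<open>The finite reflection group generated by the reflections r_alpha, alpha in R
  (each reflection is an involution, so closure under left composition with
  generators starting from the identity gives the generated group).\<close>
inductive_set refl_group :: "'a::euclidean_space set \<Rightarrow> ('a \<Rightarrow> 'a) set"
  for R :: "'a set" where
  id: "id \<in> refl_group R"
| step: "g \<in> refl_group R \<Longrightarrow> \<alpha> \<in> R \<Longrightarrow> refl \<alpha> \<circ> g \<in> refl_group R"

definition root_system :: "'a::euclidean_space set \<Rightarrow> bool" where
  "root_system R \<longleftrightarrow> finite R \<and> R \<noteq> {} \<and> 0 \<notin> R
     \<and> (\<forall>\<alpha>\<in>R. R \<inter> {c *\<^sub>R \<alpha> | c. True} = {\<alpha>, - \<alpha>})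
     \<and> (\<forall>\<alpha>\<in>R. refl \<alpha> ` R = R)
     \<and> (\<forall>\<alpha>\<in>R. norm \<alpha> = sqrt 2)"

definition positive_subsystem :: "'a::euclidean_space set \<Rightarrow> 'a set \<Rightarrow> bool" where
  "positive_subsystem R Rp \<longleftrightarrow>
     (\<exists>\<beta>. (\<forall>\<alpha>\<in>R. \<alpha> \<bullet> \<beta> \<noteq> 0) \<and> Rp = {\<alpha>\<in>R. \<alpha> \<bullet> \<beta> > 0})"

definition multiplicity :: "'a::euclidean_space set \<Rightarrow> ('a \<Rightarrow> real) \<Rightarrow> bool" where
  "multiplicity R \<kappa> \<longleftrightarrow> (\<forall>\<alpha>\<in>R. \<kappa> \<alpha> \<ge> 0)
     \<and> (\<forall>g\<in>refl_group R. \<forall>\<alpha>\<in>R. \<kappa> (g \<alpha>) = \<kappa> \<alpha>)"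

definition dunkl_setting :: "'a::euclidean_space set \<Rightarrow> 'a set \<Rightarrow> ('a \<Rightarrow> real) \<Rightarrow> bool" where
  "dunkl_setting R Rp \<kappa> \<longleftrightarrow> root_system R \<and> positive_subsystem R Rp \<and> multiplicity R \<kappa>"

text \<open>w_kappa(x) = prod |<alpha,x>|^(2 kappa(alpha)), with the convention |t|^0 = 1.\<close>
definition dunkl_weight :: "'a::euclidean_space set \<Rightarrow> ('a \<Rightarrow> real) \<Rightarrow> 'a \<Rightarrow> real" where
  "dunkl_weight Rp \<kappa> x =
     (\<Prod>\<alpha>\<in>Rp. if \<kappa> \<alpha> = 0 then 1 else \<bar>\<alpha> \<bullet> x\<bar> powr (2 * \<kappa> \<alpha>))"

definition dunkl_measure :: "'a::euclidean_space set \<Rightarrow> ('a \<Rightarrow> real) \<Rightarrow> 'a measure" where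
  "dunkl_measure Rp \<kappa> = density lebesgue (\<lambda>x. ennreal (dunkl_weight Rp \<kappa> x))"

text \<open>Characterisation of the Dunkl kernel E_kappa(x,y): for each y, x |-> E(x,y) is
  C^1, E(0,y) = 1, and T_xi E(.,y) = <xi,y> E(.,y) for every xi (the Dunkl operator
  T_xi f(x) = d_xi f(x) + sum_{alpha in R+} kappa(alpha) <alpha,xi> (f x - f (r_alpha x))/<alpha,x>,
  required off the reflecting hyperplanes; on them it extends by continuity).\<close>
definition is_dunkl_kernel ::
  "'a::euclidean_space set \<Rightarrow> ('a \<Rightarrow> real) \<Rightarrow> ('a \<Rightarrow> 'a \<Rightarrow> real) \<Rightarrow> bool" where
  "is_dunkl_kernel Rp \<kappa> E \<longleftrightarrow>
     (\<forall>y. (\<forall>x. (\<lambda>z. E z y) differentiable (at x))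
        \<and> (\<forall>\<xi>. continuous_on UNIV (\<lambda>x. frechet_derivative (\<lambda>z. E z y) (at x) \<xi>))
        \<and> E 0 y = 1
        \<and> (\<forall>\<xi> x. (\<forall>\<alpha>\<in>Rp. \<alpha> \<bullet> x \<noteq> 0) \<longrightarrow>
              frechet_derivative (\<lambda>z. E z y) (at x) \<xi>
              + (\<Sum>\<alpha>\<in>Rp. \<kappa> \<alpha> * (\<alpha> \<bullet> \<xi>) * (E x y - E (refl \<alpha> x) y) / (\<alpha> \<bullet> x))
              = (\<xi> \<bullet> y) * E x y))"

definition dunkl_kernel :: "'a::euclidean_space set \<Rightarrow> ('a \<Rightarrow> real) \<Rightarrow> 'a \<Rightarrow> 'a \<Rightarrow> real" where
  "dunkl_kernel Rp \<kappa> = (THE E. is_dunkl_kernel Rp \<kappa> E)"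

definition mehta_const :: "'a::euclidean_space set \<Rightarrow> ('a \<Rightarrow> real) \<Rightarrow> real" where
  "mehta_const Rp \<kappa> = (LINT x|lebesgue. exp (- (norm x)\<^sup>2 / 2) * dunkl_weight Rp \<kappa> x)"

text \<open>Heat kernel of the semigroup exp(t Delta_kappa) w.r.t. mu_kappa (Roesler):
  p_t(x,y) = c_kappa^-1 (2t)^-(gamma+n/2) exp(-(|x|^2+|y|^2)/(4t)) E(x/sqrt(2t), y/sqrt(2t)),
  gamma = sum_{alpha in R+} kappa(alpha).\<close>
definition dunkl_heat_kernel ::
  "'a::euclidean_space set \<Rightarrow> ('a \<Rightarrow> real) \<Rightarrow> real \<Rightarrow> 'a \<Rightarrow> 'a \<Rightarrow> real" where
  "dunkl_heat_kernel Rp \<kappa> t x y =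
     (2 * t) powr (- ((\<Sum>\<alpha>\<in>Rp. \<kappa> \<alpha>) + real DIM('a) / 2)) / mehta_const Rp \<kappa>
     * exp (- ((norm x)\<^sup>2 + (norm y)\<^sup>2) / (4 * t))
     * dunkl_kernel Rp \<kappa> ((1 / sqrt (2 * t)) *\<^sub>R x) ((1 / sqrt (2 * t)) *\<^sub>R y)"

definition heat_sg_ind ::
  "'a::euclidean_space set \<Rightarrow> ('a \<Rightarrow> real) \<Rightarrow> real \<Rightarrow> 'a set \<Rightarrow> 'a \<Rightarrow> ennreal" where
  "heat_sg_ind Rp \<kappa> t B x =
     (\<integral>\<^sup>+ y. indicator B y * ennreal (dunkl_heat_kernel Rp \<kappa> t x y) \<partial>dunkl_measure Rp \<kappa>)"

definition orbit_dist :: "'a::euclidean_space set \<Rightarrow> 'a \<Rightarrow> 'a \<Rightarrow> real" where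
  "orbit_dist R x y = (INF g\<in>refl_group R. dist x (g y))"

definition orbit_setdist :: "'a::euclidean_space set \<Rightarrow> 'a \<Rightarrow> 'a set \<Rightarrow> real" where
  "orbit_setdist R x A = (INF y\<in>A. orbit_dist R x y)"

definition orbit_ball :: "'a::euclidean_space set \<Rightarrow> 'a \<Rightarrow> real \<Rightarrow> 'a set" where
  "orbit_ball R x r = {y. orbit_dist R x y < r}"

definition orbit_nbhd :: "'a::euclidean_space set \<Rightarrow> 'a set \<Rightarrow> real \<Rightarrow> 'a set \<Rightarrow> 'a set" where
  "orbit_nbhd R E r F = {x\<in>E. orbit_setdist R x F \<le> r}"

definition L_kappa ::
  "'a::euclidean_space set \<Rightarrow> ('a \<Rightarrow> real) \<Rightarrow> real \<Rightarrow> 'a set \<Rightarrow> 'a set \<Rightarrow> ennreal" where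
  "L_kappa Rp \<kappa> s A B =
     (\<integral>\<^sup>+ t\<in>{0<..}. ennreal (t powr (- (1 + s)))
        * (\<integral>\<^sup>+ x\<in>A. heat_sg_ind Rp \<kappa> t B x \<partial>dunkl_measure Rp \<kappa>) \<partial>lborel)"

definition Per_kappa ::
  "'a::euclidean_space set \<Rightarrow> ('a \<Rightarrow> real) \<Rightarrow> real \<Rightarrow> 'a set \<Rightarrow> 'a set \<Rightarrow> ennreal" where
  "Per_kappa Rp \<kappa> s E \<Omega> =
     2 * (L_kappa Rp \<kappa> s (E \<inter> \<Omega>) (- E \<inter> \<Omega>)
        + L_kappa Rp \<kappa> s (E \<inter> \<Omega>) (- E \<inter> - \<Omega>)
        + L_kappa Rp \<kappa> s (E \<inter> - \<Omega>) (- E \<inter> \<Omega>))"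

definition Lambda_kappa ::
  "'a::euclidean_space set \<Rightarrow> 'a set \<Rightarrow> ('a \<Rightarrow> real) \<Rightarrow> 'a set \<Rightarrow> 'a \<Rightarrow> real \<Rightarrow> real \<Rightarrow> ennreal" where
  "Lambda_kappa R Rp \<kappa> E x r s =
     (\<integral>\<^sup>+ t\<in>{1..}. heat_sg_ind Rp \<kappa> t (E \<inter> - orbit_ball R x r) x
        * ennreal (t powr (- (1 + s))) \<partial>lborel)"

end

theory Submission
  imports Defs
begin

text \<open>The Dunkl kernel is \<open>E(x,y) = (\<Sum>n. E_n(x,y))\<close>, where \<open>E_n\<close> is obtained from
  \<open>\<langle>x,y\<rangle> E_{n-1}\<close> by inverting \<open>n + gam - (\<Sum>a\<in>Rp. \<kappa> a * r_a)\<close> on the orbits of the reflection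
  group. This gives \<open>\<bar>E(x,y) - 1\<bar> \<le> exp (\<bar>x\<bar> \<bar>y\<bar>) - 1\<close>, so that, by scaling, the heat kernel
  \<open>p_t(x,-)\<close> approaches \<open>p_t(0,-)\<close> in \<open>L1\<close> as \<open>t \<rightarrow> \<infinity>\<close>, uniformly for \<open>x\<close> in a bounded set.

  In \<open>s Per_s\<close> the times \<open>t < 1\<close> contribute at most \<open>s\<close> times the finite perimeter at \<open>s0\<close>. The
  measures \<open>s t^(-1-s) dt\<close> on \<open>[1,\<infinity>)\<close> are probability measures whose mass escapes to infinity as
  \<open>s \<rightarrow> 0\<close>. With \<open>H(s)\<close> the average of \<open>p_t(0,E)\<close> against them, and \<open>m1\<close>, \<open>m2\<close> the measures of \<open>E\<close>
  and of its complement in the domain, the limit statements therefore reduce to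
  \<open>s Per_s = 2 (m1 (1 - H(s)) + m2 H(s)) + o(1)\<close> and \<open>s \<Lambda>(x,r,s) = H(s) + o(1)\<close>.\<close>

section \<open>Reflection groups\<close>

text \<open>\<open>dunkl_kernel\<close> is a definite description, so nothing is known about the
  heat kernel until existence and uniqueness of a solution are both proved. For existence,
  contracting the Dunkl system with x gives one equation per degree. Its inverse in the group
  algebra has nonnegative coefficients of total mass 1/n, and these factors multiply up to the
  factorials of the ordinary exponential. That solutions of the contracted equations solve the whole
  system is a separate matter, settled by a maximum principle on orbits. The later obstacle is that
  \<open>H(s)\<close> need not converge. All errors are therefore shown to be o(1) without assuming
  any limit, and what remains is an affine relation between \<open>s Per_s\<close> and
  \<open>H(s)\<close> of slope \<open>2 * (m2 - m1)\<close>. In case (a) the slope vanishes and the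
  limit is unconditional; in case (b) the relation can be inverted, and convergence passes in both
  directions. Comparison with the origin needs a bounded set of arguments: in two parts of the
  perimeter the starting set is bounded, in the third the target is.\<close>

lemma linear_refl: "linear (refl a)"
  by (rule linearI) (simp_all add: refl_def algebra_simps inner_add_right add_divide_distrib)

lemma refl_inner_refl [simp]: "refl a x \<bullet> refl a y = x \<bullet> y"
proof (cases "a = 0")
  case False
  then have "a \<bullet> a \<noteq> 0" by simp
  then show ?thesis
    by (simp add: refl_def inner_diff_left inner_diff_right inner_commute field_simps)
qed (simp add: refl_def)

lemma refl_refl [simp]: "refl a (refl a x) = x"
proof (cases "a = 0")
  case False
  then have "a \<bullet> a \<noteq> 0" by simp
  then show ?thesis
    by (simp add: refl_def inner_diff_right algebra_simps)
qed (simp add: refl_def)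

lemma refl_comp_refl [simp]: "refl a \<circ> refl a = id"
  by (simp add: fun_eq_iff)

lemma inner_refl_left: "refl a x \<bullet> y = x \<bullet> refl a y"
  using refl_inner_refl[of a x "refl a y"] by simp

lemma refl_uminus [simp]: "refl (- a) = refl a"
  by (simp add: refl_def fun_eq_iff)

lemma refl_self [simp]: "refl a a = - a"
  by (cases "a = 0") (simp_all add: refl_def scaleR_2)

lemma refl_minus: "refl a (- x) = - refl a x"
  by (rule linear_neg[OF linear_refl])

lemma refl_scaleR: "refl a (c *\<^sub>R x) = c *\<^sub>R refl a x"
  by (rule linear_scale[OF linear_refl])

lemma refl_conj: "refl (refl a b) (refl a x) = refl a (refl b x)"
  by (simp add: refl_def[of "refl a b"] refl_def[of b]
      linear_diff[OF linear_refl] linear_scale[OF linear_refl])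

text \<open>\<open>refl_group\<close> is generated by multiplication on the left, whereas the
  recursions in the group algebra below multiply on the right; associativity carries the new
  reflection through the word.\<close>

lemma id_comp_refl_group:
  assumes "g \<in> refl_group R" "a \<in> R"
  shows "g \<circ> refl a \<in> refl_group R"
  using assms
proof (induction rule: refl_group.induct)
  case id
  then show ?case using refl_group.step[OF refl_group.id, of a R] by simp
next
  case (step g b)
  then show ?case by (metis comp_assoc refl_group.step)
qed

lemma refl_in_refl_group: "a \<in> R \<Longrightarrow> refl a \<in> refl_group R"
  using refl_group.step[OF refl_group.id, of a R] by simp

lemma linear_refl_group: "g \<in> refl_group R \<Longrightarrow> linear g"
proof (induction rule: refl_group.induct)
  case (step g b)
  then show ?case using linear_compose[of g "refl b"] linear_refl by blast
qed (simp add: linear_id[unfolded id_def] id_def)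

lemma refl_group_inner [simp]: "g \<in> refl_group R \<Longrightarrow> g x \<bullet> g y = x \<bullet> y"
  by (induction rule: refl_group.induct) simp_all

lemma refl_group_norm [simp]: "g \<in> refl_group R \<Longrightarrow> norm (g x) = norm x"
  by (simp add: norm_eq_sqrt_inner)

section \<open>Roots, multiplicities and finiteness of the group\<close>

locale dunkl =
  fixes R Rp :: "'a::euclidean_space set" and \<kappa> :: "'a \<Rightarrow> real"
  assumes setting: "dunkl_setting R Rp \<kappa>"
begin

abbreviation G :: "('a \<Rightarrow> 'a) set" where "G \<equiv> refl_group R"

definition gam :: real where "gam = sum \<kappa> Rp"

lemma finite_R: "finite R"
  using setting by (simp add: dunkl_setting_def root_system_def)

lemma root_norm: "a \<in> R \<Longrightarrow> norm a = sqrt 2"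
  using setting by (simp add: dunkl_setting_def root_system_def)

lemma root_inner_self: "a \<in> R \<Longrightarrow> a \<bullet> a = 2"
  using root_norm[of a] by (simp add: norm_eq_sqrt_inner)

lemma refl_root: "a \<in> R \<Longrightarrow> refl a x = x - (a \<bullet> x) *\<^sub>R a"
  by (simp add: refl_def root_inner_self)

lemma refl_image_R: "a \<in> R \<Longrightarrow> refl a ` R = R"
  using setting by (simp add: dunkl_setting_def root_system_def)

lemma refl_mem_R: "a \<in> R \<Longrightarrow> b \<in> R \<Longrightarrow> refl a b \<in> R"
  using refl_image_R[of a] by auto

lemma uminus_mem_R: "a \<in> R \<Longrightarrow> - a \<in> R"
  using refl_mem_R[of a a] by simp

lemma kappa_nonneg: "a \<in> R \<Longrightarrow> 0 \<le> \<kappa> a"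
  using setting by (simp add: dunkl_setting_def multiplicity_def)

lemma kappa_refl: "a \<in> R \<Longrightarrow> b \<in> R \<Longrightarrow> \<kappa> (refl a b) = \<kappa> b"
  using setting refl_in_refl_group[of a R]
  by (auto simp: dunkl_setting_def multiplicity_def)

lemma kappa_uminus: "a \<in> R \<Longrightarrow> \<kappa> (- a) = \<kappa> a"
  using kappa_refl[of a a] by simp

lemma positive_direction:
  obtains d where "\<And>a. a \<in> R \<Longrightarrow> a \<bullet> d \<noteq> 0" "Rp = {a \<in> R. a \<bullet> d > 0}"
  using setting by (auto simp: dunkl_setting_def positive_subsystem_def)

lemma Rp_subset: "Rp \<subseteq> R"
  using positive_direction by blast

lemma Rp_R: "a \<in> Rp \<Longrightarrow> a \<in> R"
  using Rp_subset by blast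

lemma finite_Rp: "finite Rp"
  using finite_subset[OF Rp_subset finite_R] .

lemma gam_nonneg: "0 \<le> gam"
  unfolding gam_def by (intro sum_nonneg kappa_nonneg Rp_R)

lemma R_cases: "a \<in> R \<Longrightarrow> a \<in> Rp \<or> - a \<in> Rp"
  by (rule positive_direction) (use uminus_mem_R in \<open>force simp: neq_iff\<close>)

text \<open>The direction defining \<open>Rp\<close> is orthogonal to no root, so R is the disjoint
  union of \<open>Rp\<close> and its negative.\<close>

lemma sum_R_eq:
  assumes "\<And>a. a \<in> R \<Longrightarrow> F (- a) = (F a :: real)"
  shows "sum F R = 2 * sum F Rp"
proof -
  obtain d where d: "\<And>a. a \<in> R \<Longrightarrow> a \<bullet> d \<noteq> 0" "Rp = {a \<in> R. a \<bullet> d > 0}"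
    using positive_direction by blast
  have R: "R = Rp \<union> uminus ` Rp"
  proof
    show "R \<subseteq> Rp \<union> uminus ` Rp"
    proof
      fix a assume "a \<in> R"
      then show "a \<in> Rp \<union> uminus ` Rp"
        using R_cases[of a] by (metis UnCI image_eqI minus_minus)
    qed
    show "Rp \<union> uminus ` Rp \<subseteq> R"
      using Rp_subset uminus_mem_R by auto
  qed
  have dis: "Rp \<inter> uminus ` Rp = {}"
    using d(2) by force
  have "sum F R = sum F Rp + sum F (uminus ` Rp)"
    by (subst R) (simp add: sum.union_disjoint finite_Rp dis)
  also have "sum F (uminus ` Rp) = (\<Sum>a\<in>Rp. F (- a))"
    by (subst sum.reindex) (auto simp: inj_on_def)
  also have "\<dots> = sum F Rp"
    using assms Rp_R by (intro sum.cong) auto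
  finally show ?thesis by simp
qed

text \<open>A reflection permutes R but need not preserve \<open>Rp\<close>. Evenness of F allows
  the sum to be doubled to all of R, reindexed there and halved again.\<close>

lemma sum_Rp_refl:
  assumes "\<And>a. a \<in> R \<Longrightarrow> F (- a) = (F a :: real)" "b \<in> R"
  shows "(\<Sum>a\<in>Rp. F (refl b a)) = sum F Rp"
proof -
  have "2 * (\<Sum>a\<in>Rp. F (refl b a)) = (\<Sum>a\<in>R. F (refl b a))"
    by (rule sum_R_eq[symmetric]) (use assms refl_mem_R in \<open>auto simp: refl_minus\<close>)
  also have "\<dots> = sum F R"
    using sum.reindex[of "refl b" R F] refl_image_R[OF assms(2)]
    by (metis (no_types, lifting) comp_apply inj_onI refl_refl sum.cong)
  also have "\<dots> = 2 * sum F Rp"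
    by (rule sum_R_eq) (rule assms(1))
  finally show ?thesis by simp
qed

lemma refl_group_image_R: "g \<in> G \<Longrightarrow> g ` R = R"
proof (induction rule: refl_group.induct)
  case (step g b)
  then show ?case by (metis image_comp refl_image_R)
qed simp

text \<open>A reflection moves a vector only along its root, so displacements accumulate inside the
  span.\<close>

lemma refl_group_diff_span: "g \<in> G \<Longrightarrow> g x - x \<in> span R"
proof (induction rule: refl_group.induct)
  case (step g b)
  have "(refl b \<circ> g) x - x = (g x - x) - (b \<bullet> g x) *\<^sub>R b"
    using refl_root[OF step(2)] by (simp add: algebra_simps)
  moreover have "(g x - x) - (b \<bullet> g x) *\<^sub>R b \<in> span R"
    by (rule span_diff[OF step.IH span_scale[OF span_base[OF step.hyps(2)]]])
  ultimately show ?case by metis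
qed (simp add: span_zero)

text \<open>The difference of two elements agreeing on \<open>R\<close> takes values in \<open>span R\<close>, and is orthogonal
  to \<open>R\<close>.\<close>

lemma refl_group_eqI:
  assumes g: "g \<in> G" and h: "h \<in> G" and eq: "\<And>a. a \<in> R \<Longrightarrow> g a = h a"
  shows "g = h"
proof
  fix x
  define v where "v = g x - h x"
  have "v = (g x - x) - (h x - x)" by (simp add: v_def)
  then have v: "v \<in> span R"
    using refl_group_diff_span[OF g] refl_group_diff_span[OF h] by (metis span_diff)
  have "orthogonal v b" if "b \<in> R" for b
  proof -
    from that obtain a where a: "a \<in> R" "b = g a"
      using refl_group_image_R[OF g] by blast
    have "g x \<bullet> b = h x \<bullet> b"
      using refl_group_inner[OF g, of x a] refl_group_inner[OF h, of x a] eq[OF a(1)] a(2) by simp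
    then show ?thesis
      by (simp add: orthogonal_def v_def inner_diff_left)
  qed
  then have "orthogonal v v"
    using orthogonal_to_span[OF v] by blast
  then show "g x = h x"
    by (simp add: orthogonal_def v_def)
qed

text \<open>By \<open>refl_group_eqI\<close> an element is determined by the permutation it induces
  on the finite set R, even when R does not span the space.\<close>

lemma finite_G: "finite G"
proof -
  have "inj_on (\<lambda>g. restrict g R) G"
    by (intro inj_onI refl_group_eqI) (auto, metis restrict_apply')
  moreover have "(\<lambda>g. restrict g R) ` G \<subseteq> R \<rightarrow>\<^sub>E R"
    using refl_group_image_R by (fastforce simp: PiE_def Pi_def extensional_def)
  ultimately show ?thesis
    using finite_imageD finite_subset finite_PiE finite_R by metis
qed

lemma G_right: "g \<in> G \<Longrightarrow> a \<in> Rp \<Longrightarrow> g \<circ> refl a \<in> G"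
  by (rule id_comp_refl_group) (auto intro: Rp_R)

lemma G_left: "g \<in> G \<Longrightarrow> a \<in> Rp \<Longrightarrow> refl a \<circ> g \<in> G"
  by (rule refl_group.step) (auto intro: Rp_R)

lemma sum_G_left:
  assumes "a \<in> Rp"
  shows "(\<Sum>g\<in>G. F (refl a \<circ> g)) = sum F G"
  by (rule sum.reindex_bij_witness[of _ "\<lambda>g. refl a \<circ> g" "\<lambda>g. refl a \<circ> g"])
    (use G_left assms in auto)

lemma sum_G_right:
  assumes "a \<in> Rp"
  shows "(\<Sum>g\<in>G. F (g \<circ> refl a)) = sum F G"
  by (rule sum.reindex_bij_witness[of _ "\<lambda>g. g \<circ> refl a" "\<lambda>g. g \<circ> refl a"])
    (use G_right assms in \<open>auto simp: comp_assoc\<close>)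

lemma id_in_G: "id \<in> G"
  by (rule refl_group.id)

end

section \<open>The Dunkl kernel\<close>

context dunkl
begin

text \<open>\<open>rcoef n\<close> is the kernel, as an element of the group algebra, of the inverse of
  \<open>n + gam - (\<Sum>a\<in>Rp. \<kappa> a * r_a)\<close>, expanded in a Neumann series.\<close>

primrec wcoef :: "nat \<Rightarrow> ('a \<Rightarrow> 'a) \<Rightarrow> real" where
  "wcoef 0 g = (if g = id then 1 else 0)"
| "wcoef (Suc k) g = (\<Sum>a\<in>Rp. \<kappa> a * wcoef k (g \<circ> refl a))"

definition rcoef :: "nat \<Rightarrow> ('a \<Rightarrow> 'a) \<Rightarrow> real" where
  "rcoef n g = (\<Sum>k. wcoef k g / (real n + gam) ^ Suc k)"

lemma wcoef_nonneg: "0 \<le> wcoef k g"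
  by (induction k arbitrary: g) (auto intro!: sum_nonneg mult_nonneg_nonneg kappa_nonneg Rp_R)

text \<open>\<open>wcoef k\<close> holds the coefficients of the k-th power of
  \<open>\<Sum>a\<in>Rp. \<kappa> a * r_a\<close>. Right translation permutes G, so each step
  multiplies the total mass by \<open>gam\<close>.\<close>

lemma sum_wcoef: "(\<Sum>g\<in>G. wcoef k g) = gam ^ k"
proof (induction k)
  case 0
  then show ?case using finite_G id_in_G by simp
next
  case (Suc k)
  have "(\<Sum>g\<in>G. wcoef (Suc k) g) = (\<Sum>a\<in>Rp. \<kappa> a * (\<Sum>g\<in>G. wcoef k (g \<circ> refl a)))"
    by (simp add: sum.swap[of _ Rp] sum_distrib_left)
  also have "\<dots> = (\<Sum>a\<in>Rp. \<kappa> a * gam ^ k)"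
    by (intro sum.cong refl) (simp add: sum_G_right Suc)
  finally show ?case by (simp add: gam_def sum_distrib_right)
qed

lemma wcoef_le: "g \<in> G \<Longrightarrow> wcoef k g \<le> gam ^ k"
  using member_le_sum[of g G "wcoef k"] wcoef_nonneg finite_G sum_wcoef[of k] by auto

text \<open>The majorant is geometric with ratio \<open>gam / (n + gam)\<close>, below 1 because n
  is positive. For n = 0 the operator annihilates constants and has no inverse.\<close>

lemma summable_rcoef:
  assumes "0 < n" "g \<in> G"
  shows "summable (\<lambda>k. wcoef k g / (real n + gam) ^ Suc k)"
proof (rule summable_comparison_test)
  have p: "0 < real n + gam" using assms(1) gam_nonneg by simp
  have "summable (\<lambda>k. (1 / (real n + gam)) * (gam / (real n + gam)) ^ k)"
    using assms(1) gam_nonneg by (intro summable_mult summable_geometric) simp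
  then show "summable (\<lambda>k. gam ^ k / (real n + gam) ^ Suc k)"
    by (simp add: power_divide)
  show "\<exists>N. \<forall>k\<ge>N. norm (wcoef k g / (real n + gam) ^ Suc k) \<le> gam ^ k / (real n + gam) ^ Suc k"
    using wcoef_le[OF assms(2)] wcoef_nonneg p by (auto intro!: divide_right_mono)
qed

lemma rcoef_nonneg: "0 < n \<Longrightarrow> g \<in> G \<Longrightarrow> 0 \<le> rcoef n g"
  unfolding rcoef_def using gam_nonneg
  by (intro suminf_nonneg summable_rcoef divide_nonneg_nonneg wcoef_nonneg) auto

text \<open>The coefficients of "inverse times operator is the identity": the term k = 0 of the
  series gives the unit at \<open>id\<close>, and every later term is one step of the recursion for
  \<open>wcoef\<close>.\<close>

lemma rcoef_eq:
  assumes n: "0 < n" and g: "g \<in> G"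
  shows "(real n + gam) * rcoef n g
    = (if g = id then 1 else 0) + (\<Sum>a\<in>Rp. \<kappa> a * rcoef n (g \<circ> refl a))"
proof -
  define l where "l = real n + gam"
  have l: "l \<noteq> 0" using n gam_nonneg by (simp add: l_def add_pos_nonneg less_imp_neq)
  let ?f = "\<lambda>k. wcoef k g / l ^ Suc k"
  have sf: "summable ?f" using summable_rcoef[OF n g] by (simp add: l_def)
  have "l * rcoef n g = l * (?f 0 + (\<Sum>k. ?f (Suc k)))"
    using suminf_split_head[OF sf] by (simp add: rcoef_def l_def)
  also have "\<dots> = wcoef 0 g + l * (\<Sum>k. ?f (Suc k))"
    using l by (simp add: field_simps)
  also have "l * (\<Sum>k. ?f (Suc k)) = (\<Sum>k. l * ?f (Suc k))"
    using sf by (intro suminf_mult[symmetric]) (rule summable_Suc_iff[THEN iffD2])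
  also have "\<dots> = (\<Sum>k. \<Sum>a\<in>Rp. \<kappa> a * (wcoef k (g \<circ> refl a) / l ^ Suc k))"
    using l by (simp add: sum_distrib_left sum_divide_distrib)
  also have "\<dots> = (\<Sum>a\<in>Rp. \<Sum>k. \<kappa> a * (wcoef k (g \<circ> refl a) / l ^ Suc k))"
    using summable_rcoef[OF n G_right[OF g]]
    by (intro suminf_sum summable_mult) (simp add: l_def)
  also have "\<dots> = (\<Sum>a\<in>Rp. \<kappa> a * rcoef n (g \<circ> refl a))"
  proof (intro sum.cong refl)
    fix a assume "a \<in> Rp"
    from suminf_mult[OF summable_rcoef[OF n G_right[OF g this]], of "\<kappa> a"]
    show "(\<Sum>k. \<kappa> a * (wcoef k (g \<circ> refl a) / l ^ Suc k)) = \<kappa> a * rcoef n (g \<circ> refl a)"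
      unfolding rcoef_def l_def .
  qed
  finally show ?thesis by (simp add: l_def)
qed

definition res :: "nat \<Rightarrow> (('a \<Rightarrow> 'a) \<Rightarrow> real) \<Rightarrow> real" where
  "res n F = (\<Sum>g\<in>G. rcoef n g * F g)"

lemma res_eq:
  assumes n: "0 < n"
  shows "(real n + gam) * res n F - (\<Sum>a\<in>Rp. \<kappa> a * res n (\<lambda>g. F (g \<circ> refl a))) = F id"
proof -
  have *: "res n (\<lambda>g. F (g \<circ> refl a)) = (\<Sum>g\<in>G. rcoef n (g \<circ> refl a) * F g)" if "a \<in> Rp" for a
    unfolding res_def
    using sum_G_right[OF that, of "\<lambda>g. rcoef n (g \<circ> refl a) * F g"] by (simp add: comp_assoc)
  have "(real n + gam) * res n F = (\<Sum>g\<in>G. ((real n + gam) * rcoef n g) * F g)"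
    by (simp add: res_def sum_distrib_left mult.assoc)
  also have "\<dots> = (\<Sum>g\<in>G. (if g = id then F g else 0)
      + (\<Sum>a\<in>Rp. \<kappa> a * (rcoef n (g \<circ> refl a) * F g)))"
    by (intro sum.cong refl, subst rcoef_eq[OF n], assumption)
      (simp add: distrib_right sum_distrib_right mult.assoc)
  also have "\<dots> = F id + (\<Sum>a\<in>Rp. \<kappa> a * res n (\<lambda>g. F (g \<circ> refl a)))"
    using finite_G id_in_G
    by (simp add: sum.distrib sum.swap[of _ Rp] sum_distrib_left *)
  finally show ?thesis by simp
qed

text \<open>This is the inverse applied to the constant 1: on constants the reflections contribute
  \<open>gam\<close>, which cancels the \<open>gam\<close> of the operator and leaves n.\<close>

lemma sum_rcoef:
  assumes n: "0 < n"
  shows "(\<Sum>g\<in>G. rcoef n g) = 1 / real n"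
  using res_eq[OF n, of "\<lambda>_. 1"] n
  by (simp add: res_def gam_def sum_distrib_right[symmetric] field_simps)

text \<open>Nonnegative coefficients of total mass 1/n make \<open>res n F\<close> a weighted
  average divided by n, whatever the group and the size of \<open>gam\<close>. The factorials below
  all come from this division.\<close>

lemma res_bound:
  assumes n: "0 < n" and B: "\<And>g. g \<in> G \<Longrightarrow> \<bar>F g\<bar> \<le> B"
  shows "\<bar>res n F\<bar> \<le> B / real n"
proof -
  have "\<bar>res n F\<bar> \<le> (\<Sum>g\<in>G. rcoef n g * B)"
    unfolding res_def
    by (rule order_trans[OF sum_abs], rule sum_mono)
      (use B rcoef_nonneg[OF n] in \<open>auto simp: abs_mult intro!: mult_left_mono\<close>)
  also have "\<dots> = B / real n"
    by (simp add: sum_distrib_right[symmetric] sum_rcoef[OF n])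
  finally show ?thesis .
qed

text \<open>\<open>Ek n y\<close> is the homogeneous part of degree \<open>n\<close> of \<open>x \<mapsto> E(x,y)\<close>. Since
  \<open>\<Sum>i. x_i T_i\<close> acts on it as \<open>n + gam - (\<Sum>a\<in>Rp. \<kappa> a * r_a)\<close>, the eigenvalue
  equations force this recursion.\<close>

primrec Ek :: "nat \<Rightarrow> 'a \<Rightarrow> 'a \<Rightarrow> real" where
  "Ek 0 y x = 1"
| "Ek (Suc n) y x = res (Suc n) (\<lambda>g. (g x \<bullet> y) * Ek n y (g x))"

text \<open>The derivative of \<open>Ek n y\<close> at x in the direction v, found by
  differentiating the recursion formally. Its own recursion allows bounds that make no reference to
  differentiability.\<close>

primrec DEk :: "nat \<Rightarrow> 'a \<Rightarrow> 'a \<Rightarrow> 'a \<Rightarrow> real" where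
  "DEk 0 y x v = 0"
| "DEk (Suc n) y x v =
    res (Suc n) (\<lambda>g. (g v \<bullet> y) * Ek n y (g x) + (g x \<bullet> y) * DEk n y (g x) (g v))"

lemma Ek_rec:
  "(real (Suc n) + gam) * Ek (Suc n) y x - (\<Sum>a\<in>Rp. \<kappa> a * Ek (Suc n) y (refl a x))
    = (x \<bullet> y) * Ek n y x"
  using res_eq[of "Suc n" "\<lambda>g. (g x \<bullet> y) * Ek n y (g x)"] by (simp add: comp_def)

lemma DEk_rec:
  "(real (Suc n) + gam) * DEk (Suc n) y x v
      - (\<Sum>a\<in>Rp. \<kappa> a * DEk (Suc n) y (refl a x) (refl a v))
    = (v \<bullet> y) * Ek n y x + (x \<bullet> y) * DEk n y x v"
  using res_eq[of "Suc n" "\<lambda>g. (g v \<bullet> y) * Ek n y (g x) + (g x \<bullet> y) * DEk n y (g x) (g v)"]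
  by (simp add: comp_def)

lemma Ek_bound: "\<bar>Ek n y x\<bar> \<le> (norm x * norm y) ^ n / fact n"
proof (induction n arbitrary: x)
  case (Suc n)
  have "\<bar>Ek (Suc n) y x\<bar> \<le> ((norm x * norm y) * ((norm x * norm y) ^ n / fact n)) / real (Suc n)"
    unfolding Ek.simps
  proof (rule res_bound)
    fix g assume g: "g \<in> G"
    have "\<bar>g x \<bullet> y\<bar> \<le> norm x * norm y"
      using Cauchy_Schwarz_ineq2[of "g x" y] g by simp
    then show "\<bar>(g x \<bullet> y) * Ek n y (g x)\<bar> \<le> (norm x * norm y) * ((norm x * norm y) ^ n / fact n)"
      unfolding abs_mult using Suc[of "g x"] g by (intro mult_mono) auto
  qed simp
  then show ?case by (simp add: field_simps)
qed simp

lemma DEk_bound: "\<bar>DEk (Suc n) y x v\<bar> \<le> norm v * norm y * ((norm x * norm y) ^ n / fact n)"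
proof (induction n arbitrary: x v)
  case 0
  have "\<bar>DEk (Suc 0) y x v\<bar> \<le> norm v * norm y / real (Suc 0)"
    unfolding DEk.simps
  proof (rule res_bound)
    fix g assume "g \<in> G"
    then show "\<bar>(g v \<bullet> y) * Ek 0 y (g x) + (g x \<bullet> y) * 0\<bar> \<le> norm v * norm y"
      using Cauchy_Schwarz_ineq2[of "g v" y] by simp
  qed simp
  then show ?case by simp
next
  case (Suc n)
  define c where "c = norm x * norm y"
  have c: "0 \<le> c" by (simp add: c_def)
  have "\<bar>DEk (Suc (Suc n)) y x v\<bar> \<le>
    (norm v * norm y * (c ^ Suc n / fact (Suc n)) + c * (norm v * norm y * (c ^ n / fact n)))
      / real (Suc (Suc n))"
    unfolding DEk.simps(2)[of "Suc n"]
  proof (rule res_bound)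
    fix g assume g: "g \<in> G"
    have 1: "\<bar>g x \<bullet> y\<bar> \<le> c" "\<bar>g v \<bullet> y\<bar> \<le> norm v * norm y"
      using Cauchy_Schwarz_ineq2[of "g x" y] Cauchy_Schwarz_ineq2[of "g v" y] g by (simp_all add: c_def)
    have 2: "\<bar>Ek (Suc n) y (g x)\<bar> \<le> c ^ Suc n / fact (Suc n)"
      using Ek_bound[of "Suc n" y "g x"] g by (simp add: c_def)
    have 3: "\<bar>DEk (Suc n) y (g x) (g v)\<bar> \<le> norm v * norm y * (c ^ n / fact n)"
      using Suc[of "g x" "g v"] g by (simp add: c_def)
    have "\<bar>(g v \<bullet> y) * Ek (Suc n) y (g x)\<bar> \<le> norm v * norm y * (c ^ Suc n / fact (Suc n))"
      unfolding abs_mult by (rule mult_mono[OF 1(2) 2]) auto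
    moreover have "\<bar>(g x \<bullet> y) * DEk (Suc n) y (g x) (g v)\<bar> \<le> c * (norm v * norm y * (c ^ n / fact n))"
      unfolding abs_mult by (rule mult_mono[OF 1(1) 3]) (auto simp: c)
    ultimately show "\<bar>(g v \<bullet> y) * Ek (Suc n) y (g x) + (g x \<bullet> y) * DEk (Suc n) y (g x) (g v)\<bar>
      \<le> norm v * norm y * (c ^ Suc n / fact (Suc n)) + c * (norm v * norm y * (c ^ n / fact n))"
      by linarith
  qed simp
  \<comment> \<open>With X the right-hand side, the first summand is X and the second is
    \<open>Suc n\<close> times X, so the division by \<open>Suc (Suc n)\<close> loses
    nothing.\<close>
  also have "\<dots> = norm v * norm y * (c ^ Suc n / fact (Suc n))"
  proof -
    have "c * (norm v * norm y * (c ^ n / fact n)) = real (Suc n) * (norm v * norm y * (c ^ Suc n / fact (Suc n)))"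
      by (simp add: fact_Suc power_Suc divide_simps del: of_nat_Suc)
    moreover have "X + real (Suc n) * X = real (Suc (Suc n)) * X" for X :: real
      by (simp add: algebra_simps)
    ultimately have "norm v * norm y * (c ^ Suc n / fact (Suc n)) + c * (norm v * norm y * (c ^ n / fact n))
      = real (Suc (Suc n)) * (norm v * norm y * (c ^ Suc n / fact (Suc n)))"
      by metis
    then show ?thesis by simp
  qed
  finally show ?case by (simp add: c_def)
qed

lemma bounded_linear_G: "g \<in> G \<Longrightarrow> bounded_linear g"
  using linear_refl_group linear_conv_bounded_linear by blast

lemma has_derivative_Ek: "(Ek n y has_derivative DEk n y x) (at x)"
proof (induction n arbitrary: x)
  case 0
  then show ?case by (simp add: fun_eq_iff)
next
  case (Suc n)
  have "((\<lambda>z. rcoef (Suc n) g * ((g z \<bullet> y) * Ek n y (g z))) has_derivative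
      (\<lambda>v. rcoef (Suc n) g * ((g v \<bullet> y) * Ek n y (g x) + (g x \<bullet> y) * DEk n y (g x) (g v)))) (at x)"
    if "g \<in> G" for g
  proof -
    have g: "(g has_derivative g) (at x)"
      by (rule bounded_linear_imp_has_derivative[OF bounded_linear_G[OF that]])
    have 2: "((\<lambda>z. Ek n y (g z)) has_derivative (\<lambda>v. DEk n y (g x) (g v))) (at x)"
      using diff_chain_at[OF g Suc] by (simp add: comp_def)
    show ?thesis
      by (rule derivative_eq_intros g 2 refl)+ (simp add: fun_eq_iff algebra_simps)
  qed
  then show ?case
    by (simp add: res_def fun_eq_iff [abs_def] has_derivative_sum)
qed

lemma continuous_Ek: "continuous_on UNIV (\<lambda>p. Ek n (snd p) (fst p))"
proof (induction n)
  case (Suc n)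
  have "continuous_on UNIV (\<lambda>p::'a\<times>'a. rcoef (Suc n) g * ((g (fst p) \<bullet> snd p) * Ek n (snd p) (g (fst p))))"
    if "g \<in> G" for g
  proof -
    have g: "continuous_on UNIV (\<lambda>p::'a\<times>'a. g (fst p))"
      by (intro bounded_linear.continuous_on[OF bounded_linear_G[OF that]] continuous_intros)
    have "continuous_on UNIV (\<lambda>p::'a\<times>'a. Ek n (snd (g (fst p), snd p)) (fst (g (fst p), snd p)))"
      by (rule continuous_on_compose2[OF Suc]) (auto intro!: g continuous_intros)
    then show ?thesis
      by (auto intro!: g continuous_intros)
  qed
  then show ?case
    by (simp add: res_def continuous_on_sum)
qed simp

lemma continuous_DEk: "continuous_on UNIV (\<lambda>x. DEk n y x v)"
proof (induction n arbitrary: v)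
  case (Suc n)
  have "continuous_on UNIV (\<lambda>x. rcoef (Suc n) g *
      ((g v \<bullet> y) * Ek n y (g x) + (g x \<bullet> y) * DEk n y (g x) (g v)))" if "g \<in> G" for g
  proof -
    have g: "continuous_on UNIV g"
      using linear_continuous_on[OF bounded_linear_G[OF that]] .
    have "continuous_on UNIV (\<lambda>x. Ek n (snd (g x, y)) (fst (g x, y)))"
      by (rule continuous_on_compose2[OF continuous_Ek]) (auto intro!: g continuous_intros)
    moreover have "continuous_on UNIV (\<lambda>x. DEk n y (g x) (g v))"
      by (rule continuous_on_compose2[OF Suc g]) auto
    ultimately show ?thesis
      by (auto intro!: g continuous_intros)
  qed
  then show ?case
    by (simp add: res_def continuous_on_sum)
qed simp

section \<open>The eigenvalue equations degree by degree\<close>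

definition reg :: "'a \<Rightarrow> bool" where
  "reg x \<longleftrightarrow> (\<forall>a\<in>Rp. a \<bullet> x \<noteq> 0)"

lemma regD: "reg x \<Longrightarrow> a \<in> R \<Longrightarrow> a \<bullet> x \<noteq> 0"
  using R_cases[of a] by (auto simp: reg_def)

lemma reg_G: "g \<in> G \<Longrightarrow> reg x \<Longrightarrow> reg (g x)"
proof (induction rule: refl_group.induct)
  case (step g b)
  show ?case
    unfolding reg_def
  proof
    fix a assume "a \<in> Rp"
    then have "refl b a \<in> R" using step.hyps(2) Rp_R refl_mem_R by blast
    then show "a \<bullet> (refl b \<circ> g) x \<noteq> 0"
      using regD[OF step.IH[OF step.prems]] by (metis comp_apply inner_refl_left)
  qed
qed simp

text \<open>At the orbit point where the absolute value of F is largest, the equation yields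
  \<open>(n + gam) * M \<le> gam * M\<close>, hence \<open>M \<le> 0\<close>. The direction v
  travels along the orbit with x, because F will be the defect of an equation between directional
  derivatives.\<close>

lemma max_principle:
  assumes n: "0 < n" and x: "reg x"
    and eq: "\<And>x v. reg x \<Longrightarrow>
      (real n + gam) * F x v = (\<Sum>a\<in>Rp. \<kappa> a * F (refl a x) (refl a v))"
  shows "F x v = 0"
proof -
  define M where "M = Max ((\<lambda>g. \<bar>F (g x) (g v)\<bar>) ` G)"
  have fin: "finite ((\<lambda>g. \<bar>F (g x) (g v)\<bar>) ` G)" using finite_G by simp
  have M: "\<bar>F (g x) (g v)\<bar> \<le> M" if "g \<in> G" for g
    unfolding M_def using fin that by simp
  have "M \<in> (\<lambda>g. \<bar>F (g x) (g v)\<bar>) ` G"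
    unfolding M_def using fin id_in_G by (intro Max_in) auto
  then obtain g where g: "g \<in> G" "M = \<bar>F (g x) (g v)\<bar>" by blast
  have "(real n + gam) * M = \<bar>\<Sum>a\<in>Rp. \<kappa> a * F (refl a (g x)) (refl a (g v))\<bar>"
    using gam_nonneg by (simp add: g(2) abs_mult flip: eq[OF reg_G[OF g(1) x], of "g v"])
  also have "\<dots> \<le> (\<Sum>a\<in>Rp. \<kappa> a * M)"
    by (rule order_trans[OF sum_abs], rule sum_mono)
      (use M[OF G_left[OF g(1)]] kappa_nonneg Rp_R in \<open>auto simp: abs_mult intro!: mult_left_mono\<close>)
  also have "\<dots> = gam * M" by (simp add: gam_def sum_distrib_right)
  finally have "real n * M \<le> 0" by (simp add: algebra_simps)
  then have "M \<le> 0" using n by (simp add: mult_le_0_iff)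
  then show ?thesis using M[OF id_in_G] by simp
qed

text \<open>The defect of the eigenvalue equation for \<open>f\<close> satisfies the hypothesis of \<open>max_principle\<close>: in
  the double sums over reflections, reindexing \<open>b\<close> as \<open>refl a b\<close> and using \<open>refl_conj\<close> makes all terms in
  \<open>f\<close> cancel. This replaces the commutativity of the Dunkl operators.\<close>

lemma dunkl_step:
  fixes f h h' :: "'a \<Rightarrow> real" and df dh :: "'a \<Rightarrow> 'a \<Rightarrow> real" and m :: nat
  assumes f: "\<And>x. (real (Suc m) + gam) * f x - (\<Sum>a\<in>Rp. \<kappa> a * f (refl a x)) = (x \<bullet> y) * h x"
    and h: "\<And>x. (real m + gam) * h x - (\<Sum>a\<in>Rp. \<kappa> a * h (refl a x)) = (x \<bullet> y) * h' x"
    and df: "\<And>x v. (real (Suc m) + gam) * df x v - (\<Sum>a\<in>Rp. \<kappa> a * df (refl a x) (refl a v))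
      = (v \<bullet> y) * h x + (x \<bullet> y) * dh x v"
    and dh: "\<And>x v. reg x \<Longrightarrow> dh x v + (\<Sum>b\<in>Rp. \<kappa> b * (b \<bullet> v) * (h x - h (refl b x)) / (b \<bullet> x))
      = (v \<bullet> y) * h' x"
    and x: "reg x"
  shows "df x v + (\<Sum>b\<in>Rp. \<kappa> b * (b \<bullet> v) * (f x - f (refl b x)) / (b \<bullet> x)) = (v \<bullet> y) * h x"
proof -
  define S where "S x v = (\<Sum>b\<in>Rp. \<kappa> b * (b \<bullet> v) * (f x - f (refl b x)) / (b \<bullet> x))" for x v
  define F where "F x v = df x v + S x v - (v \<bullet> y) * h x" for x v
  define l where "l = real (Suc m) + gam"
  have "F x v = 0"
  proof (rule max_principle[where n = "Suc m" and F = F, OF _ x])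
    fix x v assume x: "reg x"
    \<comment> \<open>P is the double sum that contains f. \<open>S1\<close> produces it through the
      recursion for f, \<open>S2\<close> through the reflected copies of S, so that it stands on
      both sides of the goal.\<close>
    define P where "P = (\<Sum>a\<in>Rp. \<Sum>b\<in>Rp. \<kappa> a * (\<kappa> b * (b \<bullet> v) * (f (refl a x) - f (refl a (refl b x))) / (b \<bullet> x)))"
    have lf: "l * f z = (\<Sum>a\<in>Rp. \<kappa> a * f (refl a z)) + (z \<bullet> y) * h z" for z
      using f[of z] by (simp add: l_def)
    have S1: "l * S x v = P + (\<Sum>b\<in>Rp. \<kappa> b * (b \<bullet> v) * ((x \<bullet> y) * h x - (refl b x \<bullet> y) * h (refl b x)) / (b \<bullet> x))"
    proof -
      have "l * S x v = (\<Sum>b\<in>Rp. \<kappa> b * (b \<bullet> v) * (l * f x - l * f (refl b x)) / (b \<bullet> x))"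
        unfolding S_def sum_distrib_left by (intro sum.cong refl) (simp add: algebra_simps)
      also have "\<dots> = (\<Sum>b\<in>Rp. (\<Sum>a\<in>Rp. \<kappa> a * (\<kappa> b * (b \<bullet> v) * (f (refl a x) - f (refl a (refl b x))) / (b \<bullet> x)))
         + \<kappa> b * (b \<bullet> v) * ((x \<bullet> y) * h x - (refl b x \<bullet> y) * h (refl b x)) / (b \<bullet> x))"
      proof (intro sum.cong refl)
        fix b
        have "(\<Sum>a\<in>Rp. \<kappa> a * (\<kappa> b * (b \<bullet> v) * (f (refl a x) - f (refl a (refl b x))) / (b \<bullet> x)))
          = \<kappa> b * (b \<bullet> v) / (b \<bullet> x) * (\<Sum>a\<in>Rp. \<kappa> a * f (refl a x) - \<kappa> a * f (refl a (refl b x)))"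
          unfolding sum_distrib_left
          by (intro sum.cong refl) (simp add: right_diff_distrib diff_divide_distrib mult_ac)
        then show "\<kappa> b * (b \<bullet> v) * (l * f x - l * f (refl b x)) / (b \<bullet> x) =
          (\<Sum>a\<in>Rp. \<kappa> a * (\<kappa> b * (b \<bullet> v) * (f (refl a x) - f (refl a (refl b x))) / (b \<bullet> x)))
         + \<kappa> b * (b \<bullet> v) * ((x \<bullet> y) * h x - (refl b x \<bullet> y) * h (refl b x)) / (b \<bullet> x)"
          unfolding lf sum_subtractf by (simp add: algebra_simps diff_divide_distrib add_divide_distrib)
      qed
      also have "\<dots> = P + (\<Sum>b\<in>Rp. \<kappa> b * (b \<bullet> v) * ((x \<bullet> y) * h x - (refl b x \<bullet> y) * h (refl b x)) / (b \<bullet> x))"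
        unfolding sum.distrib P_def by (subst sum.swap) simp
      finally show ?thesis .
    qed
    have S2: "(\<Sum>a\<in>Rp. \<kappa> a * S (refl a x) (refl a v)) = P"
      unfolding P_def
    proof (intro sum.cong refl)
      fix a assume a: "a \<in> Rp"
      have "S (refl a x) (refl a v) = (\<Sum>b\<in>Rp. \<kappa> (refl a b) * (refl a b \<bullet> refl a v)
          * (f (refl a x) - f (refl (refl a b) (refl a x))) / (refl a b \<bullet> refl a x))"
        unfolding S_def
        by (rule sum_Rp_refl[symmetric]) (use a Rp_R kappa_uminus in auto)
      also have "\<dots> = (\<Sum>b\<in>Rp. \<kappa> b * (b \<bullet> v) * (f (refl a x) - f (refl a (refl b x))) / (b \<bullet> x))"
        by (intro sum.cong refl) (use a Rp_R kappa_refl in \<open>simp add: refl_conj\<close>)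
      finally show "\<kappa> a * S (refl a x) (refl a v) =
        (\<Sum>b\<in>Rp. \<kappa> a * (\<kappa> b * (b \<bullet> v) * (f (refl a x) - f (refl a (refl b x))) / (b \<bullet> x)))"
        by (simp add: sum_distrib_left)
    qed
    \<comment> \<open>The part \<open>(b \<bullet> x) * (b \<bullet> y)\<close> of the reflected
      inner product cancels the denominator. The sum without quotients that it leaves occurs again
      in \<open>H\<close> and drops out of the balance.\<close>
    have S3: "(\<Sum>b\<in>Rp. \<kappa> b * (b \<bullet> v) * ((x \<bullet> y) * h x - (refl b x \<bullet> y) * h (refl b x)) / (b \<bullet> x))
      = (x \<bullet> y) * (\<Sum>b\<in>Rp. \<kappa> b * (b \<bullet> v) * (h x - h (refl b x)) / (b \<bullet> x))
        + (\<Sum>b\<in>Rp. \<kappa> b * (b \<bullet> v) * (b \<bullet> y) * h (refl b x))"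
      unfolding sum_distrib_left sum.distrib[symmetric]
    proof (intro sum.cong refl)
      fix b assume b: "b \<in> Rp"
      have nz: "b \<bullet> x \<noteq> 0" using x b by (simp add: reg_def)
      have r: "refl b x \<bullet> y = x \<bullet> y - (b \<bullet> x) * (b \<bullet> y)"
        using b Rp_R by (simp add: refl_root inner_diff_left)
      show "\<kappa> b * (b \<bullet> v) * ((x \<bullet> y) * h x - (refl b x \<bullet> y) * h (refl b x)) / (b \<bullet> x)
        = (x \<bullet> y) * (\<kappa> b * (b \<bullet> v) * (h x - h (refl b x)) / (b \<bullet> x)) + \<kappa> b * (b \<bullet> v) * (b \<bullet> y) * h (refl b x)"
        unfolding r using nz by (simp add: field_simps)
    qed
    have H: "(\<Sum>a\<in>Rp. \<kappa> a * ((refl a v \<bullet> y) * h (refl a x)))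
      = (v \<bullet> y) * (\<Sum>a\<in>Rp. \<kappa> a * h (refl a x)) - (\<Sum>b\<in>Rp. \<kappa> b * (b \<bullet> v) * (b \<bullet> y) * h (refl b x))"
      unfolding sum_distrib_left sum_subtractf[symmetric]
      by (intro sum.cong refl) (use Rp_R in \<open>simp add: refl_root inner_diff_left algebra_simps\<close>)
    have FF: "(\<Sum>a\<in>Rp. \<kappa> a * F (refl a x) (refl a v)) = (\<Sum>a\<in>Rp. \<kappa> a * df (refl a x) (refl a v))
      + (\<Sum>a\<in>Rp. \<kappa> a * S (refl a x) (refl a v)) - (\<Sum>a\<in>Rp. \<kappa> a * ((refl a v \<bullet> y) * h (refl a x)))"
      unfolding F_def by (simp add: sum.distrib sum_subtractf ring_distribs)
    have D: "(\<Sum>b\<in>Rp. \<kappa> b * (b \<bullet> v) * (h x - h (refl b x)) / (b \<bullet> x)) = (v \<bullet> y) * h' x - dh x v"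
      using dh[OF x, of v] by simp
    \<comment> \<open>h lies one degree below f, so its recursion carries the factor
      \<open>l - 1\<close>; the missing h is supplied by \<open>df\<close>.\<close>
    have h2: "(x \<bullet> y) * h' x = (l - 1) * h x - (\<Sum>a\<in>Rp. \<kappa> a * h (refl a x))"
      using h[of x] by (simp add: l_def)
    have h3: "(x \<bullet> y) * ((v \<bullet> y) * h' x) = (v \<bullet> y) * ((l - 1) * h x) - (v \<bullet> y) * (\<Sum>a\<in>Rp. \<kappa> a * h (refl a x))"
      using h2 by (metis mult.left_commute right_diff_distrib)
    have "l * F x v = l * df x v + l * S x v - l * ((v \<bullet> y) * h x)"
      by (simp add: F_def ring_distribs)
    then show "(real (Suc m) + gam) * F x v = (\<Sum>a\<in>Rp. \<kappa> a * F (refl a x) (refl a v))"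
      using df[of x v] h3 unfolding FF S1 S2 S3 H D l_def[symmetric]
      by (simp add: algebra_simps)
  qed simp
  then show ?thesis by (simp add: F_def S_def)
qed

lemma Ek_dunkl:
  assumes "reg x"
  shows "DEk (Suc n) y x v
      + (\<Sum>b\<in>Rp. \<kappa> b * (b \<bullet> v) * (Ek (Suc n) y x - Ek (Suc n) y (refl b x)) / (b \<bullet> x))
    = (v \<bullet> y) * Ek n y x"
  using assms
proof (induction n arbitrary: x v)
  case 0
  \<comment> \<open>Below degree 0 the zero function serves as \<open>h'\<close>: this is
    consistent, since the operator for m = 0 maps the constant 1 to
    \<open>gam - sum \<kappa> Rp = 0\<close>.\<close>
  show ?case
    by (rule dunkl_step[where m = 0 and h' = "\<lambda>_. 0" and dh = "\<lambda>_ _. 0", OF Ek_rec])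
      (use DEk_rec[of 0] 0 in \<open>auto simp: gam_def\<close>)
next
  case (Suc n)
  show ?case
    by (rule dunkl_step[where m = "Suc n" and h' = "Ek n y" and dh = "DEk (Suc n) y", OF Ek_rec Ek_rec DEk_rec])
      (use Suc in auto)
qed

end

section \<open>Summation of the series and existence of the kernel\<close>

lemma sums_exp_real: "(\<lambda>n. c ^ n / fact n) sums exp (c::real)"
  using exp_converges[of c] by (simp add: field_simps)

context dunkl
begin

definition Ed :: "'a \<Rightarrow> 'a \<Rightarrow> real" where
  "Ed x y = (\<Sum>n. Ek n y x)"

definition DEd :: "'a \<Rightarrow> 'a \<Rightarrow> 'a \<Rightarrow> real" where
  "DEd y x v = (\<Sum>n. DEk n y x v)"

lemma summable_abs_Ek: "summable (\<lambda>n. \<bar>Ek n y x\<bar>)"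
  using summable_comparison_test'[of "\<lambda>n. (norm x * norm y) ^ n / fact n" 0 "\<lambda>n. \<bar>Ek n y x\<bar>"]
    Ek_bound sums_summable[OF sums_exp_real] by simp

lemma summable_Ek: "summable (\<lambda>n. Ek n y x)"
  using summable_abs_Ek by (rule summable_rabs_cancel)

text \<open>The degree 0 part is exactly 1, and the rest is majorised by the exponential series
  without its first term. The bound involves only the product of the norms, so it is small when
  either argument is small and treats both alike.\<close>

lemma Ed_minus_one_le: "\<bar>Ed x y - 1\<bar> \<le> exp (norm x * norm y) - 1"
proof -
  define c where "c = norm x * norm y"
  have "Ed x y - 1 = (\<Sum>n. Ek (Suc n) y x)"
    using suminf_split_head[OF summable_Ek[of y x]] by (simp add: Ed_def)
  also have "\<bar>\<dots>\<bar> \<le> (\<Sum>n. \<bar>Ek (Suc n) y x\<bar>)"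
    using summable_abs_Ek[of y x] by (intro summable_rabs) (rule summable_Suc_iff[THEN iffD2])
  also have "\<dots> \<le> (\<Sum>n. c ^ Suc n / fact (Suc n))"
    using summable_abs_Ek[of y x] sums_summable[OF sums_exp_real[of c]] Ek_bound
    by (intro suminf_le) (auto simp only: c_def summable_Suc_iff[of "\<lambda>n. \<bar>Ek n y x\<bar>"]
        summable_Suc_iff[of "\<lambda>n. (norm x * norm y) ^ n / fact n"])
  also have "\<dots> = exp c - 1"
    using suminf_split_head[OF sums_summable[OF sums_exp_real[of c]]] sums_unique[OF sums_exp_real[of c]]
    by simp
  finally show ?thesis by (simp add: c_def)
qed

lemma Ed_zero: "Ed 0 y = 1"
  using Ed_minus_one_le[of 0 y] by simp

text \<open>Joint continuity is what later makes the heat kernel jointly measurable in time and both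
  space variables.\<close>

lemma continuous_Ed: "continuous_on UNIV (\<lambda>p. Ed (fst p) (snd p))"
proof -
  have "continuous_on (ball 0 r) (\<lambda>p. Ed (fst p) (snd p))" for r :: real
  proof (rule uniform_limit_theorem)
    show "uniform_limit (ball 0 r) (\<lambda>n p. \<Sum>i<n. Ek i (snd p) (fst p)) (\<lambda>p. Ed (fst p) (snd p)) sequentially"
      unfolding Ed_def
    proof (rule Weierstrass_m_test)
      fix n and p :: "'a \<times> 'a" assume "p \<in> ball 0 r"
      then have p: "norm p < r" by simp
      have "norm (fst p) \<le> r" "norm (snd p) \<le> r"
        using norm_fst_le[of "fst p" "snd p"] norm_snd_le[of "snd p" "fst p"] p by auto
      then have "(norm (fst p) * norm (snd p)) ^ n / fact n \<le> (r * r) ^ n / fact n"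
        by (intro divide_right_mono power_mono mult_mono) (auto intro: order_trans[OF norm_ge_zero])
      then show "norm (Ek n (snd p) (fst p)) \<le> (r * r) ^ n / fact n"
        using Ek_bound[of n "snd p" "fst p"] by simp
    next
      show "summable (\<lambda>n. (r * r) ^ n / fact n)"
        by (rule sums_summable[OF sums_exp_real])
    qed
    show "\<forall>\<^sub>F n in sequentially. continuous_on (ball 0 r) (\<lambda>p. \<Sum>i<n. Ek i (snd p) (fst p))"
      by (intro always_eventually allI continuous_on_sum continuous_on_subset[OF continuous_Ek]) simp
  qed simp
  then have "continuous_on (\<Union>r. ball 0 r) (\<lambda>p. Ed (fst p) (snd p))"
    by (intro continuous_on_open_UN) auto
  moreover have "(\<Union>r. ball (0 :: 'a \<times> 'a) r) = UNIV"
    using gt_ex by (auto simp: dist_norm)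
  ultimately show ?thesis by simp
qed

text \<open>A majorant for \<open>DEk n y x v\<close> on the ball of radius r, with the norm of v
  taken out. The case split is the shift of index under differentiation: degree m + 1 contributes
  the power m, and degree 0 nothing.\<close>

definition DEb :: "'a \<Rightarrow> real \<Rightarrow> nat \<Rightarrow> real" where
  "DEb y r n = (case n of 0 \<Rightarrow> 0 | Suc m \<Rightarrow> norm y * ((r * norm y) ^ m / fact m))"

lemma summable_DEb: "summable (DEb y r)"
proof -
  have "summable (\<lambda>n. DEb y r (Suc n))"
    unfolding DEb_def nat.case by (intro summable_mult sums_summable[OF sums_exp_real])
  then show ?thesis by (rule summable_Suc_iff[THEN iffD1])
qed

lemma DEk_le: "norm x \<le> r \<Longrightarrow> \<bar>DEk n y x v\<bar> \<le> norm v * DEb y r n"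
proof (cases n)
  case (Suc m)
  assume "norm x \<le> r"
  then have "norm v * norm y * ((norm x * norm y) ^ m / fact m)
    \<le> norm v * norm y * ((r * norm y) ^ m / fact m)"
    by (intro mult_left_mono divide_right_mono power_mono mult_right_mono) auto
  then show ?thesis
    using DEk_bound[of m y x v] by (simp add: Suc DEb_def mult.assoc)
qed (simp add: DEb_def)

lemma summable_DEk: "summable (\<lambda>n. DEk n y x v)"
  by (rule summable_comparison_test'[of "\<lambda>n. norm v * DEb y (norm x) n" 0])
    (use DEk_le[of x "norm x"] in \<open>auto intro: summable_mult summable_DEb\<close>)

lemma has_derivative_Ed: "((\<lambda>z. Ed z y) has_derivative DEd y x) (at x)"
proof -
  define r where "r = norm x + 1"
  have "\<exists>g. \<forall>z\<in>ball 0 r. (\<lambda>n. Ek n y z) sums g z \<and> (g has_derivative DEd y z) (at z within ball 0 r)"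
  proof (rule has_derivative_series)
    show "(\<lambda>n. Ek n y 0) sums Ed 0 y"
      unfolding Ed_def by (rule summable_sums[OF summable_Ek])
    show "(Ek n y has_derivative DEk n y z) (at z within ball 0 r)" for n z
      by (rule has_derivative_at_withinI[OF has_derivative_Ek])
    show "\<forall>\<^sub>F n in sequentially. \<forall>z\<in>ball 0 r. \<forall>h. norm ((\<Sum>i<n. DEk i y z h) - DEd y z h) \<le> e * norm h"
      if e: "0 < e" for e
    proof -
      \<comment> \<open>Termwise differentiation requires a remainder at most e times the norm of h,
        uniformly on the ball; the tail of \<open>DEb\<close> contains neither the point nor
        h.\<close>
      obtain N where N: "\<And>n. N \<le> n \<Longrightarrow> norm (\<Sum>i. DEb y r (i + n)) < e"
        using suminf_exist_split[OF e summable_DEb[of y r]] by blast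
      have "norm ((\<Sum>i<n. DEk i y z h) - DEd y z h) \<le> e * norm h" if n: "N \<le> n" and z: "z \<in> ball 0 r" for n z h
      proof -
        have zr: "norm z \<le> r" using z by simp
        have "DEd y z h - (\<Sum>i<n. DEk i y z h) = (\<Sum>i. DEk (i + n) y z h)"
          unfolding DEd_def using suminf_split_initial_segment[OF summable_DEk, of y z h n] by simp
        moreover have "\<bar>\<Sum>i. DEk (i + n) y z h\<bar> \<le> (\<Sum>i. norm h * DEb y r (i + n))"
        proof -
          have s: "summable (\<lambda>i. norm h * DEb y r (i + n))"
            by (intro summable_mult summable_ignore_initial_segment summable_DEb)
          have s': "summable (\<lambda>i. \<bar>DEk (i + n) y z h\<bar>)"
            by (rule summable_comparison_test'[OF s, of 0]) (use DEk_le[OF zr] in auto)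
          show ?thesis
            by (rule order_trans[OF summable_rabs[OF s'] suminf_le[OF DEk_le[OF zr] s' s]])
        qed
        moreover have "(\<Sum>i. norm h * DEb y r (i + n)) \<le> norm h * e"
          using N[OF n] suminf_mult[OF summable_ignore_initial_segment[OF summable_DEb[of y r], of n], of "norm h"]
          by (auto intro!: mult_left_mono)
        ultimately show ?thesis by (simp add: mult.commute abs_minus_commute)
      qed
      then show ?thesis unfolding eventually_sequentially by blast
    qed
  qed (auto simp: r_def add_nonneg_pos)
  then obtain g where g: "\<And>z. z \<in> ball 0 r \<Longrightarrow> (\<lambda>n. Ek n y z) sums g z"
    "\<And>z. z \<in> ball 0 r \<Longrightarrow> (g has_derivative DEd y z) (at z within ball 0 r)" by blast
  have x: "x \<in> ball 0 r" by (simp add: r_def)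
  have "(g has_derivative DEd y x) (at x)"
    using g(2)[OF x] at_within_open[OF x] by simp
  moreover have "g z = Ed z y" if "z \<in> ball 0 r" for z
    using sums_unique[OF g(1)[OF that]] by (simp add: Ed_def)
  ultimately show ?thesis
    by (rule has_derivative_transform_within_open[OF _ open_ball x])
qed

lemma continuous_DEd: "continuous_on UNIV (\<lambda>x. DEd y x v)"
proof -
  have "continuous_on (ball 0 r) (\<lambda>x. DEd y x v)" for r :: real
  proof (rule uniform_limit_theorem)
    show "uniform_limit (ball 0 r) (\<lambda>n x. \<Sum>i<n. DEk i y x v) (\<lambda>x. DEd y x v) sequentially"
      unfolding DEd_def
    proof (rule Weierstrass_m_test)
      show "norm (DEk n y x v) \<le> norm v * DEb y r n" if "x \<in> ball 0 r" for n x
        using DEk_le[of x r] that by simp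
    qed (intro summable_mult summable_DEb)
    show "\<forall>\<^sub>F n in sequentially. continuous_on (ball 0 r) (\<lambda>x. \<Sum>i<n. DEk i y x v)"
      by (intro always_eventually allI continuous_on_sum continuous_on_subset[OF continuous_DEk]) simp
  qed simp
  then have "continuous_on (\<Union>r. ball 0 r) (\<lambda>x. DEd y x v)"
    by (intro continuous_on_open_UN) auto
  moreover have "(\<Union>r. ball (0 :: 'a) r) = UNIV"
    using gt_ex by (auto simp: dist_norm)
  ultimately show ?thesis by simp
qed

lemma Ed_dunkl:
  assumes x: "reg x"
  shows "DEd y x v + (\<Sum>b\<in>Rp. \<kappa> b * (b \<bullet> v) * (Ed x y - Ed (refl b x) y) / (b \<bullet> x)) = (v \<bullet> y) * Ed x y"
proof -
  let ?T = "\<lambda>n. DEk n y x v + (\<Sum>b\<in>Rp. \<kappa> b * (b \<bullet> v) * (Ek n y x - Ek n y (refl b x)) / (b \<bullet> x))"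
  have E: "(\<lambda>n. Ek n y z) sums Ed z y" for z
    unfolding Ed_def by (rule summable_sums[OF summable_Ek])
  have "(\<lambda>n. DEk n y x v) sums DEd y x v"
    unfolding DEd_def by (rule summable_sums[OF summable_DEk])
  then have T: "?T sums (DEd y x v + (\<Sum>b\<in>Rp. \<kappa> b * (b \<bullet> v) * (Ed x y - Ed (refl b x) y) / (b \<bullet> x)))"
    by (intro sums_add sums_sum sums_divide sums_mult sums_diff E)
  \<comment> \<open>The operator lowers the degree by one, so the shifted series is a multiple of
    the series for E. The term of index 0 vanishes because \<open>Ek 0\<close> is constant.\<close>
  have "(\<lambda>n. ?T (Suc n)) sums ((v \<bullet> y) * Ed x y)"
    unfolding Ek_dunkl[OF x] by (intro sums_mult E)
  then have "?T sums ((v \<bullet> y) * Ed x y + ?T 0)"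
    by (rule sums_Suc)
  with T show ?thesis
    using sums_unique2 by fastforce
qed

lemma is_dunkl_kernel_Ed: "is_dunkl_kernel Rp \<kappa> Ed"
proof -
  have F: "frechet_derivative (\<lambda>z. Ed z y) (at x) = DEd y x" for x y
    using frechet_derivative_at[OF has_derivative_Ed, of y x] by simp
  show ?thesis
    unfolding is_dunkl_kernel_def F
    using has_derivative_Ed continuous_DEd Ed_zero Ed_dunkl
    by (auto simp: differentiable_def reg_def)
qed

section \<open>Uniqueness of the kernel\<close>

text \<open>Along the orbit of a ray, the sum of the squares satisfies a Gronwall inequality, because
  the reflection terms are dissipative.\<close>

lemma ray_uniqueness_reg:
  assumes deriv: "\<And>x. (f has_derivative f' x) (at x)" and f0: "f 0 = (0::real)"
    and eq: "\<And>x. reg x \<Longrightarrow> f' x x + (\<Sum>b\<in>Rp. \<kappa> b * (f x - f (refl b x))) = (x \<bullet> y) * f x"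
    and x: "reg x"
  shows "f x = 0"
proof -
  define C where "C = norm x * norm y"
  define S where "S t = (\<Sum>g\<in>G. (f (t *\<^sub>R g x))\<^sup>2)" for t
  define S' where "S' t = (\<Sum>g\<in>G. 2 * f (t *\<^sub>R g x) * f' (t *\<^sub>R g x) (g x))" for t
  have dS: "(S has_real_derivative S' t) (at t)" for t
  proof -
    have 1: "((\<lambda>t. f (t *\<^sub>R g x)) has_real_derivative f' (t *\<^sub>R g x) (g x)) (at t)" for g
    proof -
      have "((\<lambda>t. t *\<^sub>R g x) has_derivative (\<lambda>h. h *\<^sub>R g x)) (at t)"
        by (auto intro!: derivative_eq_intros)
      from diff_chain_at[OF this deriv]
      have "((\<lambda>t. f (t *\<^sub>R g x)) has_derivative (\<lambda>h. f' (t *\<^sub>R g x) (h *\<^sub>R g x))) (at t)"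
        by (simp add: comp_def)
      moreover have "(\<lambda>h. f' z (h *\<^sub>R v)) = (*) (f' z v)" for z v
        using linear_scale[OF has_derivative_linear[OF deriv]] by (simp add: fun_eq_iff)
      ultimately show ?thesis
        by (simp add: has_field_derivative_def)
    qed
    show ?thesis
      unfolding S_def[abs_def] S'_def
      by (auto intro!: derivative_eq_intros 1 sum.cong)
  qed
  \<comment> \<open>The origin lies on every reflecting hyperplane, where the equation is not
    assumed; for t = 0 both sides vanish through \<open>f 0 = 0\<close> instead.\<close>
  have S'_le: "S' t \<le> 2 * C * S t" if "0 \<le> t" for t
  proof (cases "t = 0")
    case True
    then show ?thesis by (simp add: S'_def S_def f0)
  next
    case False
    with that have t: "0 < t" by simp
    define z where "z g = t *\<^sub>R g x" for g :: "'a \<Rightarrow> 'a"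
    have zreg: "reg (z g)" if "g \<in> G" for g
      using reg_G[OF that x] t by (simp add: z_def reg_def)
    have zrefl: "z (refl b \<circ> g) = refl b (z g)" for b g
      by (simp add: z_def refl_scaleR)
    \<comment> \<open>The factor t turns the velocity \<open>g x\<close> into the position
      \<open>z g\<close>, which is the direction in which the equation is given.\<close>
    have "t * S' t = (\<Sum>g\<in>G. 2 * f (z g) * f' (z g) (z g))"
      using linear_scale[OF has_derivative_linear[OF deriv]]
      by (simp add: S'_def sum_distrib_left z_def mult_ac)
    also have "\<dots> = (\<Sum>g\<in>G. 2 * (z g \<bullet> y) * (f (z g))\<^sup>2
        - (\<Sum>b\<in>Rp. \<kappa> b * (2 * f (z g) * (f (z g) - f (refl b (z g))))))"
    proof (intro sum.cong refl)
      fix g assume "g \<in> G"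
      then have "f' (z g) (z g) = (z g \<bullet> y) * f (z g) - (\<Sum>b\<in>Rp. \<kappa> b * (f (z g) - f (refl b (z g))))"
        using eq[OF zreg] by (simp add: algebra_simps)
      then show "2 * f (z g) * f' (z g) (z g) = 2 * (z g \<bullet> y) * (f (z g))\<^sup>2
        - (\<Sum>b\<in>Rp. \<kappa> b * (2 * f (z g) * (f (z g) - f (refl b (z g)))))"
        by (simp add: power2_eq_square right_diff_distrib sum_distrib_left mult_ac)
    qed
    also have "\<dots> = (\<Sum>g\<in>G. 2 * (z g \<bullet> y) * (f (z g))\<^sup>2)
        - (\<Sum>b\<in>Rp. \<kappa> b * (\<Sum>g\<in>G. 2 * f (z g) * (f (z g) - f (refl b (z g)))))"
      by (simp add: sum_subtractf sum.swap[of _ Rp] sum_distrib_left)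
    also have "\<dots> \<le> (\<Sum>g\<in>G. 2 * (t * C) * (f (z g))\<^sup>2) - 0"
    proof (rule diff_mono)
      show "(\<Sum>g\<in>G. 2 * (z g \<bullet> y) * (f (z g))\<^sup>2) \<le> (\<Sum>g\<in>G. 2 * (t * C) * (f (z g))\<^sup>2)"
      proof (intro sum_mono mult_right_mono mult_left_mono)
        fix g assume "g \<in> G"
        then show "z g \<bullet> y \<le> t * C"
          using norm_cauchy_schwarz[of "z g" y] t by (simp add: z_def C_def mult.assoc)
      qed auto
      show "0 \<le> (\<Sum>b\<in>Rp. \<kappa> b * (\<Sum>g\<in>G. 2 * f (z g) * (f (z g) - f (refl b (z g)))))"
      proof (rule sum_nonneg)
        fix b assume b: "b \<in> Rp"
        \<comment> \<open>Reindexing by left multiplication with \<open>refl b\<close> shows that f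
          and its reflected copy have the same sum of squares over the orbit, so the cross term
          completes a square.\<close>
        have "(\<Sum>g\<in>G. (f (refl b (z g)))\<^sup>2) = (\<Sum>g\<in>G. (f (z g))\<^sup>2)"
          using sum_G_left[OF b, of "\<lambda>g. (f (z g))\<^sup>2"] by (simp add: zrefl)
        then have "(\<Sum>g\<in>G. 2 * f (z g) * (f (z g) - f (refl b (z g)))) = (\<Sum>g\<in>G. (f (z g) - f (refl b (z g)))\<^sup>2)"
          by (simp add: power2_diff sum_subtractf sum.distrib right_diff_distrib power2_eq_square sum_distrib_left mult_ac)
        also have "\<dots> \<ge> 0" by (intro sum_nonneg) simp
        finally show "0 \<le> \<kappa> b * (\<Sum>g\<in>G. 2 * f (z g) * (f (z g) - f (refl b (z g))))"
          using kappa_nonneg[OF Rp_R[OF b]] by simp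
      qed
    qed
    also have "\<dots> = t * (2 * C * S t)"
      by (simp add: S_def z_def sum_distrib_left mult_ac)
    finally show ?thesis using t by simp
  qed
  have "exp (- 2 * C * 1) * S 1 \<le> exp (- 2 * C * 0) * S 0"
  proof (rule DERIV_nonpos_imp_nonincreasing[where f = "\<lambda>t. exp (- 2 * C * t) * S t"])
    fix t :: real assume t: "0 \<le> t" "t \<le> 1"
    have "((\<lambda>t. exp (- 2 * C * t) * S t) has_real_derivative exp (- 2 * C * t) * (S' t - 2 * C * S t)) (at t)"
      by (auto intro!: derivative_eq_intros dS simp: algebra_simps)
    moreover have "exp (- 2 * C * t) * (S' t - 2 * C * S t) \<le> 0"
      using S'_le[OF t(1)] by (intro mult_nonneg_nonpos) auto
    ultimately show "\<exists>d. ((\<lambda>t. exp (- 2 * C * t) * S t) has_real_derivative d) (at t) \<and> d \<le> 0"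
      by blast
  qed simp
  then have "S 1 \<le> 0"
    by (simp add: S_def f0 mult_le_0_iff)
  moreover have "(f (1 *\<^sub>R id x))\<^sup>2 \<le> S 1"
    unfolding S_def by (rule member_le_sum[OF id_in_G]) (use finite_G in auto)
  ultimately show ?thesis
    by (smt (verit) id_apply scaleR_one zero_eq_power2 zero_le_power2)
qed

text \<open>A line in a direction orthogonal to no root meets each of the finitely many hyperplanes
  at most once. By continuity this extends the vanishing of f from regular points to all
  points.\<close>

lemma reg_dense:
  obtains d where "eventually (\<lambda>t. reg (x + t *\<^sub>R d)) (at 0)"
proof -
  obtain d where d: "\<And>a. a \<in> R \<Longrightarrow> a \<bullet> d \<noteq> 0" using positive_direction by blast
  have "eventually (\<lambda>t. a \<bullet> (x + t *\<^sub>R d) \<noteq> 0) (at 0)" if "a \<in> Rp" for a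
  proof -
    have "{t. a \<bullet> (x + t *\<^sub>R d) = 0} \<subseteq> {- (a \<bullet> x) / (a \<bullet> d)}"
      using d[OF Rp_R[OF that]] by (auto simp: inner_add_right field_simps)
    then have "finite {t. a \<bullet> (x + t *\<^sub>R d) = 0}" by (rule finite_subset) simp
    then have "finite ({t. a \<bullet> (x + t *\<^sub>R d) = 0} - {0})" by simp
    then have "open (- ({t. a \<bullet> (x + t *\<^sub>R d) = 0} - {0}))"
      by (intro open_Compl finite_imp_closed)
    then show ?thesis
      unfolding eventually_at_topological
      by (intro exI[of _ "- ({t. a \<bullet> (x + t *\<^sub>R d) = 0} - {0})"]) auto
  qed
  then have "eventually (\<lambda>t. reg (x + t *\<^sub>R d)) (at 0)"
    unfolding reg_def using finite_Rp by (simp add: eventually_ball_finite)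
  then show ?thesis by (rule that)
qed

lemma ray_uniqueness:
  assumes deriv: "\<And>x. (f has_derivative f' x) (at x)" and f0: "f 0 = (0::real)"
    and eq: "\<And>x. reg x \<Longrightarrow> f' x x + (\<Sum>b\<in>Rp. \<kappa> b * (f x - f (refl b x))) = (x \<bullet> y) * f x"
  shows "f x = 0"
proof -
  obtain d where d: "eventually (\<lambda>t. reg (x + t *\<^sub>R d)) (at 0)" using reg_dense by blast
  have "isCont f x" for x using has_derivative_continuous[OF deriv] .
  then have "continuous_on UNIV f" by (simp add: continuous_on_eq_continuous_at)
  then have "continuous_on UNIV (\<lambda>t::real. f (x + t *\<^sub>R d))"
    by (rule continuous_on_compose2) (auto intro!: continuous_intros)
  then have "((\<lambda>t. f (x + t *\<^sub>R d)) \<longlongrightarrow> f (x + 0 *\<^sub>R d)) (at 0)"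
    unfolding continuous_on_def by blast
  moreover have "((\<lambda>t. f (x + t *\<^sub>R d)) \<longlongrightarrow> 0) (at 0)"
  proof (rule tendsto_eventually)
    show "eventually (\<lambda>t. f (x + t *\<^sub>R d) = 0) (at 0)"
      using d by eventually_elim (rule ray_uniqueness_reg[OF deriv f0 eq])
  qed
  ultimately have "f (x + 0 *\<^sub>R d) = 0"
    using tendsto_unique[of "at (0::real)"] by fastforce
  then show ?thesis by simp
qed

text \<open>With x itself as the direction, \<open>b \<bullet> x\<close> cancels the denominator of
  the difference quotient. The difference of two kernels then satisfies the linear equation of
  \<open>ray_uniqueness\<close> with value 0 at the origin.\<close>

lemma is_dunkl_kernel_unique:
  assumes "is_dunkl_kernel Rp \<kappa> E1" "is_dunkl_kernel Rp \<kappa> E2"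
  shows "E1 = E2"
proof (intro ext)
  fix x y :: 'a
  let ?D = "\<lambda>E x. frechet_derivative (\<lambda>z. E z y) (at x)"
  have d: "((\<lambda>z. E z y) has_derivative ?D E x) (at x)" if "is_dunkl_kernel Rp \<kappa> E" for E x
    using that by (auto simp: is_dunkl_kernel_def frechet_derivative_works)
  have e: "?D E x x + (\<Sum>b\<in>Rp. \<kappa> b * (E x y - E (refl b x) y)) = (x \<bullet> y) * E x y"
    if E: "is_dunkl_kernel Rp \<kappa> E" and x: "reg x" for E x
  proof -
    have s: "(\<Sum>b\<in>Rp. \<kappa> b * (E x y - E (refl b x) y))
      = (\<Sum>b\<in>Rp. \<kappa> b * (b \<bullet> x) * (E x y - E (refl b x) y) / (b \<bullet> x))"
      using x by (intro sum.cong refl) (auto simp: reg_def)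
    show ?thesis
      using E x unfolding is_dunkl_kernel_def reg_def s by blast
  qed
  have "E1 x y - E2 x y = 0"
  proof (rule ray_uniqueness[where f = "\<lambda>x. E1 x y - E2 x y" and f' = "\<lambda>x v. ?D E1 x v - ?D E2 x v" and y = y])
    show "((\<lambda>x. E1 x y - E2 x y) has_derivative (\<lambda>v. ?D E1 x v - ?D E2 x v)) (at x)" for x
      by (intro has_derivative_diff d assms)
    show "E1 0 y - E2 0 y = 0"
      using assms by (simp add: is_dunkl_kernel_def)
    fix x assume "reg x"
    from e[OF assms(1) this] e[OF assms(2) this]
    show "?D E1 x x - ?D E2 x x + (\<Sum>b\<in>Rp. \<kappa> b * (E1 x y - E2 x y - (E1 (refl b x) y - E2 (refl b x) y)))
      = (x \<bullet> y) * (E1 x y - E2 x y)"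
      by (simp add: right_diff_distrib sum_subtractf)
  qed
  then show "E1 x y = E2 x y" by simp
qed

theorem dunkl_kernel_eq: "dunkl_kernel Rp \<kappa> = Ed"
  unfolding dunkl_kernel_def
proof (rule the_equality)
  show "is_dunkl_kernel Rp \<kappa> Ed" by (rule is_dunkl_kernel_Ed)
  then show "E = Ed" if "is_dunkl_kernel Rp \<kappa> E" for E
    using that by (rule is_dunkl_kernel_unique[rotated])
qed

end

section \<open>Heat kernel estimates\<close>

lemma power_le_exp: "0 \<le> x \<Longrightarrow> x ^ n \<le> fact n * exp (x :: real)"
proof -
  assume x: "0 \<le> x"
  have "x ^ n / fact n \<le> exp x"
    using sum_le_suminf[OF sums_summable[OF sums_exp_real[of x]], of "{n}"] x
      sums_unique[OF sums_exp_real[of x]] by simp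
  then show ?thesis by (simp add: field_simps)
qed

lemma nn_integral_exp_norm:
  "(\<integral>\<^sup>+ x. ennreal (exp (- norm (x::'a::euclidean_space))) \<partial>lborel) < \<infinity>"
proof -
  let ?n = "DIM('a)"
  let ?V = "unit_ball_vol (real ?n)"
  \<comment> \<open>From \<open>power_le_exp\<close> at (k + 1)/2: half of the exponential decay
    absorbs the growth of the ball volumes, at the cost of \<open>2 ^ n * fact n * exp (1/2)\<close>
    for dimension n.\<close>
  define C where "C = ?V * (2 ^ ?n * fact ?n * exp (1/2))"
  have "(\<integral>\<^sup>+ x. ennreal (exp (- norm (x::'a))) \<partial>lborel)
    \<le> (\<integral>\<^sup>+ x. (\<Sum>k. ennreal (exp (- real k)) * indicator (ball 0 (real k + 1)) (x::'a)) \<partial>lborel)"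
  proof (rule nn_integral_mono)
    fix x :: 'a
    define k where "k = nat \<lfloor>norm x\<rfloor>"
    have k: "real k \<le> norm x" "norm x < real k + 1"
      by (simp_all add: k_def)
    define F where "F k = ennreal (exp (- real k)) * indicator (ball 0 (real k + 1)) x" for k
    have "ennreal (exp (- norm x)) \<le> F k"
      using k by (simp add: F_def)
    also have "\<dots> \<le> (\<Sum>k. F k)"
      using sum_le_suminf[of F "{k}"] by simp
    finally show "ennreal (exp (- norm x)) \<le> (\<Sum>k. ennreal (exp (- real k)) * indicator (ball 0 (real k + 1)) x)"
      by (simp add: F_def)
  qed
  also have "\<dots> = (\<Sum>k. ennreal (exp (- real k)) * emeasure lborel (ball (0::'a) (real k + 1)))"
    by (subst nn_integral_suminf)
      (auto simp: nn_integral_cmult_indicator intro!: borel_measurable_times_ennreal borel_measurable_indicator)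
  also have "\<dots> = (\<Sum>k. ennreal (exp (- real k) * (?V * (real k + 1) ^ ?n)))"
    by (simp add: emeasure_ball ennreal_mult)
  also have "\<dots> \<le> (\<Sum>k. ennreal (C * exp (- 1 / 2) ^ k))"
  proof (intro suminf_le summableI ennreal_leI)
    fix k
    have "((real k + 1) / 2) ^ ?n \<le> fact ?n * exp ((real k + 1) / 2)"
      by (rule power_le_exp) simp
    then have "exp (- real k) * (?V * (real k + 1) ^ ?n) \<le> exp (- real k) * (?V * (2 ^ ?n * (fact ?n * exp ((real k + 1) / 2))))"
      by (intro mult_left_mono) (simp_all add: power_divide field_simps)
    also have "\<dots> = C * (exp (- real k) * exp (real k / 2))"
      by (simp add: C_def add_divide_distrib exp_add)
    also have "exp (- real k) * exp (real k / 2) = exp (- 1 / 2) ^ k"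
      by (simp flip: exp_add exp_of_nat_mult)
    finally show "exp (- real k) * (?V * (real k + 1) ^ ?n) \<le> C * exp (- 1 / 2) ^ k" .
  qed
  also have "\<dots> < \<infinity>"
  proof -
    have "summable (\<lambda>k. C * exp (- 1 / 2) ^ k)"
      by (intro summable_mult summable_geometric) simp
    moreover have "0 \<le> C" by (simp add: C_def)
    ultimately show ?thesis by (subst suminf_ennreal2) auto
  qed
  finally show ?thesis .
qed

section \<open>The weight, Gaussian integrals and the Mehta constant\<close>

context dunkl
begin

abbreviation W :: "'a \<Rightarrow> real" where "W \<equiv> dunkl_weight Rp \<kappa>"

abbreviation \<mu> :: "'a measure" where "\<mu> \<equiv> dunkl_measure Rp \<kappa>"

abbreviation mc :: real where "mc \<equiv> mehta_const Rp \<kappa>"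

lemma W_nonneg [simp]: "0 \<le> W x"
  unfolding dunkl_weight_def by (intro prod_nonneg) auto

lemma W_measurable [measurable]: "W \<in> borel_measurable borel"
  unfolding dunkl_weight_def by measurable

lemma W_scale:
  assumes "0 < c"
  shows "W (c *\<^sub>R x) = c powr (2 * gam) * W x"
proof -
  have "W (c *\<^sub>R x) = (\<Prod>a\<in>Rp. c powr (2 * \<kappa> a) * (if \<kappa> a = 0 then 1 else \<bar>a \<bullet> x\<bar> powr (2 * \<kappa> a)))"
    unfolding dunkl_weight_def
    by (intro prod.cong refl) (use assms in \<open>auto simp: abs_mult powr_mult\<close>)
  also have "\<dots> = c powr (2 * gam) * W x"
    using assms
    by (simp add: prod.distrib dunkl_weight_def powr_sum[symmetric] gam_def sum_distrib_left)
  finally show ?thesis .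
qed

text \<open>Exponential growth is harmless against a Gaussian. The 4 arises from \<open>\<bar>a
  \<bullet> x\<bar> \<le> 2 * norm x \<le> exp (2 * norm x)\<close>, raised to the power
  \<open>2 * \<kappa> a\<close>.\<close>

lemma W_le: "W x \<le> exp (4 * gam * norm x)"
proof -
  have "W x \<le> (\<Prod>a\<in>Rp. exp (4 * \<kappa> a * norm x))"
    unfolding dunkl_weight_def
  proof (intro prod_mono conjI)
    fix a assume a: "a \<in> Rp"
    have k: "0 \<le> \<kappa> a" using kappa_nonneg Rp_R a by blast
    have s: "sqrt 2 \<le> 2" by (rule real_le_lsqrt) auto
    have "\<bar>a \<bullet> x\<bar> \<le> sqrt 2 * norm x"
      using Cauchy_Schwarz_ineq2[of a x] root_norm[OF Rp_R[OF a]] by simp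
    also have "\<dots> \<le> 2 * norm x"
      using s by (intro mult_right_mono) auto
    finally have "\<bar>a \<bullet> x\<bar> \<le> exp (2 * norm x)"
      using exp_ge_add_one_self[of "2 * norm x"] by linarith
    then have "\<bar>a \<bullet> x\<bar> powr (2 * \<kappa> a) \<le> exp (2 * norm x) powr (2 * \<kappa> a)"
      using k by (intro powr_mono2) auto
    also have "\<dots> = exp (4 * \<kappa> a * norm x)"
      by (simp add: powr_def mult_ac)
    finally show "(if \<kappa> a = 0 then 1 else \<bar>a \<bullet> x\<bar> powr (2 * \<kappa> a)) \<le> exp (4 * \<kappa> a * norm x)"
      by simp
  qed auto
  also have "\<dots> = exp (4 * gam * norm x)"
    by (simp add: exp_sum[OF finite_Rp, symmetric] gam_def sum_distrib_left sum_distrib_right)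
  finally show ?thesis .
qed

lemma sets_mu [simp, measurable_cong]: "sets \<mu> = sets lebesgue"
  by (simp add: dunkl_measure_def)

lemma space_mu [simp]: "space \<mu> = UNIV"
  by (simp add: dunkl_measure_def)

lemma borel_to_mu: "f \<in> borel_measurable borel \<Longrightarrow> f \<in> borel_measurable \<mu>"
  unfolding measurable_cong_sets[OF sets_mu HOL.refl]
  by (rule measurable_completion) (simp add: measurable_lborel1)

lemma nn_integral_mu:
  assumes [measurable]: "f \<in> borel_measurable borel"
  shows "(\<integral>\<^sup>+ x. f x \<partial>\<mu>) = (\<integral>\<^sup>+ x. ennreal (W x) * f x \<partial>lborel)"
proof -
  have "(\<integral>\<^sup>+ x. f x \<partial>\<mu>) = (\<integral>\<^sup>+ x. ennreal (W x) * f x \<partial>lebesgue)"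
    unfolding dunkl_measure_def
    by (rule nn_integral_density) (auto intro!: measurable_completion)
  then show ?thesis by (simp add: nn_integral_completion)
qed

text \<open>The weight is homogeneous of degree \<open>2 * gam\<close>, so dilations act as they
  would on a space of dimension \<open>2 * gam + DIM('a)\<close>.\<close>

lemma nn_integral_mu_scale:
  assumes [measurable]: "f \<in> borel_measurable borel" and c: "0 < c"
  shows "(\<integral>\<^sup>+ x. f ((1 / c) *\<^sub>R x) \<partial>\<mu>) = ennreal (c powr (2 * gam + real DIM('a))) * (\<integral>\<^sup>+ x. f x \<partial>\<mu>)"
proof -
  have "(\<integral>\<^sup>+ x. f ((1 / c) *\<^sub>R x) \<partial>\<mu>) = (\<integral>\<^sup>+ x. ennreal (W x) * f ((1 / c) *\<^sub>R x) \<partial>lborel)"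
    by (rule nn_integral_mu) measurable
  also have "\<dots> = (\<integral>\<^sup>+ x. ennreal (c ^ DIM('a)) * (ennreal (W (c *\<^sub>R x)) * f x) \<partial>lborel)"
    using c by (subst lborel_affine[of c 0]) (simp_all add: nn_integral_density nn_integral_distr)
  also have "\<dots> = (\<integral>\<^sup>+ x. ennreal (c powr (2 * gam + real DIM('a))) * (ennreal (W x) * f x) \<partial>lborel)"
    using c by (simp add: W_scale powr_add powr_realpow ennreal_mult mult_ac)
  also have "\<dots> = ennreal (c powr (2 * gam + real DIM('a))) * (\<integral>\<^sup>+ x. f x \<partial>\<mu>)"
    by (simp add: nn_integral_cmult nn_integral_mu)
  finally show ?thesis .
qed

lemma integrable_gauss:
  "integrable lborel (\<lambda>z. exp (r * norm z - (norm z)\<^sup>2 / 2) * W z)"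
proof -
  \<comment> \<open>Completing the square bounds \<open>L * norm z - (norm z)\<^sup>2 / 2\<close> by
    \<open>L\<^sup>2 / 2\<close>. The extra 1 in L is what leaves the integrable factor
    \<open>exp (- norm z)\<close>.\<close>
  define L where "L = \<bar>r\<bar> + 4 * gam + 1"
  have le: "exp (r * norm z - (norm z)\<^sup>2 / 2) * W z \<le> exp (L\<^sup>2 / 2) * exp (- norm z)" for z :: 'a
  proof -
    have "exp (r * norm z - (norm z)\<^sup>2 / 2) * W z
        \<le> exp (r * norm z - (norm z)\<^sup>2 / 2) * exp (4 * gam * norm z)"
      by (intro mult_left_mono W_le) auto
    also have "\<dots> = exp (r * norm z - (norm z)\<^sup>2 / 2 + 4 * gam * norm z)"
      by (simp add: exp_add)
    also have "\<dots> \<le> exp (L\<^sup>2 / 2 - norm z)"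
    proof -
      have "0 \<le> (L - norm z)\<^sup>2" by simp
      moreover have "r * norm z \<le> \<bar>r\<bar> * norm z"
        by (intro mult_right_mono) auto
      ultimately show ?thesis
        by (simp add: L_def power2_diff algebra_simps)
    qed
    finally show ?thesis by (simp add: mult_exp_exp)
  qed
  have "integrable lborel (\<lambda>z::'a. exp (- norm z))"
    by (rule integrableI_bounded) (use nn_integral_exp_norm[where 'a='a] in auto)
  then have i: "integrable lborel (\<lambda>z::'a. exp (L\<^sup>2 / 2) * exp (- norm z))"
    by simp
  show ?thesis
    by (rule Bochner_Integration.integrable_bound[OF i]) (use le in \<open>auto simp: abs_mult\<close>)
qed

lemma mehta_eq: "mc = (LINT z|lborel. exp (- (norm z)\<^sup>2 / 2) * W z)"
  unfolding mehta_const_def by (rule integral_completion) measurable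

lemma open_reg: "open {x. reg x}"
proof -
  have "{x. reg x} = (\<Inter>a\<in>Rp. {x. a \<bullet> x \<noteq> 0})" by (auto simp: reg_def)
  also have "open \<dots>"
    by (intro open_INT finite_Rp ballI open_Collect_neq continuous_intros)
  finally show ?thesis .
qed

text \<open>The heat kernel divides by this constant. Were it 0, the weight would vanish almost
  everywhere, although it is positive on the regular points, a nonempty open set.\<close>

lemma mehta_pos: "0 < mc"
proof -
  let ?f = "\<lambda>z::'a. exp (- (norm z)\<^sup>2 / 2) * W z"
  have i: "integrable lborel ?f" using integrable_gauss[of 0] by simp
  have "0 \<le> mc" unfolding mehta_eq by (intro integral_nonneg_AE) auto
  moreover have "mc \<noteq> 0"
  proof
    assume "mc = 0"
    then have "AE z in lborel. ?f z = 0"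
      unfolding mehta_eq using integral_nonneg_eq_0_iff_AE[OF i] by auto
    then have "AE z in lborel. \<not> reg z"
    proof eventually_elim
      case (elim z)
      then have "(\<Prod>a\<in>Rp. if \<kappa> a = 0 then 1 else \<bar>a \<bullet> z\<bar> powr (2 * \<kappa> a)) = 0"
        by (simp add: dunkl_weight_def)
      then show ?case
        using finite_Rp by (auto simp: reg_def split: if_splits)
    qed
    then have "AE z in lborel. z \<notin> {x. reg x}" by simp
    then have "{x. reg x} \<in> null_sets lborel"
      using open_reg by (subst AE_iff_null_sets) auto
    then have "negligible {x. reg x}"
      by (simp add: negligible_iff_null_sets null_sets_completionI)
    moreover obtain d where "\<And>a. a \<in> R \<Longrightarrow> a \<bullet> d \<noteq> 0" using positive_direction by blast
    then have "d \<in> {x. reg x}" using Rp_R by (simp add: reg_def)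
    ultimately show False using open_not_negligible[OF open_reg] by blast
  qed
  ultimately show ?thesis by simp
qed

section \<open>Comparison of the heat kernel with the kernel at the origin\<close>

definition hd_exp :: real where "hd_exp = gam + real DIM('a) / 2"

lemma hd_exp_pos: "0 < hd_exp"
  using gam_nonneg by (simp add: hd_exp_def add_nonneg_pos)

text \<open>The value of the heat kernel with both arguments at the origin; its decay exponent
  \<open>hd_exp\<close> is half the homogeneous dimension of the measure.\<close>

definition K :: "real \<Rightarrow> real" where "K t = (2 * t) powr (- hd_exp) / mc"

text \<open>\<open>q t\<close> is the heat kernel with one argument at the origin, and \<open>err t \<rho>\<close> bounds the
  change of the kernel when that argument moves within the ball of radius \<open>\<rho>\<close>.\<close>

definition q :: "real \<Rightarrow> 'a \<Rightarrow> real" where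
  "q t y = K t * exp (- (norm y)\<^sup>2 / (4 * t))"

definition err :: "real \<Rightarrow> real \<Rightarrow> 'a \<Rightarrow> real" where
  "err t \<rho> y = q t y * (exp (\<rho> * norm y / (2 * t)) - exp (- \<rho>\<^sup>2 / (4 * t)))"

text \<open>The total mass of \<open>err t \<rho>\<close>. By scaling it depends on
  \<open>\<rho>\<close> and t only through \<open>\<sigma> = \<rho> / sqrt (2 * t)\<close>.\<close>

definition eps :: "real \<Rightarrow> real" where
  "eps \<sigma> = (LINT z|lborel. (exp (\<sigma> * norm z - (norm z)\<^sup>2 / 2) - exp (- \<sigma>\<^sup>2 / 2) * exp (- (norm z)\<^sup>2 / 2)) * W z) / mc"

abbreviation p :: "real \<Rightarrow> 'a \<Rightarrow> 'a \<Rightarrow> real" where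
  "p \<equiv> dunkl_heat_kernel Rp \<kappa>"

lemma K_nonneg: "0 \<le> K t"
  using mehta_pos by (simp add: K_def)

lemma q_nonneg [simp]: "0 \<le> q t y"
  using K_nonneg by (simp add: q_def)

lemma q_le_K: "0 < t \<Longrightarrow> q t y \<le> K t"
  unfolding q_def using K_nonneg by (intro mult_right_le_one_le) auto

lemma q_measurable [measurable]: "q t \<in> borel_measurable borel"
  unfolding q_def[abs_def] by measurable

lemma err_measurable [measurable]: "err t \<rho> \<in> borel_measurable borel"
  unfolding err_def[abs_def] by measurable

lemma p_eq: "p t x y = K t * exp (- ((norm x)\<^sup>2 + (norm y)\<^sup>2) / (4 * t))
    * Ed ((1 / sqrt (2 * t)) *\<^sub>R x) ((1 / sqrt (2 * t)) *\<^sub>R y)"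
  by (simp add: dunkl_heat_kernel_def dunkl_kernel_eq K_def hd_exp_def gam_def)

text \<open>The number e stands for the kernel value and is kept abstract so that one estimate
  covers both orders of the arguments. With b the Gaussian factor in x, the deviation of
  \<open>b * e\<close> from 1 is at most that of e plus \<open>1 - b\<close>; these give the two
  exponentials in \<open>err\<close>.\<close>

lemma gauss_perturb:
  assumes t: "0 < t" and x: "norm x \<le> \<rho>" and E: "\<bar>e - 1\<bar> \<le> exp (norm x * norm y / (2 * t)) - 1"
  shows "\<bar>K t * exp (- ((norm x)\<^sup>2 + (norm y)\<^sup>2) / (4 * t)) * e - q t (y::'a)\<bar> \<le> err t \<rho> y"
proof -
  define b where "b = exp (- (norm x)\<^sup>2 / (4 * t))"
  have b: "0 \<le> b" "b \<le> 1" using t by (auto simp: b_def)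
  have b2: "exp (- \<rho>\<^sup>2 / (4 * t)) \<le> b"
    using t x unfolding b_def by (auto intro!: divide_right_mono power_mono)
  have e2: "exp (norm x * norm y / (2 * t)) \<le> exp (\<rho> * norm y / (2 * t))"
    using t x by (auto intro!: divide_right_mono mult_right_mono)
  have "\<bar>b * e - 1\<bar> \<le> b * \<bar>e - 1\<bar> + (1 - b)"
  proof -
    have "b * e - 1 = b * (e - 1) - (1 - b)" by (simp add: algebra_simps)
    then show ?thesis using b by (metis abs_mult abs_of_nonneg abs_triangle_ineq4 diff_ge_0_iff_ge)
  qed
  also have "\<dots> \<le> 1 * \<bar>e - 1\<bar> + (1 - b)"
    using b by (intro add_right_mono mult_right_mono) auto
  also have "\<dots> \<le> exp (\<rho> * norm y / (2 * t)) - exp (- \<rho>\<^sup>2 / (4 * t))"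
  proof -
    have "exp (norm x * norm y / (2 * t)) \<le> exp (\<rho> * norm y / (2 * t))" using e2 by simp
    moreover have "u \<le> X - 1 \<Longrightarrow> X \<le> Y \<Longrightarrow> Z \<le> b \<Longrightarrow> 1 * u + (1 - b) \<le> Y - Z" for u X Y Z :: real
      by simp
    ultimately show ?thesis using E b2 by blast
  qed
  finally have *: "q t y * \<bar>b * e - 1\<bar> \<le> err t \<rho> y"
    unfolding err_def by (intro mult_left_mono) auto
  have "exp (- ((norm x)\<^sup>2 + (norm y)\<^sup>2) / (4 * t)) = b * exp (- (norm y)\<^sup>2 / (4 * t))"
    unfolding b_def exp_add[symmetric] by (simp add: diff_divide_distrib)
  then have "K t * exp (- ((norm x)\<^sup>2 + (norm y)\<^sup>2) / (4 * t)) * e - q t y = q t y * (b * e - 1)"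
    by (simp add: q_def algebra_simps)
  then show ?thesis using * by (simp add: abs_mult)
qed

text \<open>The second inequality is for a bounded target set: there the second argument of the
  kernel is the one replaced by the origin.\<close>

lemma p_close:
  assumes t: "0 < t" and x: "norm x \<le> \<rho>"
  shows "\<bar>p t x y - q t y\<bar> \<le> err t \<rho> y" "\<bar>p t y x - q t y\<bar> \<le> err t \<rho> y"
proof -
  have n: "norm ((1 / sqrt (2 * t)) *\<^sub>R u) * norm ((1 / sqrt (2 * t)) *\<^sub>R v) = norm u * norm v / (2 * t)" for u v :: 'a
    using t by (simp add: field_simps)
  show "\<bar>p t x y - q t y\<bar> \<le> err t \<rho> y"
    unfolding p_eq using Ed_minus_one_le n by (intro gauss_perturb[OF t x]) metis
  have "\<bar>K t * exp (- ((norm x)\<^sup>2 + (norm y)\<^sup>2) / (4 * t)) *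
      Ed ((1 / sqrt (2 * t)) *\<^sub>R y) ((1 / sqrt (2 * t)) *\<^sub>R x) - q t y\<bar> \<le> err t \<rho> y"
    using Ed_minus_one_le n by (intro gauss_perturb[OF t x]) (metis mult.commute)
  then show "\<bar>p t y x - q t y\<bar> \<le> err t \<rho> y"
    by (simp add: p_eq add.commute)
qed

lemma err_nonneg: "0 < t \<Longrightarrow> 0 \<le> \<rho> \<Longrightarrow> 0 \<le> err t \<rho> y"
  using p_close(1)[of t 0 \<rho> y] by simp

text \<open>The Jacobian of the dilation by \<open>sqrt (2 * t)\<close> is
  \<open>(2 * t) powr hd_exp\<close>, exactly the power that \<open>K t\<close> divides by.\<close>

lemma nn_integral_heat_scale:
  assumes [measurable]: "F \<in> borel_measurable borel" and F: "\<And>z. 0 \<le> F z" and t: "0 < t"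
  shows "(\<integral>\<^sup>+ y. ennreal (K t * F ((1 / sqrt (2 * t)) *\<^sub>R y)) \<partial>\<mu>) = (\<integral>\<^sup>+ z. ennreal (F z / mc) \<partial>\<mu>)"
proof -
  let ?c = "sqrt (2 * t)"
  have c: "0 < ?c" using t by simp
  have "(\<integral>\<^sup>+ y. ennreal (K t * F ((1 / ?c) *\<^sub>R y)) \<partial>\<mu>)
    = ennreal (?c powr (2 * gam + real DIM('a))) * (\<integral>\<^sup>+ z. ennreal (K t * F z) \<partial>\<mu>)"
    by (rule nn_integral_mu_scale[OF _ c, of "\<lambda>z. ennreal (K t * F z)"]) measurable
  also have "\<dots> = (\<integral>\<^sup>+ z. ennreal (?c powr (2 * gam + real DIM('a))) * ennreal (K t * F z) \<partial>\<mu>)"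
    by (intro nn_integral_cmult[symmetric] borel_to_mu) measurable
  also have "\<dots> = (\<integral>\<^sup>+ z. ennreal (F z / mc) \<partial>\<mu>)"
  proof (intro nn_integral_cong)
    fix z
    have "?c powr (2 * gam + real DIM('a)) = (2 * t) powr hd_exp"
      using t by (simp add: powr_half_sqrt[symmetric] powr_powr hd_exp_def field_simps)
    then have "?c powr (2 * gam + real DIM('a)) * (K t * F z) = F z / mc"
      using t by (simp add: K_def powr_minus)
    then show "ennreal (?c powr (2 * gam + real DIM('a))) * ennreal (K t * F z) = ennreal (F z / mc)"
      using K_nonneg F by (simp flip: ennreal_mult)
  qed
  finally show ?thesis .
qed

lemma nn_integral_mu_eq:
  assumes i: "integrable lborel (\<lambda>z. F z * W z)" and F: "\<And>z. 0 \<le> F z"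
    and [measurable]: "F \<in> borel_measurable borel"
  shows "(\<integral>\<^sup>+ z. ennreal (F z / mc) \<partial>\<mu>) = ennreal ((LINT z|lborel. F z * W z) / mc)"
proof -
  have "(\<integral>\<^sup>+ z. ennreal (F z / mc) \<partial>\<mu>) = (\<integral>\<^sup>+ z. ennreal (W z) * ennreal (F z / mc) \<partial>lborel)"
    by (rule nn_integral_mu) measurable
  also have "\<dots> = (\<integral>\<^sup>+ z. ennreal (F z * W z / mc) \<partial>lborel)"
    using F mehta_pos by (simp add: ennreal_mult'[symmetric] mult.commute)
  also have "\<dots> = ennreal (LINT z|lborel. F z * W z / mc)"
    using F mehta_pos i by (intro nn_integral_eq_integral) auto
  finally show ?thesis by simp
qed

lemma q_total:
  assumes t: "0 < t"
  shows "(\<integral>\<^sup>+ y. ennreal (q t y) \<partial>\<mu>) = 1"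
proof -
  have "q t y = K t * exp (- (norm ((1 / sqrt (2 * t)) *\<^sub>R y))\<^sup>2 / 2)" for y
    using t by (simp add: q_def power_divide)
  then have "(\<integral>\<^sup>+ y. ennreal (q t y) \<partial>\<mu>) = (\<integral>\<^sup>+ z. ennreal (exp (- (norm z)\<^sup>2 / 2) / mc) \<partial>\<mu>)"
    using nn_integral_heat_scale[of "\<lambda>z. exp (- (norm z)\<^sup>2 / 2)", OF _ _ t] by simp
  also have "\<dots> = ennreal (mc / mc)"
    using nn_integral_mu_eq[of "\<lambda>z. exp (- (norm z)\<^sup>2 / 2)"] integrable_gauss[of 0]
    by (simp add: mehta_eq)
  finally show ?thesis using mehta_pos by simp
qed

lemma eps_integrable:
  "integrable lborel (\<lambda>z. (exp (\<sigma> * norm z - (norm z)\<^sup>2 / 2) - exp (- \<sigma>\<^sup>2 / 2) * exp (- (norm z)\<^sup>2 / 2)) * W z)"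
proof -
  have "integrable lborel (\<lambda>z. exp (\<sigma> * norm z - (norm z)\<^sup>2 / 2) * W z
      - exp (- \<sigma>\<^sup>2 / 2) * (exp (0 * norm z - (norm z)\<^sup>2 / 2) * W z))"
    by (intro Bochner_Integration.integrable_diff integrable_mult_right integrable_gauss)
  then show ?thesis by (simp add: algebra_simps)
qed

lemma eps_integrand_nonneg:
  assumes "0 \<le> \<sigma>"
  shows "0 \<le> exp (\<sigma> * norm z - (norm z)\<^sup>2 / 2) - exp (- \<sigma>\<^sup>2 / 2) * exp (- (norm (z::'a))\<^sup>2 / 2)"
proof -
  have "- \<sigma>\<^sup>2 / 2 + - (norm z)\<^sup>2 / 2 \<le> \<sigma> * norm z - (norm z)\<^sup>2 / 2"
  proof -
    have "0 \<le> \<sigma> * norm z" "- \<sigma>\<^sup>2 / 2 \<le> 0" using assms by simp_all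
    then show ?thesis by linarith
  qed
  then show ?thesis by (simp add: mult_exp_exp)
qed

lemma eps_nonneg: "0 \<le> \<sigma> \<Longrightarrow> 0 \<le> eps \<sigma>"
  unfolding eps_def using eps_integrand_nonneg mehta_pos
  by (intro divide_nonneg_nonneg integral_nonneg_AE) auto

lemma eps_mono:
  assumes "0 \<le> \<sigma>" "\<sigma> \<le> \<tau>"
  shows "eps \<sigma> \<le> eps \<tau>"
  unfolding eps_def
proof (rule divide_right_mono[OF integral_mono[OF eps_integrable eps_integrable]])
  fix z :: 'a
  have "exp (- \<tau>\<^sup>2 / 2) * exp (- (norm z)\<^sup>2 / 2) \<le> exp (- \<sigma>\<^sup>2 / 2) * exp (- (norm z)\<^sup>2 / 2)"
    using assms by (intro mult_right_mono) (auto intro!: power_mono)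
  moreover have "exp (\<sigma> * norm z - (norm z)\<^sup>2 / 2) \<le> exp (\<tau> * norm z - (norm z)\<^sup>2 / 2)"
    using assms by (auto intro!: mult_right_mono)
  ultimately show "(exp (\<sigma> * norm z - (norm z)\<^sup>2 / 2) - exp (- \<sigma>\<^sup>2 / 2) * exp (- (norm z)\<^sup>2 / 2)) * W z
    \<le> (exp (\<tau> * norm z - (norm z)\<^sup>2 / 2) - exp (- \<tau>\<^sup>2 / 2) * exp (- (norm z)\<^sup>2 / 2)) * W z"
    by (intro mult_right_mono diff_mono) auto
qed (use mehta_pos in simp)

lemma eps_tendsto: "(eps \<longlongrightarrow> 0) (at_right 0)"
proof -
  let ?f = "\<lambda>\<sigma> z::'a. (exp (\<sigma> * norm z - (norm z)\<^sup>2 / 2) - exp (- \<sigma>\<^sup>2 / 2) * exp (- (norm z)\<^sup>2 / 2)) * W z"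
  have "((\<lambda>\<sigma>. LINT z|lborel. ?f \<sigma> z) \<longlongrightarrow> (LINT z|(lborel :: 'a measure). (0::real))) (at_right 0)"
  proof (rule tendsto_at_right_sequentially[of _ 1])
    fix S :: "nat \<Rightarrow> real"
    assume S: "\<And>n. 0 < S n" "\<And>n. S n < 1" "S \<longlonglongrightarrow> 0"
    show "(\<lambda>n. LINT z|lborel. ?f (S n) z) \<longlonglongrightarrow> (LINT z|(lborel :: 'a measure). (0::real))"
    proof (rule integral_dominated_convergence)
      \<comment> \<open>For parameters below 1 the first exponential is at most its value at 1, and
        the subtracted one is nonnegative.\<close>
      show "integrable lborel (\<lambda>z::'a. exp (1 * norm z - (norm z)\<^sup>2 / 2) * W z)"
        by (rule integrable_gauss)
      have "(\<lambda>n. ?f (S n) z) \<longlonglongrightarrow> ?f 0 z" for z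
        by (intro tendsto_intros S(3)) simp
      then show "AE z in lborel. (\<lambda>n. ?f (S n) z) \<longlonglongrightarrow> 0" by simp
      fix n
      have "norm (?f (S n) z) \<le> exp (1 * norm z - (norm z)\<^sup>2 / 2) * W z" for z
      proof -
        have "norm (?f (S n) z) = ?f (S n) z"
          using eps_integrand_nonneg[of "S n" z] S(1)[of n] by (simp add: less_imp_le)
        also have "\<dots> \<le> exp (1 * norm z - (norm z)\<^sup>2 / 2) * W z"
        proof (rule mult_right_mono)
          have "S n * norm z \<le> 1 * norm z"
            using S(2)[of n] by (intro mult_right_mono) auto
          then have "exp (S n * norm z - (norm z)\<^sup>2 / 2) \<le> exp (1 * norm z - (norm z)\<^sup>2 / 2)"
            by simp
          moreover have "0 \<le> exp (- (S n)\<^sup>2 / 2) * exp (- (norm z)\<^sup>2 / 2)"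
            by simp
          ultimately show "exp (S n * norm z - (norm z)\<^sup>2 / 2) - exp (- (S n)\<^sup>2 / 2) * exp (- (norm z)\<^sup>2 / 2)
            \<le> exp (1 * norm z - (norm z)\<^sup>2 / 2)"
            by linarith
        qed simp
        finally show ?thesis .
      qed
      then show "AE z in lborel. norm (?f (S n) z) \<le> exp (1 * norm z - (norm z)\<^sup>2 / 2) * W z"
        by simp
    qed measurable
  qed simp
  then have "((\<lambda>\<sigma>. (LINT z|lborel. ?f \<sigma> z) / mc) \<longlongrightarrow> 0 / mc) (at_right 0)"
    using mehta_pos by (intro tendsto_divide) auto
  then show ?thesis by (simp add: eps_def[abs_def])
qed

lemma err_total:
  assumes t: "0 < t" and \<rho>: "0 \<le> \<rho>"
  shows "(\<integral>\<^sup>+ y. ennreal (err t \<rho> y) \<partial>\<mu>) = ennreal (eps (\<rho> / sqrt (2 * t)))"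
proof -
  let ?s = "\<rho> / sqrt (2 * t)"
  let ?F = "\<lambda>z::'a. exp (?s * norm z - (norm z)\<^sup>2 / 2) - exp (- ?s\<^sup>2 / 2) * exp (- (norm z)\<^sup>2 / 2)"
  have F: "0 \<le> ?F z" for z by (rule eps_integrand_nonneg) (use t \<rho> in auto)
  have "err t \<rho> y = K t * ?F ((1 / sqrt (2 * t)) *\<^sub>R y)" for y
  proof -
    define z where "z = (1 / sqrt (2 * t)) *\<^sub>R y"
    have 1: "\<rho> * norm y / (2 * t) = ?s * norm z" "- (norm y)\<^sup>2 / (4 * t) = - (norm z)\<^sup>2 / 2"
      "- \<rho>\<^sup>2 / (4 * t) = - ?s\<^sup>2 / 2"
      using t by (simp_all add: z_def power_divide)
    have "err t \<rho> y = K t * ?F z"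
    proof -
      have "exp (u - v) = exp (- v) * exp u" for u v :: real
        by (simp add: mult_exp_exp)
      then show ?thesis
        unfolding err_def q_def 1 by (simp add: algebra_simps)
    qed
    then show ?thesis by (simp only: z_def)
  qed
  then have "(\<integral>\<^sup>+ y. ennreal (err t \<rho> y) \<partial>\<mu>) = (\<integral>\<^sup>+ z. ennreal (?F z / mc) \<partial>\<mu>)"
    using nn_integral_heat_scale[of ?F, OF _ F t] by simp
  also have "\<dots> = ennreal (eps ?s)"
    unfolding eps_def by (rule nn_integral_mu_eq[OF eps_integrable F]) measurable
  finally show ?thesis .
qed

end

text \<open>No sign is assumed for b: cutting it off at 0 only enlarges the right side. It will be a
  kernel value, or \<open>q - err\<close>.\<close>

lemma ennreal_le_plus:
  assumes "a \<le> b + c" "0 \<le> c"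
  shows "ennreal a \<le> ennreal b + ennreal c"
proof -
  have "ennreal a \<le> ennreal (max b 0 + c)"
    using assms by (intro ennreal_leI) auto
  also have "\<dots> = ennreal (max b 0) + ennreal c"
    using assms by (intro ennreal_plus) auto
  also have "ennreal (max b 0) = ennreal b"
    by (simp add: max_def ennreal_neg)
  finally show ?thesis .
qed

lemma ennreal_diff_le:
  assumes "ennreal a \<le> x + ennreal e" "0 \<le> e"
  shows "ennreal (a - e) \<le> x"
proof (cases x)
  case (real r)
  then have "ennreal a \<le> ennreal (r + e)" using assms by simp
  then have "a \<le> r + e" using ennreal_le_iff[of "r + e" a] real assms(2) by (simp del: ennreal_plus)
  then show ?thesis using real by (auto intro: ennreal_leI)
qed simp

section \<open>Heat flow between two sets at a fixed time\<close>

context dunkl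
begin

lemma mu_to_borel: "f \<in> measurable M \<mu> \<Longrightarrow> f \<in> measurable M borel"
proof -
  assume f: "f \<in> measurable M \<mu>"
  from measurable_compose[OF f borel_to_mu[of "\<lambda>x. x"]] show ?thesis by simp
qed

lemma ident_measurable [measurable]:
  "(\<lambda>x. x) \<in> borel_measurable \<mu>" "(\<lambda>x::'a. x) \<in> borel_measurable lebesgue"
  by (rule borel_to_mu, simp) (rule measurable_completion, simp)

lemma Ed_measurable [measurable (raw)]:
  assumes [measurable]: "f \<in> borel_measurable M" "g \<in> borel_measurable M"
  shows "(\<lambda>z. Ed (f z) (g z)) \<in> borel_measurable M"
proof -
  have "(\<lambda>z. (f z, g z)) \<in> measurable M borel"
    by (rule borel_measurable_Pair) fact+
  from measurable_compose[OF this borel_measurable_continuous_onI[OF continuous_Ed]]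
  show ?thesis by simp
qed

lemma p_measurable [measurable (raw)]:
  assumes [measurable]: "T \<in> borel_measurable M" "f \<in> borel_measurable M" "g \<in> borel_measurable M"
  shows "(\<lambda>z. p (T z) (f z) (g z)) \<in> borel_measurable M"
  unfolding p_eq K_def by measurable

lemma q_measurable' [measurable (raw)]:
  assumes [measurable]: "T \<in> borel_measurable M" "f \<in> borel_measurable M"
  shows "(\<lambda>z. q (T z) (f z)) \<in> borel_measurable M"
  unfolding q_def K_def by measurable

text \<open>On the ball the probability density \<open>q 1\<close> is at least the positive constant
  c, so the ball has measure at most 1/c.\<close>

lemma emeasure_mu_cball: "emeasure \<mu> (cball 0 \<rho>) < \<infinity>"
proof -
  define c where "c = K 1 * exp (- \<rho>\<^sup>2 / 4)"
  have c: "0 < c" using mehta_pos by (simp add: c_def K_def)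
  have "ennreal c * emeasure \<mu> (cball 0 \<rho>) = (\<integral>\<^sup>+ y. ennreal c * indicator (cball 0 \<rho>) y \<partial>\<mu>)"
    by (simp add: nn_integral_cmult_indicator)
  also have "\<dots> \<le> (\<integral>\<^sup>+ y. ennreal (q 1 y) \<partial>\<mu>)"
  proof (intro nn_integral_mono)
    fix y :: 'a
    have "c \<le> q 1 y" if "norm y \<le> \<rho>"
      using that K_nonneg[of 1] unfolding c_def q_def
      by (intro mult_left_mono) (auto intro!: power_mono)
    then show "ennreal c * indicator (cball 0 \<rho>) y \<le> ennreal (q 1 y)"
      by (auto simp: indicator_def intro: ennreal_leI)
  qed
  also have "\<dots> = 1" by (simp add: q_total)
  finally have le: "ennreal c * emeasure \<mu> (cball 0 \<rho>) \<le> 1" .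
  show ?thesis
  proof (rule ccontr)
    assume "\<not> ?thesis"
    then have "emeasure \<mu> (cball 0 \<rho>) = top" by (metis infinity_ennreal_def less_top)
    with le c show False by (auto simp: ennreal_mult_top top_unique)
  qed
qed

lemma sigma_finite_mu: "sigma_finite_measure \<mu>"
proof
  have "\<exists>n. norm x \<le> real n" for x :: 'a by (rule real_arch_simple)
  then have "(\<Union>n. cball (0::'a) (real n)) = UNIV" by auto
  then show "\<exists>A. countable A \<and> A \<subseteq> sets \<mu> \<and> \<Union> A = space \<mu> \<and> (\<forall>a\<in>A. emeasure \<mu> a \<noteq> \<infinity>)"
    using emeasure_mu_cball by (intro exI[of _ "range (\<lambda>n. cball 0 (real n))"]) (auto simp: less_top)
qed

interpretation mu: sigma_finite_measure \<mu>
  by (rule sigma_finite_mu)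

text \<open>The heat distribution at time t started from the origin, with which every bounded
  starting point is compared.\<close>

definition nu :: "real \<Rightarrow> 'a measure" where
  "nu t = density \<mu> (\<lambda>y. ennreal (q t y))"

lemma sets_nu [simp, measurable_cong]: "sets (nu t) = sets lebesgue"
  by (simp add: nu_def)

lemma space_nu [simp]: "space (nu t) = UNIV"
  by (simp add: nu_def)

lemma emeasure_nu:
  "S \<in> sets lebesgue \<Longrightarrow> emeasure (nu t) S = (\<integral>\<^sup>+ y. indicator S y * ennreal (q t y) \<partial>\<mu>)"
  unfolding nu_def by (subst emeasure_density) (auto simp: mult.commute)

lemma emeasure_nu_UNIV: "0 < t \<Longrightarrow> emeasure (nu t) UNIV = 1"
  using q_total by (simp add: emeasure_nu)

lemma finite_measure_nu: "0 < t \<Longrightarrow> finite_measure (nu t)"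
  by (rule finite_measureI) (simp add: emeasure_nu_UNIV)

lemma measure_nu_UNIV: "0 < t \<Longrightarrow> measure (nu t) UNIV = 1"
  by (simp add: measure_def emeasure_nu_UNIV)

lemma emeasure_nu_eq: "0 < t \<Longrightarrow> emeasure (nu t) S = ennreal (measure (nu t) S)"
  using finite_measure.emeasure_eq_measure[OF finite_measure_nu] .

lemma measure_nu_le_1: "0 < t \<Longrightarrow> measure (nu t) S \<le> 1"
  using finite_measure.bounded_measure[OF finite_measure_nu, of t S] by (simp add: measure_nu_UNIV)

lemma measure_nu_Compl:
  "0 < t \<Longrightarrow> S \<in> sets lebesgue \<Longrightarrow> measure (nu t) (- S) = 1 - measure (nu t) S"
  using finite_measure.finite_measure_compl[OF finite_measure_nu, of t S]
  by (simp add: measure_nu_UNIV Compl_eq_Diff_UNIV)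

lemma measure_nu_split:
  assumes t: "0 < t" and S: "S \<in> sets lebesgue" and T: "T \<in> sets lebesgue"
  shows "measure (nu t) S = measure (nu t) (S \<inter> - T) + measure (nu t) (S \<inter> T)"
proof -
  have "S = (S \<inter> - T) \<union> (S \<inter> T)" by blast
  moreover have "measure (nu t) ((S \<inter> - T) \<union> (S \<inter> T)) = measure (nu t) (S \<inter> - T) + measure (nu t) (S \<inter> T)"
    by (rule finite_measure.finite_measure_Union[OF finite_measure_nu[OF t]]) (use S T in auto)
  ultimately show ?thesis by simp
qed

text \<open>Since \<open>K t\<close> tends to 0, bounded sets lose all their mass. This is why
  removing an orbit ball, or the domain itself, does not affect the limits.\<close>

lemma measure_nu_le_K:
  assumes t: "0 < t" and S: "S \<in> sets lebesgue" "S \<subseteq> cball 0 \<rho>"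
  shows "measure (nu t) S \<le> K t * measure \<mu> (cball 0 \<rho>)"
proof -
  have "emeasure (nu t) S \<le> (\<integral>\<^sup>+ y. ennreal (K t) * indicator (cball 0 \<rho>) y \<partial>\<mu>)"
    unfolding emeasure_nu[OF S(1)] using S(2) q_le_K[OF t]
    by (intro nn_integral_mono) (auto simp: indicator_def intro: ennreal_leI)
  also have "\<dots> = ennreal (K t * measure \<mu> (cball 0 \<rho>))"
    using emeasure_mu_cball[of \<rho>] K_nonneg
    by (simp add: nn_integral_cmult_indicator ennreal_mult measure_def)
  finally show ?thesis
    using K_nonneg by (simp add: emeasure_nu_eq[OF t] ennreal_le_iff)
qed

lemma K_tendsto: "(K \<longlongrightarrow> 0) at_top"
proof -
  have "((\<lambda>t. (2 * t) powr (- hd_exp)) \<longlongrightarrow> 0) at_top"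
    using hd_exp_pos
    by (intro tendsto_neg_powr filterlim_tendsto_pos_mult_at_top[OF tendsto_const]) (auto intro: filterlim_ident)
  from tendsto_divide[OF this tendsto_const[of mc]] show ?thesis
    using mehta_pos by (simp add: K_def[abs_def])
qed

lemma eps_time_tendsto:
  assumes "0 < \<rho>"
  shows "((\<lambda>t. eps (\<rho> / sqrt (2 * t))) \<longlongrightarrow> 0) at_top"
proof (rule filterlim_compose[OF eps_tendsto])
  have "filterlim (\<lambda>t::real. sqrt (2 * t)) at_top at_top"
    by (intro filterlim_compose[OF sqrt_at_top] filterlim_tendsto_pos_mult_at_top[OF tendsto_const])
      (auto intro: filterlim_ident)
  then have "((\<lambda>t. \<rho> / sqrt (2 * t)) \<longlongrightarrow> 0) at_top"
    by (intro tendsto_divide_0[OF tendsto_const] filterlim_at_top_imp_at_infinity)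
  moreover have "eventually (\<lambda>t. \<rho> / sqrt (2 * t) \<in> {0<..}) at_top"
    using eventually_gt_at_top[of 0] by eventually_elim (use assms in simp)
  ultimately show "filterlim (\<lambda>t. \<rho> / sqrt (2 * t)) (at_right 0) at_top"
    unfolding filterlim_at by (auto elim: eventually_mono)
qed

abbreviation err_mass :: "real \<Rightarrow> real \<Rightarrow> real" where
  "err_mass \<rho> t \<equiv> eps (\<rho> / sqrt (2 * t))"

lemma err_mass_bound:
  assumes "1 \<le> t" "0 \<le> \<rho>"
  shows "0 \<le> err_mass \<rho> t" "err_mass \<rho> t \<le> eps \<rho>"
proof -
  have "1 \<le> sqrt (2 * t)" using assms by simp
  then have "\<rho> / sqrt (2 * t) \<le> \<rho> / 1"
    using assms by (intro divide_left_mono) auto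
  then show "0 \<le> err_mass \<rho> t" "err_mass \<rho> t \<le> eps \<rho>"
    using assms by (auto intro!: eps_nonneg eps_mono)
qed

abbreviation heat :: "real \<Rightarrow> 'a set \<Rightarrow> 'a \<Rightarrow> ennreal" where
  "heat \<equiv> heat_sg_ind Rp \<kappa>"

lemma heat_measurable [measurable (raw)]:
  assumes S [measurable]: "S \<in> sets lebesgue" and T [measurable]: "T \<in> borel_measurable M" "f \<in> borel_measurable M"
  shows "(\<lambda>z. heat (T z) S (f z)) \<in> borel_measurable M"
proof -
  have [measurable]: "snd \<in> measurable (M \<Otimes>\<^sub>M \<mu>) borel"
    by (rule mu_to_borel) measurable
  show ?thesis
    unfolding heat_sg_ind_def
    by (rule mu.borel_measurable_nn_integral) (simp add: split_beta', measurable)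
qed

lemma heat_bounds:
  assumes S [measurable]: "S \<in> sets lebesgue" and t: "0 < t" and x: "norm x \<le> \<rho>"
  shows "heat t S x \<le> ennreal (measure (nu t) S + err_mass \<rho> t)"
    and "ennreal (measure (nu t) S - err_mass \<rho> t) \<le> heat t S x"
proof -
  have \<rho>: "0 \<le> \<rho>" using x norm_ge_zero[of x] by linarith
  have e0: "0 \<le> err_mass \<rho> t" using t \<rho> by (intro eps_nonneg) auto
  have tot: "(\<integral>\<^sup>+ y. ennreal (err t \<rho> y) \<partial>\<mu>) = ennreal (err_mass \<rho> t)"
    by (rule err_total[OF t \<rho>])
  have le: "p t x y \<le> q t y + err t \<rho> y" "q t y \<le> p t x y + err t \<rho> y" for y
    using p_close(1)[OF t x, of y] by auto
  have "heat t S x \<le> (\<integral>\<^sup>+ y. indicator S y * ennreal (q t y) + ennreal (err t \<rho> y) \<partial>\<mu>)"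
    unfolding heat_sg_ind_def
    using le(1) err_nonneg[OF t \<rho>]
    by (intro nn_integral_mono) (auto simp: indicator_def ennreal_plus[symmetric] intro!: ennreal_leI simp del: ennreal_plus)
  also have "\<dots> = ennreal (measure (nu t) S + err_mass \<rho> t)"
    using e0 by (subst nn_integral_add) (auto simp: tot emeasure_nu_eq[OF t] simp flip: emeasure_nu)
  finally show "heat t S x \<le> ennreal (measure (nu t) S + err_mass \<rho> t)" .
  have "ennreal (measure (nu t) S) = (\<integral>\<^sup>+ y. indicator S y * ennreal (q t y) \<partial>\<mu>)"
    by (simp add: emeasure_nu_eq[OF t, symmetric] emeasure_nu)
  also have "\<dots> \<le> (\<integral>\<^sup>+ y. indicator S y * ennreal (p t x y) + ennreal (err t \<rho> y) \<partial>\<mu>)"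
  proof (intro nn_integral_mono)
    fix y
    have "ennreal (q t y) \<le> ennreal (p t x y) + ennreal (err t \<rho> y)"
      using le(2) err_nonneg[OF t \<rho>] by (rule ennreal_le_plus)
    then show "indicator S y * ennreal (q t y) \<le> indicator S y * ennreal (p t x y) + ennreal (err t \<rho> y)"
      by (auto simp: indicator_def)
  qed
  also have "\<dots> = heat t S x + ennreal (err_mass \<rho> t)"
    unfolding heat_sg_ind_def by (subst nn_integral_add) (auto simp: tot)
  finally show "ennreal (measure (nu t) S - err_mass \<rho> t) \<le> heat t S x"
    using e0 by (rule ennreal_diff_le)
qed

text \<open>Here the target is bounded and x is arbitrary, so the error stays a function of x, to be
  integrated over the starting set afterwards.\<close>

lemma heat_bounds':
  assumes B [measurable]: "B \<in> sets lebesgue" and t: "0 < t" and B\<rho>: "B \<subseteq> cball 0 \<rho>" and \<rho>: "0 \<le> \<rho>"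
  shows "heat t B x \<le> ennreal (measure \<mu> B) * ennreal (q t x + err t \<rho> x)"
    and "ennreal (measure \<mu> B) * ennreal (q t x - err t \<rho> x) \<le> heat t B x"
proof -
  have fin: "emeasure \<mu> B = ennreal (measure \<mu> B)"
    using emeasure_mono[OF B\<rho>, of \<mu>] emeasure_mu_cball[of \<rho>]
    by (intro emeasure_eq_ennreal_measure) auto
  have int: "(\<integral>\<^sup>+ y. c * indicator B y \<partial>\<mu>) = ennreal (measure \<mu> B) * c" for c
    using nn_integral_cmult_indicator[of B \<mu> c] fin by (simp add: mult.commute)
  have le: "p t x y \<le> q t x + err t \<rho> x" "q t x - err t \<rho> x \<le> p t x y" if "y \<in> B" for y
    using p_close(2)[OF t, of y \<rho> x] B\<rho> that by auto
  have "heat t B x \<le> (\<integral>\<^sup>+ y. ennreal (q t x + err t \<rho> x) * indicator B y \<partial>\<mu>)"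
    unfolding heat_sg_ind_def using le(1)
    by (intro nn_integral_mono) (auto simp: indicator_def intro: ennreal_leI)
  then show "heat t B x \<le> ennreal (measure \<mu> B) * ennreal (q t x + err t \<rho> x)"
    by (simp only: int)
  have "(\<integral>\<^sup>+ y. ennreal (q t x - err t \<rho> x) * indicator B y \<partial>\<mu>) \<le> heat t B x"
    unfolding heat_sg_ind_def using le(2)
    by (intro nn_integral_mono) (auto simp: indicator_def intro: ennreal_leI)
  then show "ennreal (measure \<mu> B) * ennreal (q t x - err t \<rho> x) \<le> heat t B x"
    by (simp only: int)
qed

definition flow :: "'a set \<Rightarrow> 'a set \<Rightarrow> real \<Rightarrow> ennreal" where
  "flow A B t = (\<integral>\<^sup>+ x\<in>A. heat t B x \<partial>\<mu>)"

lemma flow_measurable [measurable]: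
  assumes [measurable]: "A \<in> sets lebesgue" "B \<in> sets lebesgue"
  shows "flow A B \<in> borel_measurable borel"
proof -
  have [measurable]: "snd \<in> measurable (borel \<Otimes>\<^sub>M \<mu>) borel"
    by (rule mu_to_borel) measurable
  show ?thesis
    unfolding flow_def[abs_def]
    by (rule mu.borel_measurable_nn_integral) (simp add: split_beta', measurable)
qed

lemma measure_nu_measurable [measurable]:
  assumes [measurable]: "S \<in> sets lebesgue"
  shows "(\<lambda>t. measure (nu t) S) \<in> borel_measurable borel"
proof -
  have [measurable]: "snd \<in> measurable (borel \<Otimes>\<^sub>M \<mu>) borel"
    by (rule mu_to_borel) measurable
  have "(\<lambda>t. \<integral>\<^sup>+ y. indicator S y * ennreal (q t y) \<partial>\<mu>) \<in> borel_measurable borel"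
    by (rule mu.borel_measurable_nn_integral) (simp add: split_beta', measurable)
  then show ?thesis
    by (simp add: measure_def emeasure_nu)
qed

lemma flow_bounds_left:
  assumes A [measurable]: "A \<in> sets lebesgue" and S [measurable]: "S \<in> sets lebesgue"
    and A\<rho>: "A \<subseteq> cball 0 \<rho>" and t: "0 < t"
  shows "flow A S t \<le> ennreal (measure \<mu> A * (measure (nu t) S + err_mass \<rho> t))"
    and "ennreal (measure \<mu> A * (measure (nu t) S - err_mass \<rho> t)) \<le> flow A S t"
proof -
  have fin: "emeasure \<mu> A = ennreal (measure \<mu> A)"
    using emeasure_mono[OF A\<rho>, of \<mu>] emeasure_mu_cball[of \<rho>]
    by (intro emeasure_eq_ennreal_measure) auto
  have int: "(\<integral>\<^sup>+ y. c * indicator A y \<partial>\<mu>) = ennreal (measure \<mu> A) * c" for c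
    using nn_integral_cmult_indicator[of A \<mu> c] fin by (simp add: mult.commute)
  have "flow A S t \<le> (\<integral>\<^sup>+ x. ennreal (measure (nu t) S + err_mass \<rho> t) * indicator A x \<partial>\<mu>)"
    unfolding flow_def using heat_bounds(1)[OF S t] A\<rho>
    by (intro nn_integral_mono) (auto simp: indicator_def)
  also have "\<dots> = ennreal (measure \<mu> A * (measure (nu t) S + err_mass \<rho> t))"
    by (simp add: int ennreal_mult')
  finally show "flow A S t \<le> ennreal (measure \<mu> A * (measure (nu t) S + err_mass \<rho> t))" .
  have "ennreal (measure \<mu> A * (measure (nu t) S - err_mass \<rho> t))
    = (\<integral>\<^sup>+ x. ennreal (measure (nu t) S - err_mass \<rho> t) * indicator A x \<partial>\<mu>)"
    by (simp add: int ennreal_mult')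
  also have "\<dots> \<le> flow A S t"
    unfolding flow_def using heat_bounds(2)[OF S t] A\<rho>
    by (intro nn_integral_mono) (auto simp: indicator_def)
  finally show "ennreal (measure \<mu> A * (measure (nu t) S - err_mass \<rho> t)) \<le> flow A S t" .
qed

text \<open>S may have infinite measure, which rules out an error uniform in x. Integrating the
  pointwise bound over S instead turns q into \<open>nu t\<close> and \<open>err\<close> into its
  finite total mass.\<close>

lemma flow_bounds_right:
  assumes B [measurable]: "B \<in> sets lebesgue" and S [measurable]: "S \<in> sets lebesgue"
    and B\<rho>: "B \<subseteq> cball 0 \<rho>" and \<rho>: "0 \<le> \<rho>" and t: "0 < t"
  shows "flow S B t \<le> ennreal (measure \<mu> B * (measure (nu t) S + err_mass \<rho> t))"
    and "ennreal (measure \<mu> B * (measure (nu t) S - err_mass \<rho> t)) \<le> flow S B t"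
proof -
  have e0: "0 \<le> err_mass \<rho> t" using t \<rho> by (intro eps_nonneg) auto
  have tot: "(\<integral>\<^sup>+ y. ennreal (err t \<rho> y) \<partial>\<mu>) = ennreal (err_mass \<rho> t)"
    by (rule err_total[OF t \<rho>])
  have nuS: "(\<integral>\<^sup>+ y. indicator S y * ennreal (q t y) \<partial>\<mu>) = ennreal (measure (nu t) S)"
    by (simp add: emeasure_nu_eq[OF t, symmetric] emeasure_nu)
  have "flow S B t \<le> (\<integral>\<^sup>+ x. ennreal (measure \<mu> B) * (indicator S x * ennreal (q t x) + ennreal (err t \<rho> x)) \<partial>\<mu>)"
    unfolding flow_def
  proof (intro nn_integral_mono)
    fix x
    have "heat t B x \<le> ennreal (measure \<mu> B) * (ennreal (q t x) + ennreal (err t \<rho> x))"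
      using heat_bounds'(1)[OF B t B\<rho> \<rho>, of x] err_nonneg[OF t \<rho>] by simp
    then show "heat t B x * indicator S x
      \<le> ennreal (measure \<mu> B) * (indicator S x * ennreal (q t x) + ennreal (err t \<rho> x))"
      by (auto simp: indicator_def)
  qed
  also have "\<dots> = ennreal (measure \<mu> B) * (ennreal (measure (nu t) S) + ennreal (err_mass \<rho> t))"
    by (simp add: nn_integral_cmult nn_integral_add tot nuS)
  also have "\<dots> = ennreal (measure \<mu> B * (measure (nu t) S + err_mass \<rho> t))"
    using e0 by (simp add: ennreal_mult)
  finally show "flow S B t \<le> ennreal (measure \<mu> B * (measure (nu t) S + err_mass \<rho> t))" .
  have "ennreal (measure (nu t) S) \<le> (\<integral>\<^sup>+ x. indicator S x * ennreal (q t x - err t \<rho> x) + ennreal (err t \<rho> x) \<partial>\<mu>)"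
    unfolding nuS[symmetric]
  proof (intro nn_integral_mono)
    fix x
    have "ennreal (q t x) \<le> ennreal (q t x - err t \<rho> x) + ennreal (err t \<rho> x)"
      using err_nonneg[OF t \<rho>] by (intro ennreal_le_plus) auto
    then show "indicator S x * ennreal (q t x) \<le> indicator S x * ennreal (q t x - err t \<rho> x) + ennreal (err t \<rho> x)"
      by (auto simp: indicator_def)
  qed
  also have "\<dots> = (\<integral>\<^sup>+ x. indicator S x * ennreal (q t x - err t \<rho> x) \<partial>\<mu>) + ennreal (err_mass \<rho> t)"
    by (subst nn_integral_add) (auto simp: tot)
  finally have "ennreal (measure (nu t) S - err_mass \<rho> t) \<le> (\<integral>\<^sup>+ x. indicator S x * ennreal (q t x - err t \<rho> x) \<partial>\<mu>)"
    using e0 by (rule ennreal_diff_le)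
  then have "ennreal (measure \<mu> B * (measure (nu t) S - err_mass \<rho> t))
    \<le> ennreal (measure \<mu> B) * (\<integral>\<^sup>+ x. indicator S x * ennreal (q t x - err t \<rho> x) \<partial>\<mu>)"
    by (simp add: ennreal_mult' mult_left_mono)
  also have "\<dots> = (\<integral>\<^sup>+ x. ennreal (measure \<mu> B) * (indicator S x * ennreal (q t x - err t \<rho> x)) \<partial>\<mu>)"
    by (rule nn_integral_cmult[symmetric]) measurable
  also have "\<dots> \<le> flow S B t"
    unfolding flow_def using heat_bounds'(2)[OF B t B\<rho> \<rho>]
    by (intro nn_integral_mono) (auto simp: indicator_def)
  finally show "ennreal (measure \<mu> B * (measure (nu t) S - err_mass \<rho> t)) \<le> flow S B t" .
qed

end

section \<open>Averages over large times\<close>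

definition pareto :: "real \<Rightarrow> real measure" where
  "pareto s = density lborel (\<lambda>t. ennreal (s * t powr (- (1 + s))) * indicator {1..} t)"

lemma sets_pareto [simp, measurable_cong]: "sets (pareto s) = sets borel"
  by (simp add: pareto_def)

lemma space_pareto [simp]: "space (pareto s) = UNIV"
  by (simp add: pareto_def)

lemma pareto_deriv:
  assumes "0 < t"
  shows "((\<lambda>t. - (t powr - s)) has_real_derivative s * t powr (- (1 + s))) (at t)"
proof -
  have e: "- s - 1 = - (1 + s)" by simp
  show ?thesis
    using assms by (auto intro!: derivative_eq_intros simp: e)
qed

lemma emeasure_pareto_UNIV:
  assumes s: "0 < s"
  shows "emeasure (pareto s) UNIV = 1"
proof -
  have "((\<lambda>t::real. t powr - s) \<longlongrightarrow> 0) at_top"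
    using s by (intro tendsto_neg_powr filterlim_ident) simp
  then have "((\<lambda>t::real. - (t powr - s)) \<longlongrightarrow> - 0) at_top"
    by (rule tendsto_minus)
  then have "(\<integral>\<^sup>+ t. ennreal (s * t powr (- (1 + s))) * indicator {1..} t \<partial>lborel) = ennreal (0 - - (1 powr - s))"
    using s by (intro nn_integral_FTC_atLeast pareto_deriv) auto
  then show ?thesis
    by (simp add: pareto_def emeasure_density)
qed

lemma finite_measure_pareto: "0 < s \<Longrightarrow> finite_measure (pareto s)"
  by (rule finite_measureI) (simp add: emeasure_pareto_UNIV)

lemma measure_pareto_UNIV [simp]: "0 < s \<Longrightarrow> measure (pareto s) UNIV = 1"
  by (simp add: measure_def emeasure_pareto_UNIV)

lemma pareto_Icc:
  assumes s: "0 < s" and T: "1 \<le> T"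
  shows "measure (pareto s) {..T} = 1 - T powr - s"
proof -
  have "emeasure (pareto s) {..T} = (\<integral>\<^sup>+ t. ennreal (s * t powr (- (1 + s))) * indicator {1..T} t \<partial>lborel)"
    unfolding pareto_def
    by (subst emeasure_density) (auto intro!: nn_integral_cong simp: indicator_def)
  also have "\<dots> = ennreal (- (T powr - s) - - (1 powr - s))"
    using s T by (intro nn_integral_FTC_Icc has_field_derivative_at_within[OF pareto_deriv]) auto
  finally show ?thesis
    using T s by (simp add: measure_def ge_one_powr_ge_zero powr_minus inverse_le_1_iff)
qed

lemma pareto_mass_tendsto:
  assumes T: "1 \<le> T"
  shows "((\<lambda>s. measure (pareto s) {..T}) \<longlongrightarrow> 0) (at_right 0)"
proof -
  have "((\<lambda>s. 1 - T powr - s) \<longlongrightarrow> 1 - T powr - 0) (at_right 0)"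
    using T by (intro tendsto_intros) auto
  then have "((\<lambda>s. 1 - T powr - s) \<longlongrightarrow> 0) (at_right 0)"
    using T by simp
  moreover have "eventually (\<lambda>s. 1 - T powr - s = measure (pareto s) {..T}) (at_right 0)"
    using eventually_at_right_less[of "0::real"]
    by eventually_elim (simp add: pareto_Icc T)
  ultimately show ?thesis by (rule Lim_transform_eventually)
qed

lemma AE_pareto: "AE t in pareto s. 1 \<le> t"
  unfolding pareto_def by (subst AE_density) (auto simp: indicator_def)

lemma integrable_pareto:
  assumes "0 < s" and [measurable]: "u \<in> borel_measurable borel" and "\<And>t. 1 \<le> t \<Longrightarrow> \<bar>u t\<bar> \<le> M"
  shows "integrable (pareto s) (u :: real \<Rightarrow> real)"
proof -
  interpret finite_measure "pareto s" using assms(1) by (rule finite_measure_pareto)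
  show ?thesis
    by (rule integrable_const_bound[of _ M])
      (use AE_pareto[of s] assms(3) in \<open>auto elim: eventually_mono\<close>)
qed

text \<open>As \<open>s\<close> tends to \<open>0\<close> the mass of \<open>pareto s\<close> escapes to infinity.\<close>

lemma pareto_vanish:
  assumes [measurable]: "u \<in> borel_measurable borel" and M: "\<And>t. 1 \<le> t \<Longrightarrow> \<bar>u t\<bar> \<le> M"
    and u: "(u \<longlongrightarrow> (0::real)) at_top"
  shows "((\<lambda>s. LINT t|pareto s. u t) \<longlongrightarrow> 0) (at_right 0)"
proof (rule tendstoI)
  fix e :: real assume e: "0 < e"
  have M0: "0 \<le> M" using M[of 1] by simp
  have "eventually (\<lambda>t. \<bar>u t\<bar> < e / 2) at_top"
    using tendstoD[OF u, of "e / 2"] e by simp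
  then obtain T0 where T0: "\<And>t. T0 \<le> t \<Longrightarrow> \<bar>u t\<bar> < e / 2"
    by (auto simp: eventually_at_top_linorder)
  define T where "T = max T0 1"
  have T1: "1 \<le> T" by (simp add: T_def)
  have "((\<lambda>s. M * measure (pareto s) {..T}) \<longlongrightarrow> M * 0) (at_right 0)"
    by (intro tendsto_mult tendsto_const pareto_mass_tendsto T1)
  then have "eventually (\<lambda>s. M * measure (pareto s) {..T} < e / 2) (at_right 0)"
    using e by (intro order_tendstoD(2)[of _ 0]) auto
  then show "eventually (\<lambda>s. dist (LINT t|pareto s. u t) 0 < e) (at_right 0)"
    using eventually_at_right_less[of "0::real"]
  proof eventually_elim
    case (elim s)
    interpret finite_measure "pareto s" using elim(2) by (rule finite_measure_pareto)
    have i: "integrable (pareto s) u" using elim(2) assms(1) M by (rule integrable_pareto)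
    have "\<bar>LINT t|pareto s. u t\<bar> \<le> (LINT t|pareto s. \<bar>u t\<bar>)"
      using integral_abs_bound by blast
    also have "\<dots> \<le> (LINT t|pareto s. M * indicator {..T} t + e / 2)"
    proof (rule integral_mono_AE)
      show "integrable (pareto s) (\<lambda>t. \<bar>u t\<bar>)" using i by simp
      show "integrable (pareto s) (\<lambda>t. M * indicator {..T} t + e / 2)"
        by (intro Bochner_Integration.integrable_add integrable_mult_right integrable_real_indicator)
          (auto simp: less_top[symmetric])
      show "AE t in pareto s. \<bar>u t\<bar> \<le> M * indicator {..T} t + e / 2"
        using AE_pareto[of s]
      proof eventually_elim
        case (elim t)
        then show ?case
          using M[of t] T0[of t] e by (auto simp: indicator_def T_def intro: less_imp_le)
      qed
    qed
    also have "\<dots> = M * measure (pareto s) {..T} + e / 2"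
      by (subst Bochner_Integration.integral_add)
        (use elim(2) in \<open>auto simp: less_top[symmetric] intro!: integrable_mult_right integrable_real_indicator\<close>)
    also have "\<dots> < e" using elim(1) by simp
    finally show ?case by simp
  qed
qed

text \<open>The passage from extended nonnegative to real integrals, in which differences make
  sense. Times below 1, where a might be infinite, are not charged by
  \<open>pareto s\<close>.\<close>

lemma nn_integral_pareto:
  assumes s: "0 < s" and a [measurable]: "a \<in> borel_measurable borel"
    and M: "\<And>t. 1 \<le> t \<Longrightarrow> a t \<le> ennreal M"
  shows "ennreal s * (\<integral>\<^sup>+ t\<in>{1..}. ennreal (t powr (- (1 + s))) * a t \<partial>lborel)
    = ennreal (LINT t|pareto s. enn2real (a t))"
proof -
  have "ennreal s * (\<integral>\<^sup>+ t\<in>{1..}. ennreal (t powr (- (1 + s))) * a t \<partial>lborel)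
    = (\<integral>\<^sup>+ t. (ennreal (s * t powr (- (1 + s))) * indicator {1..} t) * a t \<partial>lborel)"
    using s by (subst nn_integral_cmult[symmetric]) (auto simp: ennreal_mult mult_ac)
  also have "\<dots> = (\<integral>\<^sup>+ t. a t \<partial>pareto s)"
    unfolding pareto_def by (rule nn_integral_density[symmetric]) auto
  also have "\<dots> = (\<integral>\<^sup>+ t. ennreal (enn2real (a t)) \<partial>pareto s)"
  proof (intro nn_integral_cong_AE eventually_mono[OF AE_pareto])
    fix t :: real assume "1 \<le> t"
    then have "a t < top" using M[of t] by (auto intro: le_less_trans)
    then show "a t = ennreal (enn2real (a t))" by simp
  qed
  also have "\<dots> = ennreal (LINT t|pareto s. enn2real (a t))"
  proof (intro nn_integral_eq_integral integrable_pareto[where M = "max M 0"] s)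
    fix t :: real assume "1 \<le> t"
    then have "a t \<le> ennreal (max M 0)" using M[of t] ennreal_leI[of M "max M 0"]
      by (auto intro: order_trans)
    then show "\<bar>enn2real (a t)\<bar> \<le> max M 0"
      by (simp add: enn2real_leI)
  qed auto
  finally show ?thesis .
qed

text \<open>For t < 1 the weight \<open>t powr (- (1 + s))\<close> increases with s, so the
  short-time integral is at most the finite one at \<open>s0\<close>, and the factor s sends it to
  0.\<close>

lemma time_average:
  assumes s0: "0 < s0" and a [measurable]: "a \<in> borel_measurable borel"
    and M: "\<And>t. 1 \<le> t \<Longrightarrow> a t \<le> ennreal M"
    and fin: "(\<integral>\<^sup>+ t\<in>{0<..}. ennreal (t powr (- (1 + s0))) * a t \<partial>lborel) < \<infinity>"
  defines "L \<equiv> \<lambda>s. ennreal s * (\<integral>\<^sup>+ t\<in>{0<..}. ennreal (t powr (- (1 + s))) * a t \<partial>lborel)"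
  shows "\<And>s. 0 < s \<Longrightarrow> s \<le> s0 \<Longrightarrow> L s < \<infinity>"
    and "((\<lambda>s. enn2real (L s) - (LINT t|pareto s. enn2real (a t))) \<longlongrightarrow> 0) (at_right 0)"
proof -
  define b where "b s = (\<integral>\<^sup>+ t\<in>{0<..<1}. ennreal (t powr (- (1 + s))) * a t \<partial>lborel)" for s
  have b: "b s \<le> b s0" if "s \<le> s0" for s
    unfolding b_def
  proof (intro nn_integral_mono)
    fix t :: real
    have "t powr (- (1 + s)) \<le> t powr (- (1 + s0))" if "0 < t" "t < 1"
      using that \<open>s \<le> s0\<close> by (intro powr_mono') auto
    then show "ennreal (t powr (- (1 + s))) * a t * indicator {0<..<1} t
      \<le> ennreal (t powr (- (1 + s0))) * a t * indicator {0<..<1} t"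
      by (auto simp: indicator_def intro!: mult_right_mono)
  qed
  have b0: "b s0 < \<infinity>"
  proof -
    have "b s0 \<le> (\<integral>\<^sup>+ t\<in>{0<..}. ennreal (t powr (- (1 + s0))) * a t \<partial>lborel)"
      unfolding b_def by (intro nn_integral_mono) (auto simp: indicator_def)
    with fin show ?thesis by (auto intro: le_less_trans)
  qed
  have split: "L s = ennreal s * b s + ennreal (LINT t|pareto s. enn2real (a t))" if s: "0 < s" for s
  proof -
    have "(\<integral>\<^sup>+ t\<in>{0<..}. ennreal (t powr (- (1 + s))) * a t \<partial>lborel)
      = (\<integral>\<^sup>+ t. ennreal (t powr (- (1 + s))) * a t * indicator {0<..<1} t
          + ennreal (t powr (- (1 + s))) * a t * indicator {1..} t \<partial>lborel)"
      by (intro nn_integral_cong) (auto simp: indicator_def)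
    also have "\<dots> = b s + (\<integral>\<^sup>+ t\<in>{1..}. ennreal (t powr (- (1 + s))) * a t \<partial>lborel)"
      unfolding b_def by (rule nn_integral_add) auto
    finally show ?thesis
      unfolding L_def using nn_integral_pareto[OF s a M] by (simp add: distrib_left)
  qed
  have bfin: "ennreal s * b s \<le> ennreal (s * enn2real (b s0))" if "0 < s" "s \<le> s0" for s
  proof -
    have "ennreal s * b s \<le> ennreal s * ennreal (enn2real (b s0))"
      using b[OF that(2)] b0 by (intro mult_left_mono) auto
    then show ?thesis using that by (simp add: ennreal_mult)
  qed
  show fin': "L s < \<infinity>" if "0 < s" "s \<le> s0" for s
    unfolding split[OF that(1)] using bfin[OF that] by (auto intro: le_less_trans)
  show "((\<lambda>s. enn2real (L s) - (LINT t|pareto s. enn2real (a t))) \<longlongrightarrow> 0) (at_right 0)"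
  proof (rule tendsto_sandwich[where f = "\<lambda>_. 0" and h = "\<lambda>s. s * enn2real (b s0)"])
    have "((\<lambda>s. s * enn2real (b s0)) \<longlongrightarrow> 0 * enn2real (b s0)) (at_right 0)"
      by (intro tendsto_intros)
    then show "((\<lambda>s. s * enn2real (b s0)) \<longlongrightarrow> 0) (at_right 0)" by simp
    show "((\<lambda>s. 0) \<longlongrightarrow> (0::real)) (at_right (0::real))" by simp
    have ev: "eventually (\<lambda>s. s \<in> {0<..<s0}) (at_right 0)"
      using s0 by (rule eventually_at_right_real)
    have eq: "enn2real (L s) - (LINT t|pareto s. enn2real (a t)) = enn2real (ennreal s * b s)"
      if "s \<in> {0<..<s0}" for s
    proof -
      have "0 \<le> (LINT t|pareto s. enn2real (a t))" by (intro integral_nonneg_AE) auto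
      moreover have "ennreal s * b s < top"
        using bfin[of s] that by (auto intro: le_less_trans)
      ultimately show ?thesis
        using that by (simp add: split enn2real_plus)
    qed
    show "eventually (\<lambda>s. 0 \<le> enn2real (L s) - (LINT t|pareto s. enn2real (a t))) (at_right 0)"
      using ev by eventually_elim (simp only: eq enn2real_nonneg)
    show "eventually (\<lambda>s. enn2real (L s) - (LINT t|pareto s. enn2real (a t)) \<le> s * enn2real (b s0)) (at_right 0)"
      using ev
    proof eventually_elim
      case (elim s)
      then show ?case
        unfolding eq[OF elim] using bfin[of s] by (intro enn2real_leI) auto
    qed
  qed
qed

section \<open>Asymptotics of the perimeter\<close>

lemma enn2real_close:
  assumes a: "a \<le> ennreal (m * (u + e))" "ennreal (m * (u - e)) \<le> a"
    and pos: "0 \<le> m" "0 \<le> u" "0 \<le> e"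
  shows "\<bar>enn2real a - m * u\<bar> \<le> m * e"
proof -
  have "enn2real a \<le> m * (u + e)"
    using a(1) pos by (intro enn2real_leI) auto
  moreover have "m * (u - e) \<le> enn2real a"
  proof -
    have "enn2real (ennreal (m * (u - e))) \<le> enn2real a"
      using a by (intro enn2real_mono) (auto intro: le_less_trans)
    then show ?thesis
      by (cases "0 \<le> m * (u - e)") (auto intro: order_trans[OF _ enn2real_nonneg])
  qed
  ultimately show ?thesis by (simp add: abs_le_iff algebra_simps)
qed

text \<open>The limits in the theorem are real numbers embedded by \<open>ennreal\<close>, which
  sends every negative number to 0; hence the maximum.\<close>

lemma tendsto_ennreal_max_iff:
  assumes f: "eventually (\<lambda>s. f s = ennreal (P s)) F" and P: "\<And>s. 0 \<le> P s"
  shows "(f \<longlongrightarrow> ennreal L) F \<longleftrightarrow> (P \<longlongrightarrow> max L 0) F"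
proof -
  have "ennreal L = ennreal (max L 0)" by (simp add: max_def ennreal_neg)
  then show ?thesis
    using tendsto_cong[OF f, of "ennreal L"] tendsto_ennreal_iff[of P F "max L 0"] P by simp
qed

context dunkl
begin

definition H :: "'a set \<Rightarrow> real \<Rightarrow> real" where
  "H E s = (LINT t|pareto s. measure (nu t) E)"

lemma L_kappa_eq:
  "L_kappa Rp \<kappa> s A B = (\<integral>\<^sup>+ t\<in>{0<..}. ennreal (t powr (- (1 + s))) * flow A B t \<partial>lborel)"
  by (simp add: L_kappa_def flow_def)

lemma K_antimono: "1 \<le> t \<Longrightarrow> K t \<le> K 1"
  unfolding K_def using mehta_pos hd_exp_pos by (intro divide_right_mono powr_mono2') auto

lemma orbit_dist_less: "orbit_dist R x y < r \<longleftrightarrow> (\<exists>g\<in>G. dist x (g y) < r)"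
  unfolding orbit_dist_def
  by (subst cINF_less_iff) (use id_in_G in \<open>auto intro!: bdd_belowI[of _ 0]\<close>)

lemma orbit_ball_eq: "orbit_ball R x r = (\<Union>g\<in>G. g -` ball x r)"
  by (auto simp: orbit_ball_def orbit_dist_less)

lemma orbit_ball_sets: "orbit_ball R x r \<in> sets lebesgue"
proof -
  have "open (orbit_ball R x r)"
    unfolding orbit_ball_eq
    by (intro open_UN ballI continuous_open_vimage linear_continuous_at bounded_linear_G) auto
  then show ?thesis by simp
qed

lemma orbit_ball_subset: "orbit_ball R x r \<subseteq> cball 0 (norm x + r)"
proof
  fix y assume "y \<in> orbit_ball R x r"
  then obtain g where g: "g \<in> G" "dist x (g y) < r" by (auto simp: orbit_ball_eq)
  have "norm (g y) \<le> norm x + dist x (g y)"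
    by (metis dist_norm norm_triangle_sub norm_minus_commute)
  then show "y \<in> cball 0 (norm x + r)" using g by simp
qed

text \<open>Moving the starting point to the origin costs \<open>err_mass\<close>, and restoring the
  orbit ball costs \<open>K t\<close> times the measure of a ball. Both vanish for large t, so x and
  r leave no trace in the limit.\<close>

lemma Lambda_asymp:
  fixes x :: 'a and r :: real
  assumes E [measurable]: "E \<in> sets lebesgue" and r: "0 < r"
  defines "\<Lambda> \<equiv> \<lambda>s. enn2real (ennreal s * Lambda_kappa R Rp \<kappa> E x r s)"
  shows "\<And>s. 0 < s \<Longrightarrow> ennreal s * Lambda_kappa R Rp \<kappa> E x r s = ennreal (\<Lambda> s)"
    and "((\<lambda>s. \<Lambda> s - H E s) \<longlongrightarrow> 0) (at_right 0)"
proof -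
  \<comment> \<open>One radius for both purposes: the ball contains x and, as the group preserves
    norms, the whole orbit ball.\<close>
  define \<rho> where "\<rho> = norm x + r"
  have \<rho>: "0 < \<rho>" "norm x \<le> \<rho>" using r by (auto simp: \<rho>_def add_nonneg_pos)
  define S where "S = E \<inter> - orbit_ball R x r"
  have Bm [measurable]: "orbit_ball R x r \<in> sets lebesgue" by (rule orbit_ball_sets)
  have S [measurable]: "S \<in> sets lebesgue" by (simp add: S_def)
  have x: "(\<lambda>_. x) \<in> borel_measurable borel" by simp
  have hm [measurable]: "(\<lambda>t. heat t S x) \<in> borel_measurable borel"
    by (rule heat_measurable[OF S _ x]) simp
  have close: "\<bar>enn2real (heat t S x) - measure (nu t) S\<bar> \<le> err_mass \<rho> t" if "1 \<le> t" for t
    using enn2real_close[of "heat t S x" 1 "measure (nu t) S" "err_mass \<rho> t"]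
      heat_bounds[OF S _ \<rho>(2), of t] err_mass_bound[OF that, of \<rho>] that \<rho> by simp
  have bd: "heat t S x \<le> ennreal (1 + eps \<rho>)" if "1 \<le> t" for t
  proof -
    have "measure (nu t) S + err_mass \<rho> t \<le> 1 + eps \<rho>"
      using measure_nu_le_1[of t S] err_mass_bound[OF that, of \<rho>] that \<rho> by simp
    then show ?thesis
      using heat_bounds(1)[OF S _ \<rho>(2), of t] that by (auto intro: order_trans ennreal_leI)
  qed
  have eq: "ennreal s * Lambda_kappa R Rp \<kappa> E x r s = ennreal (LINT t|pareto s. enn2real (heat t S x))"
    if "0 < s" for s
    using nn_integral_pareto[OF that hm bd]
    by (simp add: Lambda_kappa_def S_def mult.commute mult.left_commute)
  have L: "\<Lambda> s = (LINT t|pareto s. enn2real (heat t S x))" if "0 < s" for s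
    unfolding \<Lambda>_def eq[OF that] by (intro enn2real_ennreal integral_nonneg_AE) auto
  show "ennreal s * Lambda_kappa R Rp \<kappa> E x r s = ennreal (\<Lambda> s)" if "0 < s" for s
    using eq[OF that] L[OF that] by simp
  define u where "u t = enn2real (heat t S x) - measure (nu t) E" for t
  have um [measurable]: "u \<in> borel_measurable borel"
    unfolding u_def[abs_def] by measurable
  have u_le: "\<bar>u t\<bar> \<le> err_mass \<rho> t + K t * measure \<mu> (cball 0 \<rho>)" if "1 \<le> t" for t
  proof -
    have t: "0 < t" using that by simp
    have "measure (nu t) E = measure (nu t) S + measure (nu t) (E \<inter> orbit_ball R x r)"
      unfolding S_def by (rule measure_nu_split[OF t E Bm])
    moreover have "measure (nu t) (E \<inter> orbit_ball R x r) \<le> K t * measure \<mu> (cball 0 \<rho>)"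
      using orbit_ball_subset[of x r] by (intro measure_nu_le_K[OF t]) (auto simp: \<rho>_def)
    moreover have "0 \<le> measure (nu t) (E \<inter> orbit_ball R x r)" by simp
    ultimately show ?thesis using close[OF that] unfolding u_def by linarith
  qed
  have "((\<lambda>s. LINT t|pareto s. u t) \<longlongrightarrow> 0) (at_right 0)"
  proof (rule pareto_vanish[OF um])
    fix t :: real assume t: "1 \<le> t"
    have "K t * measure \<mu> (cball 0 \<rho>) \<le> K 1 * measure \<mu> (cball 0 \<rho>)"
      by (intro mult_right_mono K_antimono t) simp
    then show "\<bar>u t\<bar> \<le> eps \<rho> + K 1 * measure \<mu> (cball 0 \<rho>)"
      using u_le[OF t] err_mass_bound[OF t, of \<rho>] \<rho> by linarith
  next
    have "((\<lambda>t. err_mass \<rho> t + K t * measure \<mu> (cball 0 \<rho>)) \<longlongrightarrow> 0 + 0 * measure \<mu> (cball 0 \<rho>)) at_top"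
      by (intro tendsto_intros eps_time_tendsto K_tendsto \<rho>)
    then have "((\<lambda>t. err_mass \<rho> t + K t * measure \<mu> (cball 0 \<rho>)) \<longlongrightarrow> 0) at_top" by simp
    then show "(u \<longlongrightarrow> 0) at_top"
      by (rule Lim_null_comparison[rotated])
        (use u_le in \<open>auto intro: eventually_mono[OF eventually_ge_at_top[of 1]]\<close>)
  qed
  moreover have "eventually (\<lambda>s. (LINT t|pareto s. u t) = \<Lambda> s - H E s) (at_right 0)"
    using eventually_at_right_less[of "0::real"]
  proof eventually_elim
    case (elim s)
    have "integrable (pareto s) (\<lambda>t. enn2real (heat t S x))"
    proof (rule integrable_pareto[OF elim, of _ "1 + eps \<rho>"])
      show "\<bar>enn2real (heat t S x)\<bar> \<le> 1 + eps \<rho>" if "1 \<le> t" for t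
        using bd[OF that] eps_nonneg[of \<rho>] \<rho> by (auto intro: enn2real_leI)
    qed simp
    moreover have "integrable (pareto s) (\<lambda>t. measure (nu t) E)"
      by (rule integrable_pareto[OF elim, of _ 1]) (auto simp: measure_nu_le_1)
    ultimately show ?case
      by (simp add: u_def L[OF elim] H_def)
  qed
  ultimately show "((\<lambda>s. \<Lambda> s - H E s) \<longlongrightarrow> 0) (at_right 0)"
    by (rule Lim_transform_eventually)
qed

lemma L_kappa_average:
  assumes "0 < s0" "A \<in> sets lebesgue" "B \<in> sets lebesgue" "\<forall>t\<ge>1. flow A B t \<le> ennreal M"
    and fin: "L_kappa Rp \<kappa> s0 A B < \<infinity>"
  shows "\<And>s. 0 < s \<Longrightarrow> s \<le> s0 \<Longrightarrow> ennreal s * L_kappa Rp \<kappa> s A B < \<infinity>"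
    and "((\<lambda>s. enn2real (ennreal s * L_kappa Rp \<kappa> s A B) - (LINT t|pareto s. enn2real (flow A B t)))
      \<longlongrightarrow> 0) (at_right 0)"
proof -
  have M: "\<And>t. 1 \<le> t \<Longrightarrow> flow A B t \<le> ennreal M" using assms(4) by blast
  note fin' = fin[unfolded L_kappa_eq]
  show "ennreal s * L_kappa Rp \<kappa> s A B < \<infinity>" if "0 < s" "s \<le> s0" for s
    unfolding L_kappa_eq by (rule time_average(1)[OF assms(1) flow_measurable[OF assms(2,3)] M fin' that])
  show "((\<lambda>s. enn2real (ennreal s * L_kappa Rp \<kappa> s A B) - (LINT t|pareto s. enn2real (flow A B t)))
      \<longlongrightarrow> 0) (at_right 0)"
    unfolding L_kappa_eq by (rule time_average(2)[OF assms(1) flow_measurable[OF assms(2,3)] M fin'])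
qed

text \<open>The first two parts start in \<open>E \<inter> \<Omega>\<close> and together reach all
  of \<open>- E\<close>, giving \<open>m1 * (1 - H E s)\<close>. The third ends in
  \<open>- E \<inter> \<Omega>\<close> and starts from E outside the domain, giving
  \<open>m2 * H E s\<close> up to a bounded part of E.\<close>

lemma Per_asymp:
  assumes E [measurable]: "E \<in> sets lebesgue" and \<Omega>: "open \<Omega>" "bounded \<Omega>"
    and s0: "0 < s0" and fin: "Per_kappa Rp \<kappa> s0 E \<Omega> < \<infinity>"
  defines "P \<equiv> \<lambda>s. enn2real (ennreal s * Per_kappa Rp \<kappa> s E \<Omega>)"
    and "m1 \<equiv> measure \<mu> (E \<inter> \<Omega>)" and "m2 \<equiv> measure \<mu> (- E \<inter> \<Omega>)"
  shows "\<And>s. 0 < s \<Longrightarrow> s \<le> s0 \<Longrightarrow> ennreal s * Per_kappa Rp \<kappa> s E \<Omega> = ennreal (P s)"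
    and "((\<lambda>s. P s - (2 * m1 + 2 * (m2 - m1) * H E s)) \<longlongrightarrow> 0) (at_right 0)"
proof -
  obtain \<rho> where \<rho>: "0 < \<rho>" "\<Omega> \<subseteq> cball 0 \<rho>"
    using \<Omega>(2) unfolding bounded_pos by (auto simp: subset_iff)
  define A1 where "A1 = E \<inter> \<Omega>"
  define A2 where "A2 = - E \<inter> \<Omega>"
  define S2 where "S2 = - E \<inter> - \<Omega>"
  define S3 where "S3 = E \<inter> - \<Omega>"
  have \<Omega>m [measurable]: "\<Omega> \<in> sets lebesgue" using \<Omega>(1) by simp
  have nE: "- E \<in> sets lebesgue" using sets.compl_sets[OF E] by (simp add: Compl_eq_Diff_UNIV)
  have m [measurable]: "A1 \<in> sets lebesgue" "A2 \<in> sets lebesgue" "S2 \<in> sets lebesgue" "S3 \<in> sets lebesgue"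
    using nE by (simp_all add: A1_def A2_def S2_def S3_def)
  have A\<rho>: "A1 \<subseteq> cball 0 \<rho>" "A2 \<subseteq> cball 0 \<rho>" using \<rho> by (auto simp: A1_def A2_def)
  have m_def: "m1 = measure \<mu> A1" "m2 = measure \<mu> A2" by (simp_all add: m1_def m2_def A1_def A2_def)
  have m0: "0 \<le> m1" "0 \<le> m2" by (simp_all add: m_def)
  define f1 where "f1 t = enn2real (flow A1 A2 t)" for t
  define f2 where "f2 t = enn2real (flow A1 S2 t)" for t
  define f3 where "f3 t = enn2real (flow S3 A2 t)" for t
  have le: "mm * (measure (nu t) S + err_mass \<rho> t) \<le> mm * (1 + eps \<rho>)" if "0 \<le> mm" "1 \<le> t" for mm t S
    using measure_nu_le_1[of t S] err_mass_bound[OF that(2), of \<rho>] that \<rho>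
    by (intro mult_left_mono) auto
  have close: "\<bar>f1 t - m1 * measure (nu t) A2\<bar> \<le> m1 * err_mass \<rho> t"
    "\<bar>f2 t - m1 * measure (nu t) S2\<bar> \<le> m1 * err_mass \<rho> t"
    "\<bar>f3 t - m2 * measure (nu t) S3\<bar> \<le> m2 * err_mass \<rho> t" if t: "1 \<le> t" for t
  proof -
    have t0: "0 < t" using t by simp
    have e: "0 \<le> err_mass \<rho> t" using err_mass_bound[OF t, of \<rho>] \<rho> by simp
    show "\<bar>f1 t - m1 * measure (nu t) A2\<bar> \<le> m1 * err_mass \<rho> t"
      unfolding f1_def m_def
      by (rule enn2real_close[OF flow_bounds_left[OF m(1) m(2) A\<rho>(1) t0]]) (auto simp: e)
    show "\<bar>f2 t - m1 * measure (nu t) S2\<bar> \<le> m1 * err_mass \<rho> t"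
      unfolding f2_def m_def
      by (rule enn2real_close[OF flow_bounds_left[OF m(1) m(3) A\<rho>(1) t0]]) (auto simp: e)
    show "\<bar>f3 t - m2 * measure (nu t) S3\<bar> \<le> m2 * err_mass \<rho> t"
      unfolding f3_def m_def
      by (rule enn2real_close[OF flow_bounds_right[OF m(2) m(4) A\<rho>(2) less_imp_le[OF \<rho>(1)] t0]]) (auto simp: e)
  qed
  have bd: "flow A1 A2 t \<le> ennreal (m1 * (1 + eps \<rho>))" "flow A1 S2 t \<le> ennreal (m1 * (1 + eps \<rho>))"
    "flow S3 A2 t \<le> ennreal (m2 * (1 + eps \<rho>))" if t: "1 \<le> t" for t
  proof -
    have t0: "0 < t" using t by simp
    show "flow A1 A2 t \<le> ennreal (m1 * (1 + eps \<rho>))"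
      using flow_bounds_left(1)[OF m(1) m(2) A\<rho>(1) t0] ennreal_leI[OF le[OF m0(1) t, of A2]]
      unfolding m_def by (rule order_trans)
    show "flow A1 S2 t \<le> ennreal (m1 * (1 + eps \<rho>))"
      using flow_bounds_left(1)[OF m(1) m(3) A\<rho>(1) t0] ennreal_leI[OF le[OF m0(1) t, of S2]]
      unfolding m_def by (rule order_trans)
    show "flow S3 A2 t \<le> ennreal (m2 * (1 + eps \<rho>))"
      using flow_bounds_right(1)[OF m(2) m(4) A\<rho>(2) less_imp_le[OF \<rho>(1)] t0] ennreal_leI[OF le[OF m0(2) t, of S3]]
      unfolding m_def by (rule order_trans)
  qed
  have Per: "Per_kappa Rp \<kappa> s E \<Omega> = 2 * (L_kappa Rp \<kappa> s A1 A2 + L_kappa Rp \<kappa> s A1 S2 + L_kappa Rp \<kappa> s S3 A2)" for s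
    by (simp add: Per_kappa_def A1_def A2_def S2_def S3_def)
  \<comment> \<open>The summands are nonnegative, so finiteness of the perimeter at
    \<open>s0\<close> is inherited by each of them.\<close>
  have Lfin: "L_kappa Rp \<kappa> s0 A1 A2 < \<infinity>" "L_kappa Rp \<kappa> s0 A1 S2 < \<infinity>" "L_kappa Rp \<kappa> s0 S3 A2 < \<infinity>"
    using fin unfolding Per by (auto simp: ennreal_mult_less_top less_top[symmetric])
  have bd': "\<forall>t\<ge>1. flow A1 A2 t \<le> ennreal (m1 * (1 + eps \<rho>))" "\<forall>t\<ge>1. flow A1 S2 t \<le> ennreal (m1 * (1 + eps \<rho>))"
    "\<forall>t\<ge>1. flow S3 A2 t \<le> ennreal (m2 * (1 + eps \<rho>))"
    using bd by auto
  note ta1 = L_kappa_average[OF s0 m(1) m(2) bd'(1) Lfin(1)]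
  note ta2 = L_kappa_average[OF s0 m(1) m(3) bd'(2) Lfin(2)]
  note ta3 = L_kappa_average[OF s0 m(4) m(2) bd'(3) Lfin(3)]
  have sPer: "ennreal s * Per_kappa Rp \<kappa> s E \<Omega>
    = 2 * (ennreal s * L_kappa Rp \<kappa> s A1 A2 + ennreal s * L_kappa Rp \<kappa> s A1 S2 + ennreal s * L_kappa Rp \<kappa> s S3 A2)" for s
    unfolding Per by (simp add: distrib_left mult.left_commute)
  show "ennreal s * Per_kappa Rp \<kappa> s E \<Omega> = ennreal (P s)" if "0 < s" "s \<le> s0" for s
  proof -
    have "ennreal s * Per_kappa Rp \<kappa> s E \<Omega> < top"
      unfolding sPer using ta1(1)[OF that] ta2(1)[OF that] ta3(1)[OF that]
      by (simp add: ennreal_mult_less_top)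
    then show ?thesis by (simp add: P_def)
  qed
  define u where "u t = f1 t + f2 t + f3 t - (m1 + (m2 - m1) * measure (nu t) E)" for t
  have fm [measurable]: "f1 \<in> borel_measurable borel" "f2 \<in> borel_measurable borel" "f3 \<in> borel_measurable borel"
    unfolding f1_def[abs_def] f2_def[abs_def] f3_def[abs_def] by measurable
  have um [measurable]: "u \<in> borel_measurable borel"
    unfolding u_def[abs_def] by measurable
  let ?M = "measure \<mu> (cball 0 \<rho>)"
  have u_le: "\<bar>u t\<bar> \<le> (2 * m1 + m2) * err_mass \<rho> t + m2 * (K t * ?M)" if t: "1 \<le> t" for t
  proof -
    have t0: "0 < t" using t by simp
    have 1: "measure (nu t) S2 + measure (nu t) A2 = 1 - measure (nu t) E"
      using measure_nu_split[OF t0 nE \<Omega>m] measure_nu_Compl[OF t0 E] by (simp add: S2_def A2_def)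
    have 2: "measure (nu t) E = measure (nu t) S3 + measure (nu t) A1"
      using measure_nu_split[OF t0 E \<Omega>m] by (simp add: S3_def A1_def)
    \<comment> \<open>The third flow misses the part of E inside the domain; that part is bounded,
      so its mass under \<open>nu t\<close> decays with \<open>K t\<close>.\<close>
    have 3: "m2 * measure (nu t) A1 \<le> m2 * (K t * ?M)"
      by (intro mult_left_mono measure_nu_le_K[OF t0 m(1) A\<rho>(1)] m0)
    have 4: "0 \<le> m2 * measure (nu t) A1" using m0 by simp
    have "m1 + (m2 - m1) * measure (nu t) E
      = m1 * (1 - measure (nu t) E) + m2 * measure (nu t) E"
      by (simp add: algebra_simps)
    also have "m1 * (1 - measure (nu t) E) = m1 * measure (nu t) A2 + m1 * measure (nu t) S2"
      unfolding 1[symmetric] by (simp add: algebra_simps)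
    also have "m2 * measure (nu t) E = m2 * measure (nu t) S3 + m2 * measure (nu t) A1"
      unfolding 2 by (simp add: algebra_simps)
    finally have "u t = (f1 t - m1 * measure (nu t) A2) + (f2 t - m1 * measure (nu t) S2)
      + (f3 t - m2 * measure (nu t) S3) - m2 * measure (nu t) A1"
      by (simp add: u_def)
    moreover have "(2 * m1 + m2) * err_mass \<rho> t = m1 * err_mass \<rho> t + m1 * err_mass \<rho> t + m2 * err_mass \<rho> t"
      by (simp add: algebra_simps)
    ultimately show ?thesis using close[OF t] 3 4 by linarith
  qed
  have lim_u: "((\<lambda>s. LINT t|pareto s. u t) \<longlongrightarrow> 0) (at_right 0)"
  proof (rule pareto_vanish[OF um])
    fix t :: real assume t: "1 \<le> t"
    have "(2 * m1 + m2) * err_mass \<rho> t \<le> (2 * m1 + m2) * eps \<rho>"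
      using err_mass_bound[OF t, of \<rho>] \<rho> m0 by (intro mult_left_mono) auto
    moreover have "m2 * (K t * ?M) \<le> m2 * (K 1 * ?M)"
      by (intro mult_left_mono mult_right_mono K_antimono t m0) simp
    ultimately show "\<bar>u t\<bar> \<le> (2 * m1 + m2) * eps \<rho> + m2 * (K 1 * ?M)"
      using u_le[OF t] by linarith
  next
    have "((\<lambda>t. (2 * m1 + m2) * err_mass \<rho> t + m2 * (K t * ?M)) \<longlongrightarrow> (2 * m1 + m2) * 0 + m2 * (0 * ?M)) at_top"
      by (intro tendsto_intros eps_time_tendsto K_tendsto \<rho>)
    then have "((\<lambda>t. (2 * m1 + m2) * err_mass \<rho> t + m2 * (K t * ?M)) \<longlongrightarrow> 0) at_top" by simp
    then show "(u \<longlongrightarrow> 0) at_top"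
      by (rule Lim_null_comparison[rotated])
        (use u_le in \<open>auto intro: eventually_mono[OF eventually_ge_at_top[of 1]]\<close>)
  qed
  \<comment> \<open>The contribution of times below 1 to each of the three flows, which tends to 0
    by \<open>L_kappa_average\<close>; \<open>u\<close> collects the errors at larger times.\<close>
  define r where "r s A B = enn2real (ennreal s * L_kappa Rp \<kappa> s A B) - (LINT t|pareto s. enn2real (flow A B t))" for s A B
  have "((\<lambda>s. 2 * (r s A1 A2 + r s A1 S2 + r s S3 A2 + (LINT t|pareto s. u t))) \<longlongrightarrow> 2 * (0 + 0 + 0 + 0)) (at_right 0)"
    unfolding r_def by (intro tendsto_mult tendsto_const tendsto_add ta1(2) ta2(2) ta3(2) lim_u)
  then have "((\<lambda>s. 2 * (r s A1 A2 + r s A1 S2 + r s S3 A2 + (LINT t|pareto s. u t))) \<longlongrightarrow> 0) (at_right 0)"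
    by simp
  moreover have "eventually (\<lambda>s. s \<in> {0<..<s0}) (at_right 0)"
    using s0 by (rule eventually_at_right_real)
  then have "eventually (\<lambda>s. 2 * (r s A1 A2 + r s A1 S2 + r s S3 A2 + (LINT t|pareto s. u t))
      = P s - (2 * m1 + 2 * (m2 - m1) * H E s)) (at_right 0)"
  proof eventually_elim
    case (elim s)
    then have s: "0 < s" "s \<le> s0" by auto
    have i: "integrable (pareto s) f" if "f = (\<lambda>t. enn2real (a t))" "f \<in> borel_measurable borel"
      "\<And>t. 1 \<le> t \<Longrightarrow> a t \<le> ennreal (c * (1 + eps \<rho>))" "0 \<le> c" for f a c
    proof (rule integrable_pareto[OF s(1) that(2), of "c * (1 + eps \<rho>)"])
      fix t :: real assume "1 \<le> t"
      then show "\<bar>f t\<bar> \<le> c * (1 + eps \<rho>)"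
        using that(3)[of t] that(4) eps_nonneg[of \<rho>] \<rho> by (auto simp: that(1) intro!: enn2real_leI)
    qed
    have i1: "integrable (pareto s) f1" by (rule i[OF _ fm(1) bd(1) m0(1)]) (auto simp: f1_def)
    have i2: "integrable (pareto s) f2" by (rule i[OF _ fm(2) bd(2) m0(1)]) (auto simp: f2_def)
    have i3: "integrable (pareto s) f3" by (rule i[OF _ fm(3) bd(3) m0(2)]) (auto simp: f3_def)
    have iE: "integrable (pareto s) (\<lambda>t. measure (nu t) E)"
      by (rule integrable_pareto[OF s(1), of _ 1]) (auto simp: measure_nu_le_1)
    have ic: "integrable (pareto s) (\<lambda>t. m1)"
      by (rule integrable_pareto[OF s(1), of _ "\<bar>m1\<bar>"]) auto
    have "(LINT t|pareto s. u t) = (LINT t|pareto s. f1 t) + (LINT t|pareto s. f2 t) + (LINT t|pareto s. f3 t)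
        - (m1 + (m2 - m1) * H E s)"
      unfolding u_def H_def using i1 i2 i3 iE ic s(1) by simp
    moreover have "P s = 2 * (enn2real (ennreal s * L_kappa Rp \<kappa> s A1 A2)
        + enn2real (ennreal s * L_kappa Rp \<kappa> s A1 S2) + enn2real (ennreal s * L_kappa Rp \<kappa> s S3 A2))"
    proof -
      have "enn2real (2 * (a + b + c)) = 2 * (enn2real a + enn2real b + enn2real c)"
        if "a < \<infinity>" "b < \<infinity>" "c < \<infinity>" for a b c :: ennreal
        using that by (simp add: enn2real_mult enn2real_plus ennreal_mult_less_top)
      then show ?thesis
        unfolding P_def sPer using ta1(1)[OF s] ta2(1)[OF s] ta3(1)[OF s] by blast
    qed
    ultimately show ?case
      by (simp add: r_def f1_def f2_def f3_def algebra_simps)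
  qed
  ultimately show "((\<lambda>s. P s - (2 * m1 + 2 * (m2 - m1) * H E s)) \<longlongrightarrow> 0) (at_right 0)"
    by (rule Lim_transform_eventually)
qed

end

theorem theorem1p8:
  fixes R Rp :: "'a::euclidean_space set" and \<kappa> :: "'a \<Rightarrow> real"
    and \<Omega> E :: "'a set" and s0 c_star \<eta> :: real
  defines "\<mu> \<equiv> dunkl_measure Rp \<kappa>"
  assumes setting: "dunkl_setting R Rp \<kappa>"
    and \<Omega>_open: "open \<Omega>" and \<Omega>_bounded: "bounded \<Omega>"
    and \<Omega>_inv: "\<forall>g\<in>refl_group R. \<forall>x\<in>\<Omega>. g x \<in> \<Omega>"
    and E_meas: "E \<in> sets lebesgue"
    and s0_pos: "0 < s0" "s0 < 1/2"
    and Per_fin: "Per_kappa Rp \<kappa> s0 E \<Omega> < \<infinity>"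
    and c_pos: "c_star > 0" and \<eta>: "\<eta> > 2 * s0"
    and boundary: "\<forall>r\<in>{0..1}. emeasure \<mu> (orbit_nbhd R \<Omega> r (- \<Omega>))
                                \<le> ennreal (c_star * min (r powr \<eta>) 1)"
  shows "(measure \<mu> (E \<inter> \<Omega>) = measure \<mu> (- E \<inter> \<Omega>) \<longrightarrow>
            ((\<lambda>s. ennreal s * Per_kappa Rp \<kappa> s E \<Omega>)
               \<longlongrightarrow> ennreal (2 * measure \<mu> (E \<inter> \<Omega>))) (at_right 0))
       \<and> (measure \<mu> (E \<inter> \<Omega>) \<noteq> measure \<mu> (- E \<inter> \<Omega>) \<longrightarrow>
            (((\<exists>L::real. ((\<lambda>s. ennreal s * Per_kappa Rp \<kappa> s E \<Omega>) \<longlongrightarrow> ennreal L) (at_right 0))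
              \<longleftrightarrow> (\<exists>x r (\<Xi>::real). r > 0 \<and>
                     ((\<lambda>s. ennreal s * Lambda_kappa R Rp \<kappa> E x r s) \<longlongrightarrow> ennreal \<Xi>) (at_right 0)))
             \<and> (\<forall>L \<Xi> x r. L \<ge> 0 \<longrightarrow> \<Xi> \<ge> 0 \<longrightarrow> r > 0 \<longrightarrow>
                  ((\<lambda>s. ennreal s * Per_kappa Rp \<kappa> s E \<Omega>) \<longlongrightarrow> ennreal L) (at_right 0) \<longrightarrow>
                  ((\<lambda>s. ennreal s * Lambda_kappa R Rp \<kappa> E x r s) \<longlongrightarrow> ennreal \<Xi>) (at_right 0) \<longrightarrow>
                  \<Xi> = (L - 2 * measure \<mu> (E \<inter> \<Omega>))
                        / (2 * (measure \<mu> (- E \<inter> \<Omega>) - measure \<mu> (E \<inter> \<Omega>))))))"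
proof -
  interpret dunkl R Rp \<kappa> by unfold_locales (rule setting)
  define P where "P s = enn2real (ennreal s * Per_kappa Rp \<kappa> s E \<Omega>)" for s
  define \<Lambda> where "\<Lambda> x r s = enn2real (ennreal s * Lambda_kappa R Rp \<kappa> E x r s)" for x r s
  define m1 where "m1 = measure (dunkl_measure Rp \<kappa>) (E \<inter> \<Omega>)"
  define m2 where "m2 = measure (dunkl_measure Rp \<kappa>) (- E \<inter> \<Omega>)"
  note per = Per_asymp[OF E_meas \<Omega>_open \<Omega>_bounded s0_pos(1) Per_fin, folded m1_def m2_def P_def]
  note lam = Lambda_asymp[OF E_meas, folded \<Lambda>_def]
  have m1: "0 \<le> m1" by (simp add: m1_def)
  have "eventually (\<lambda>s. s \<in> {0<..<s0}) (at_right 0)"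
    using s0_pos(1) by (rule eventually_at_right_real)
  then have "eventually (\<lambda>s. ennreal s * Per_kappa Rp \<kappa> s E \<Omega> = ennreal (P s)) (at_right 0)"
    by eventually_elim (use per(1) in auto)
  then have P_iff: "((\<lambda>s. ennreal s * Per_kappa Rp \<kappa> s E \<Omega>) \<longlongrightarrow> ennreal L) (at_right 0)
      \<longleftrightarrow> (P \<longlongrightarrow> max L 0) (at_right 0)" for L
    by (rule tendsto_ennreal_max_iff) (simp add: P_def)
  have \<Lambda>_iff: "((\<lambda>s. ennreal s * Lambda_kappa R Rp \<kappa> E x r s) \<longlongrightarrow> ennreal L) (at_right 0)
      \<longleftrightarrow> (\<Lambda> x r \<longlongrightarrow> max L 0) (at_right 0)" if "0 < r" for x r L
  proof (rule tendsto_ennreal_max_iff)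
    show "eventually (\<lambda>s. ennreal s * Lambda_kappa R Rp \<kappa> E x r s = ennreal (\<Lambda> x r s)) (at_right 0)"
      using eventually_at_right_less[of "0::real"] by eventually_elim (rule lam(1)[OF that])
  qed (simp add: \<Lambda>_def)
  \<comment> \<open>\<open>H E\<close> does not involve x or r, so it links the limits for different
    base points and radii.\<close>
  have H_\<Lambda>: "(H E \<longlongrightarrow> X) (at_right 0) \<longleftrightarrow> (\<Lambda> x r \<longlongrightarrow> X) (at_right 0)" if "0 < r" for x r X
  proof
    assume "(H E \<longlongrightarrow> X) (at_right 0)"
    from tendsto_add[OF lam(2)[OF that, of x] this] show "(\<Lambda> x r \<longlongrightarrow> X) (at_right 0)" by simp
  next
    assume "(\<Lambda> x r \<longlongrightarrow> X) (at_right 0)"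
    from tendsto_diff[OF this lam(2)[OF that, of x]] show "(H E \<longlongrightarrow> X) (at_right 0)" by simp
  qed
  have H_P: "(P \<longlongrightarrow> 2 * m1 + 2 * (m2 - m1) * X) (at_right 0)" if "(H E \<longlongrightarrow> X) (at_right 0)" for X
  proof -
    have "((\<lambda>s. 2 * m1 + 2 * (m2 - m1) * H E s) \<longlongrightarrow> 2 * m1 + 2 * (m2 - m1) * X) (at_right 0)"
      by (intro tendsto_intros that)
    from tendsto_add[OF per(2) this] show ?thesis by simp
  qed
  \<comment> \<open>The affine relation is solved for \<open>H E\<close>, which is possible as its
    slope \<open>2 * (m2 - m1)\<close> is nonzero; this is the quotient in the theorem.\<close>
  have P_H: "(H E \<longlongrightarrow> (L - 2 * m1) / (2 * (m2 - m1))) (at_right 0)"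
    if "(P \<longlongrightarrow> L) (at_right 0)" "m1 \<noteq> m2" for L
  proof -
    have "((\<lambda>s. (P s - (P s - (2 * m1 + 2 * (m2 - m1) * H E s)) - 2 * m1) / (2 * (m2 - m1)))
      \<longlongrightarrow> (L - 0 - 2 * m1) / (2 * (m2 - m1))) (at_right 0)"
      using that(2) by (intro tendsto_intros that(1) per(2)) auto
    then show ?thesis using that(2) by simp
  qed
  \<comment> \<open>Limits of the nonnegative functions \<open>P\<close> and
    \<open>\<Lambda>\<close> are nonnegative, so the truncation in \<open>ennreal\<close> does not
    alter them.\<close>
  have lim_nonneg: "max X 0 = X" if "(f \<longlongrightarrow> X) (at_right (0::real))" "\<And>s. 0 \<le> (f s :: real)" for f X
    using tendsto_lowerbound[OF that(1), of 0] that(2) by simp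
  show ?thesis
    unfolding \<mu>_def m1_def[symmetric] m2_def[symmetric]
  proof (intro conjI impI)
    assume eq: "m1 = m2"
    have "(P \<longlongrightarrow> 2 * m1) (at_right 0)" using per(2) eq tendsto_add[OF per(2) tendsto_const[of "2 * m1"]] by simp
    then show "((\<lambda>s. ennreal s * Per_kappa Rp \<kappa> s E \<Omega>) \<longlongrightarrow> ennreal (2 * m1)) (at_right 0)"
      unfolding P_iff using m1 by simp
  next
    assume neq: "m1 \<noteq> m2"
    show "(\<exists>L. ((\<lambda>s. ennreal s * Per_kappa Rp \<kappa> s E \<Omega>) \<longlongrightarrow> ennreal L) (at_right 0))
      \<longleftrightarrow> (\<exists>x r \<Xi>. r > 0 \<and> ((\<lambda>s. ennreal s * Lambda_kappa R Rp \<kappa> E x r s) \<longlongrightarrow> ennreal \<Xi>) (at_right 0))"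
    proof
      assume "\<exists>L. ((\<lambda>s. ennreal s * Per_kappa Rp \<kappa> s E \<Omega>) \<longlongrightarrow> ennreal L) (at_right 0)"
      then obtain L where "(P \<longlongrightarrow> L) (at_right 0)" unfolding P_iff by blast
      from P_H[OF this neq] obtain X where "(H E \<longlongrightarrow> X) (at_right 0)" by blast
      \<comment> \<open>The base point 0 and radius 1 are an arbitrary choice, since
        \<open>H_\<Lambda>\<close> holds for all of them.\<close>
      then have X: "(\<Lambda> 0 1 \<longlongrightarrow> X) (at_right 0)" by (subst H_\<Lambda>[symmetric]) auto
      then have "max X 0 = X" by (rule lim_nonneg) (simp add: \<Lambda>_def)
      then have "((\<lambda>s. ennreal s * Lambda_kappa R Rp \<kappa> E 0 1 s) \<longlongrightarrow> ennreal X) (at_right 0)"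
        using X by (simp add: \<Lambda>_iff)
      then show "\<exists>x r \<Xi>. r > 0 \<and> ((\<lambda>s. ennreal s * Lambda_kappa R Rp \<kappa> E x r s) \<longlongrightarrow> ennreal \<Xi>) (at_right 0)"
        using zero_less_one by blast
    next
      assume "\<exists>x r \<Xi>. r > 0 \<and> ((\<lambda>s. ennreal s * Lambda_kappa R Rp \<kappa> E x r s) \<longlongrightarrow> ennreal \<Xi>) (at_right 0)"
      then obtain x r \<Xi> where r: "r > 0"
        and "((\<lambda>s. ennreal s * Lambda_kappa R Rp \<kappa> E x r s) \<longlongrightarrow> ennreal \<Xi>) (at_right 0)" by blast
      then have "(\<Lambda> x r \<longlongrightarrow> max \<Xi> 0) (at_right 0)" by (simp add: \<Lambda>_iff)
      then have "(H E \<longlongrightarrow> max \<Xi> 0) (at_right 0)" using H_\<Lambda>[OF r] by blast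
      from H_P[OF this] obtain L where L: "(P \<longlongrightarrow> L) (at_right 0)" by blast
      then have "max L 0 = L" by (rule lim_nonneg) (simp add: P_def)
      then show "\<exists>L. ((\<lambda>s. ennreal s * Per_kappa Rp \<kappa> s E \<Omega>) \<longlongrightarrow> ennreal L) (at_right 0)"
        unfolding P_iff using L by metis
    qed
    show "\<forall>L \<Xi> x r. L \<ge> 0 \<longrightarrow> \<Xi> \<ge> 0 \<longrightarrow> r > 0 \<longrightarrow>
        ((\<lambda>s. ennreal s * Per_kappa Rp \<kappa> s E \<Omega>) \<longlongrightarrow> ennreal L) (at_right 0) \<longrightarrow>
        ((\<lambda>s. ennreal s * Lambda_kappa R Rp \<kappa> E x r s) \<longlongrightarrow> ennreal \<Xi>) (at_right 0) \<longrightarrow>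
        \<Xi> = (L - 2 * m1) / (2 * (m2 - m1))"
    proof (intro allI impI)
      fix L \<Xi> r :: real and x :: 'a
      assume L: "L \<ge> 0" and \<Xi>: "\<Xi> \<ge> 0" and r: "r > 0"
        and PL: "((\<lambda>s. ennreal s * Per_kappa Rp \<kappa> s E \<Omega>) \<longlongrightarrow> ennreal L) (at_right 0)"
        and \<Lambda>L: "((\<lambda>s. ennreal s * Lambda_kappa R Rp \<kappa> E x r s) \<longlongrightarrow> ennreal \<Xi>) (at_right 0)"
      have "(H E \<longlongrightarrow> (L - 2 * m1) / (2 * (m2 - m1))) (at_right 0)"
        using PL L by (intro P_H neq) (simp add: P_iff)
      moreover have "(H E \<longlongrightarrow> \<Xi>) (at_right 0)"
        using \<Lambda>L \<Xi> H_\<Lambda>[OF r, of \<Xi> x] by (simp add: \<Lambda>_iff[OF r])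
      ultimately show "\<Xi> = (L - 2 * m1) / (2 * (m2 - m1))"
        by (intro tendsto_unique[of "at_right (0::real)"]) auto
    qed
  qed
qed

end
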